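(* Let $\lambda\ge0$, let $\psi\in C(\bar I)$ satisfy $\psi(0)<0$ and $\psi(1)<0$, let $u_0\in K$ and $T>0$. Let $u$ be a weak solution of the obstacle problem (P) on $[0,T]$ with initial datum $u_0$, and suppose that $u$ is smooth, i.e. $u\in C^\infty(\bar I\times[0,T])$. Write $\gamma_u(x,t)=(x,u(x,t))$ and $\mathcal{N}_t:=\{x\in I\mid u(x,t)>\psi(x)\}$. Then: (i) $u(x,t)\ge\psi(x)$ for all $x\in I$, $t\in[0,T]$; (ii) for every $t\in(0,T]$ and every $\eta\in C^\infty_{\rm c}(\mathcal{N}_t;\mathbf{R}^2)$, \[ \int_I\langle\partial_t^\perp\gamma_u,\eta\rangle\,\mathrm{d}s=-\int_I\langle\nabla_{L^2}\mathcal{E}_\lambda[\gamma_u],\eta\rangle\,\mathrm{d}s; \] (iii) $\gamma_u(0,t)=(0,0)$ and $\gamma_u(1,t)=(1,0)$ for all $t\in[0,T]$; (iv) the curvature vector $\kappa_u$ of $\gamma_u$ satisfies $\kappa_u(0,t)=\kappa_u(1,t)=0$ for all $t\in(0,T]$. Moreover, for all $t\in(0,T]$ (with one-sided derivative at $t=T$), \[ \frac{d}{dt}\mathcal{E}_\lambda[\gamma_u(t)]=-\int_I|\partial_t^\perp\gamma_u|^2\,\mathrm{d}s . \]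
   Context: $I:=(0,1)$, $\bar I:=[0,1]$. $H(I):=H^2(I)\cap H^1_0(I)$. $K:=\{u\in H(I)\mid u\ge\psi \text{ in } I\}$. A prime denotes the derivative in $x$. $|\gamma_u'|=\sqrt{1+(u')^2}$. For $T>0$, \[ K_T:=\{u\in L^\infty(0,T;H(I))\cap H^1(0,T;L^2(I))\mid u\ge\psi\ \text{in } I\times(0,T)\}. \] Weak solution of (P) on $[0,T]$ with initial datum $u_0$: a function $u:\bar I\times[0,T]\to\mathbf{R}$ such that (a) $u\in K_T$; (b) for all $v\in K_T$, \[ \int_0^T\!\!\int_I\bigg[\frac{\partial_t u\,(v-u)}{|\gamma_u'|}+2\frac{u''(v-u)''}{|\gamma_u'|^5}-5\frac{|u''|^2u'(v-u)'}{|\gamma_u'|^7}-\lambda\frac{u''(v-u)}{|\gamma_u'|^3}\bigg]\,\mathrm{d}x\,\mathrm{d}t\ge 0; \] (c) the unique $C([0,T];L^2(I))$-representative of $u$ satisfies $u(0)=u_0$. For an immersed planar curve $\gamma$: $\mathrm{d}s=|\gamma'|\,\mathrm{d}x$, $\partial_s=|\gamma'|^{-1}\partial_x$, curvature vector $\kappa=\partial_s^2\gamma$, $\mathcal{E}_\lambda[\gamma]=\int_\gamma|\kappa|^2\,\mathrm{d}s+\lambda\int_\gamma\mathrm{d}s$. The $L^2(\mathrm{d}s)$-gradient is $\nabla_{L^2}\mathcal{E}_\lambda[\gamma]=2\nabla_s^2\kappa+|\kappa|^2\kappa-\lambda\kappa$, where $\nabla_s f:=\partial_s f-\langle\partial_s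 f,\partial_s\gamma\rangle\partial_s\gamma$. The normal velocity is $\partial_t^\perp\gamma:=\partial_t\gamma-\langle\partial_t\gamma,\partial_s\gamma\rangle\partial_s\gamma$. *)

theory Defs
  imports "HOL-Analysis.Analysis"
begin

abbreviation I01 :: "real set"
  where "I01 \<equiv> {0<..<1}"

abbreviation leb_I :: "real measure"
  where "leb_I \<equiv> lebesgue_on {0<..<1}"

definition smooth :: "(real \<Rightarrow> real) \<Rightarrow> bool"
  where "smooth f \<longleftrightarrow> (\<forall>n. ((deriv ^^ n) f) differentiable_on UNIV)"

text \<open>The space of test functions on \<open>S\<close>, extended by zero to the real line.\<close>

definition test_fun :: "real set \<Rightarrow> (real \<Rightarrow> real) set"
  where "test_fun S = {\<phi>. smooth \<phi> \<and> (\<exists>C. compact C \<and> C \<subseteq> S \<and> (\<forall>x. x \<notin> C \<longrightarrow> \<phi> x = 0))}"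

definition test_fun2 :: "real set \<Rightarrow> (real \<Rightarrow> real \<times> real) set"
  where "test_fun2 S = {\<eta>. (\<lambda>x. fst (\<eta> x)) \<in> test_fun S \<and> (\<lambda>x. snd (\<eta> x)) \<in> test_fun S}"

section \<open>Sobolev spaces on the unit interval\<close>

text \<open>Elements of the spaces below are represented by functions on the real line of which only
  the values on \<open>(0,1)\<close> matter, up to null sets; equality and order between them are
  almost-everywhere relations.\<close>

definition L2 :: "(real \<Rightarrow> real) set"
  where "L2 = {f. f \<in> borel_measurable leb_I \<and> integrable leb_I (\<lambda>x. (f x)\<^sup>2)}"

definition L2_norm :: "(real \<Rightarrow> real) \<Rightarrow> real"
  where "L2_norm f = sqrt (\<integral>x. (f x)\<^sup>2 \<partial>leb_I)"

definition has_weak_deriv :: "(real \<Rightarrow> real) \<Rightarrow> (real \<Rightarrow> real) \<Rightarrow> bool"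
  where "has_weak_deriv f g \<longleftrightarrow>
    (\<forall>\<phi>\<in>test_fun I01. (\<integral>x. f x * deriv \<phi> x \<partial>leb_I) = - (\<integral>x. g x * \<phi> x \<partial>leb_I))"

definition H1 :: "(real \<Rightarrow> real) set"
  where "H1 = {f \<in> L2. \<exists>g\<in>L2. has_weak_deriv f g}"

text \<open>A representative; it is unique up to null sets for \<open>f\<close> in \<open>H1\<close>.\<close>

definition weak_deriv :: "(real \<Rightarrow> real) \<Rightarrow> real \<Rightarrow> real"
  where "weak_deriv f = (SOME g. g \<in> L2 \<and> has_weak_deriv f g)"

definition H2 :: "(real \<Rightarrow> real) set"
  where "H2 = {f \<in> H1. weak_deriv f \<in> H1}"

definition H1_norm :: "(real \<Rightarrow> real) \<Rightarrow> real"
  where "H1_norm f = sqrt ((L2_norm f)\<^sup>2 + (L2_norm (weak_deriv f))\<^sup>2)"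

definition H2_norm :: "(real \<Rightarrow> real) \<Rightarrow> real"
  where "H2_norm f =
    sqrt ((L2_norm f)\<^sup>2 + (L2_norm (weak_deriv f))\<^sup>2 + (L2_norm (weak_deriv (weak_deriv f)))\<^sup>2)"

definition H1_0 :: "(real \<Rightarrow> real) set"
  where "H1_0 = {f \<in> H1. \<exists>\<phi>. (\<forall>n. \<phi> n \<in> test_fun I01) \<and>
      (\<lambda>n::nat. H1_norm (\<lambda>x. f x - \<phi> n x)) \<longlonglongrightarrow> 0}"

definition H_space :: "(real \<Rightarrow> real) set"
  where "H_space = H2 \<inter> H1_0"

definition K_set :: "(real \<Rightarrow> real) \<Rightarrow> (real \<Rightarrow> real) set"
  where "K_set \<psi> = {f \<in> H_space. AE x in leb_I. f x \<ge> \<psi> x}"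

section \<open>Bochner spaces on the time interval\<close>

text \<open>Strong measurability on \<open>(0,T)\<close> with values in the space \<open>X\<close> normed by \<open>N\<close>.\<close>

definition bochner_measurable ::
    "real \<Rightarrow> (real \<Rightarrow> real) set \<Rightarrow> ((real \<Rightarrow> real) \<Rightarrow> real) \<Rightarrow> (real \<Rightarrow> real \<Rightarrow> real) \<Rightarrow> bool"
  where "bochner_measurable T X N U \<longleftrightarrow>
    (AE t in lebesgue_on {0<..<T}. U t \<in> X) \<and>
    (\<exists>s :: nat \<Rightarrow> real \<Rightarrow> real \<Rightarrow> real.
       (\<forall>n. simple_function (lebesgue_on {0<..<T}) (s n) \<and> (\<forall>t\<in>{0<..<T}. s n t \<in> X)) \<and>
       (AE t in lebesgue_on {0<..<T}. (\<lambda>n. N (\<lambda>x. s n t x - U t x)) \<longlonglongrightarrow> 0))"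

definition Linf_H :: "real \<Rightarrow> (real \<Rightarrow> real \<Rightarrow> real) set"
  where "Linf_H T = {U. bochner_measurable T H_space H2_norm U \<and>
      (\<exists>M. AE t in lebesgue_on {0<..<T}. H2_norm (U t) \<le> M)}"

definition L2_L2 :: "real \<Rightarrow> (real \<Rightarrow> real \<Rightarrow> real) set"
  where "L2_L2 T = {U. bochner_measurable T L2 L2_norm U \<and>
      integrable (lebesgue_on {0<..<T}) (\<lambda>t. (L2_norm (U t))\<^sup>2)}"

text \<open>\<open>W\<close> is the weak derivative of \<open>U\<close> if \<open>\<integral> \<phi>' U dt = - \<integral> \<phi> W dt\<close> as Bochner integrals in
  \<open>L2\<close>, for all scalar test functions \<open>\<phi>\<close>. An identity in \<open>L2\<close> holds iff it holds after taking
  the inner product with every \<open>g\<close> in \<open>L2\<close>, which commutes with the Bochner integral.\<close>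

definition has_weak_time_deriv ::
    "real \<Rightarrow> (real \<Rightarrow> real \<Rightarrow> real) \<Rightarrow> (real \<Rightarrow> real \<Rightarrow> real) \<Rightarrow> bool"
  where "has_weak_time_deriv T U W \<longleftrightarrow>
    (\<forall>\<phi>\<in>test_fun {0<..<T}. \<forall>g\<in>L2.
       (\<integral>t. deriv \<phi> t * (\<integral>x. U t x * g x \<partial>leb_I) \<partial>lebesgue_on {0<..<T}) =
       - (\<integral>t. \<phi> t * (\<integral>x. W t x * g x \<partial>leb_I) \<partial>lebesgue_on {0<..<T}))"

definition H1_L2 :: "real \<Rightarrow> (real \<Rightarrow> real \<Rightarrow> real) set"
  where "H1_L2 T = {U \<in> L2_L2 T. \<exists>W\<in>L2_L2 T. has_weak_time_deriv T U W}"

definition weak_time_deriv :: "real \<Rightarrow> (real \<Rightarrow> real \<Rightarrow> real) \<Rightarrow> real \<Rightarrow> real \<Rightarrow> real"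
  where "weak_time_deriv T U = (SOME W. W \<in> L2_L2 T \<and> has_weak_time_deriv T U W)"

definition C_L2 :: "real \<Rightarrow> (real \<Rightarrow> real \<Rightarrow> real) set"
  where "C_L2 T = {U. \<forall>t\<in>{0..T}. U t \<in> L2 \<and>
      ((\<lambda>s. L2_norm (\<lambda>x. U s x - U t x)) \<longlongrightarrow> 0) (at t within {0..T})}"

section \<open>Weak solutions of the obstacle problem\<close>

text \<open>Space-time functions take the space variable first, \<open>u x t\<close>; \<open>slice u\<close> is the associated
  function of time with values in a space of functions of \<open>x\<close>.\<close>

definition slice :: "(real \<Rightarrow> real \<Rightarrow> real) \<Rightarrow> real \<Rightarrow> real \<Rightarrow> real"
  where "slice u t = (\<lambda>x. u x t)"

definition K_T :: "(real \<Rightarrow> real) \<Rightarrow> real \<Rightarrow> (real \<Rightarrow> real \<Rightarrow> real) set"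
  where "K_T \<psi> T = {u. slice u \<in> Linf_H T \<and> slice u \<in> H1_L2 T \<and>
      (AE t in lebesgue_on {0<..<T}. AE x in leb_I. u x t \<ge> \<psi> x)}"

text \<open>The integrand of the variational inequality at a fixed time: \<open>ut\<close> stands for \<open>\<partial>\<^sub>t u\<close>, and
  \<open>sqrt (1 + p\<^sup>2)\<close> with \<open>p = u'\<close> is the length element of the graph.\<close>

definition vi_integrand ::
    "real \<Rightarrow> (real \<Rightarrow> real) \<Rightarrow> (real \<Rightarrow> real) \<Rightarrow> (real \<Rightarrow> real) \<Rightarrow> real \<Rightarrow> real"
  where "vi_integrand lam u ut v x =
    (let w = (\<lambda>y. v y - u y);
         u1 = weak_deriv u; u2 = weak_deriv u1;
         w1 = weak_deriv w; w2 = weak_deriv w1;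
         l = sqrt (1 + (u1 x)\<^sup>2)
     in ut x * w x / l + 2 * (u2 x * w2 x / l ^ 5)
        - 5 * (\<bar>u2 x\<bar>\<^sup>2 * u1 x * w1 x / l ^ 7) - lam * (u2 x * w x / l ^ 3))"

definition weak_solution ::
    "real \<Rightarrow> (real \<Rightarrow> real) \<Rightarrow> real \<Rightarrow> (real \<Rightarrow> real) \<Rightarrow> (real \<Rightarrow> real \<Rightarrow> real) \<Rightarrow> bool"
  where "weak_solution lam \<psi> T u0 u \<longleftrightarrow>
    u \<in> K_T \<psi> T \<and>
    (\<forall>v\<in>K_T \<psi> T.
       (\<integral>t. (\<integral>x. vi_integrand lam (slice u t) (weak_time_deriv T (slice u) t) (slice v t) x \<partial>leb_I)
          \<partial>lebesgue_on {0<..<T}) \<ge> 0) \<and>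
    (\<exists>U\<in>C_L2 T.
       (AE t in lebesgue_on {0<..<T}. AE x in leb_I. U t x = u x t) \<and>
       (AE x in leb_I. U 0 x = u0 x))"

text \<open>\<open>C\<^sup>\<infinity>\<close> on the closed rectangle \<open>[0,1] \<times> [0,T]\<close>: \<open>D i j\<close> is the mixed partial derivative of
  order \<open>i\<close> in \<open>x\<close> and \<open>j\<close> in \<open>t\<close>, one-sided at the boundary.\<close>

definition smooth_closed_rect :: "real \<Rightarrow> (real \<Rightarrow> real \<Rightarrow> real) \<Rightarrow> bool"
  where "smooth_closed_rect T u \<longleftrightarrow>
    (\<exists>D :: nat \<Rightarrow> nat \<Rightarrow> real \<Rightarrow> real \<Rightarrow> real.
       (\<forall>x\<in>{0..1}. \<forall>t\<in>{0..T}. D 0 0 x t = u x t) \<and>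
       (\<forall>i j. continuous_on ({0..1} \<times> {0..T}) (\<lambda>(x, t). D i j x t) \<and>
          (\<forall>x\<in>{0..1}. \<forall>t\<in>{0..T}.
             ((\<lambda>y. D i j y t) has_real_derivative D (Suc i) j x t) (at x within {0..1}) \<and>
             ((\<lambda>s. D i j x s) has_real_derivative D i (Suc j) x t) (at t within {0..T}))))"

section \<open>Geometry of planar curves parametrised over the unit interval\<close>

text \<open>Derivatives are one-sided at the endpoints of \<open>[0,1]\<close>.\<close>

definition deriv_x :: "(real \<Rightarrow> real \<times> real) \<Rightarrow> real \<Rightarrow> real \<times> real"
  where "deriv_x f x = vector_derivative f (at x within {0..1})"

definition deriv_s :: "(real \<Rightarrow> real \<times> real) \<Rightarrow> (real \<Rightarrow> real \<times> real) \<Rightarrow> real \<Rightarrow> real \<times> real"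
  where "deriv_s \<gamma> f x = (1 / norm (deriv_x \<gamma> x)) *\<^sub>R deriv_x f x"

definition curvature :: "(real \<Rightarrow> real \<times> real) \<Rightarrow> real \<Rightarrow> real \<times> real"
  where "curvature \<gamma> = deriv_s \<gamma> (deriv_s \<gamma> \<gamma>)"

definition normal_part :: "(real \<Rightarrow> real \<times> real) \<Rightarrow> real \<Rightarrow> real \<times> real \<Rightarrow> real \<times> real"
  where "normal_part \<gamma> x w = w - (w \<bullet> deriv_s \<gamma> \<gamma> x) *\<^sub>R deriv_s \<gamma> \<gamma> x"

definition nabla_s :: "(real \<Rightarrow> real \<times> real) \<Rightarrow> (real \<Rightarrow> real \<times> real) \<Rightarrow> real \<Rightarrow> real \<times> real"
  where "nabla_s \<gamma> f x = normal_part \<gamma> x (deriv_s \<gamma> f x)"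

definition integral_ds :: "(real \<Rightarrow> real \<times> real) \<Rightarrow> (real \<Rightarrow> real) \<Rightarrow> real"
  where "integral_ds \<gamma> f = (\<integral>x. f x * norm (deriv_x \<gamma> x) \<partial>leb_I)"

definition elastic_energy :: "real \<Rightarrow> (real \<Rightarrow> real \<times> real) \<Rightarrow> real"
  where "elastic_energy lam \<gamma> =
    integral_ds \<gamma> (\<lambda>x. (norm (curvature \<gamma> x))\<^sup>2) + lam * integral_ds \<gamma> (\<lambda>x. 1)"

definition grad_energy :: "real \<Rightarrow> (real \<Rightarrow> real \<times> real) \<Rightarrow> real \<Rightarrow> real \<times> real"
  where "grad_energy lam \<gamma> x =
    2 *\<^sub>R nabla_s \<gamma> (nabla_s \<gamma> (curvature \<gamma>)) x
    + (norm (curvature \<gamma> x))\<^sup>2 *\<^sub>R curvature \<gamma> x - lam *\<^sub>R curvature \<gamma> x"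

definition graph_curve :: "(real \<Rightarrow> real \<Rightarrow> real) \<Rightarrow> real \<Rightarrow> real \<Rightarrow> real \<times> real"
  where "graph_curve u t = (\<lambda>x. (x, u x t))"

text \<open>Normal velocity at time \<open>t\<close> of a family \<open>\<Gamma>\<close> of curves, with \<open>\<Gamma> t\<close> the curve at time \<open>t\<close>;
  the time derivative is one-sided at the endpoints of \<open>[0,T]\<close>.\<close>

definition normal_velocity ::
    "real \<Rightarrow> (real \<Rightarrow> real \<Rightarrow> real \<times> real) \<Rightarrow> real \<Rightarrow> real \<Rightarrow> real \<times> real"
  where "normal_velocity T \<Gamma> t x =
    normal_part (\<Gamma> t) x (vector_derivative (\<lambda>s. \<Gamma> s x) (at t within {0..T}))"

definition noncoincidence_set ::
    "(real \<Rightarrow> real) \<Rightarrow> (real \<Rightarrow> real \<Rightarrow> real) \<Rightarrow> real \<Rightarrow> real set"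
  where "noncoincidence_set \<psi> u t = {x \<in> I01. u x t > \<psi> x}"

end

theory Submission
  imports Defs
begin

text \<open>Testing the variational inequality with \<open>v = u \<plusminus> \<epsilon> \<theta>(t) \<phi>(x)\<close>, where \<open>u - \<psi>\<close> is bounded away
  from zero on the support of \<open>\<theta> \<phi>\<close>, gives an equality. With interior bumps \<open>\<phi>\<close> this is the pointwise
  equation \<open>\<partial>\<^sub>t u / |\<gamma>'| + G = 0\<close> on the noncoincidence set, where \<open>\<nabla>E = G N\<close> with unit normal \<open>N\<close>.
  Since \<open>\<psi> < 0\<close> at the endpoints, \<open>\<phi>\<close> may also have nonzero slope there, and the boundary term
  \<open>u'' \<phi>'\<close> yields the natural condition \<open>u'' = 0\<close>. On the coincidence set \<open>u(x, \<cdot>)\<close> is minimal, so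
  \<open>\<partial>\<^sub>t u = 0\<close> at interior times; hence \<open>G \<partial>\<^sub>t u = - (\<partial>\<^sub>t u)\<^sup>2 / |\<gamma>'|\<close> everywhere, which is the
  dissipation identity. The time \<open>T\<close> is reached by continuity. The weak derivatives in the
  definition are identified with the classical ones by the fundamental lemma of the calculus of
  variations.\<close>

section \<open>Smooth functions and cutoffs\<close>

text \<open>Two features of the setting shape the work. All derivatives in the definition are choice
  representatives determined up to null sets, and each conclusion first holds only for almost every
  time. What repairs this is smoothness of u: gap, traces, residual and moments are continuous, so
  whatever holds almost everywhere holds everywhere. The integrand itself has a geometric origin.
  For a vertical direction (0,w) the pairing of the normal velocity with it in ds is
  (\<partial>u/\<partial>t) w / |\<gamma>'| dx. The coefficients 2 and -5 come from differentiating
  the density u''^2 / |\<gamma>'|^5 of the bending energy in u'' and u', while the length term is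
  already integrated by parts. The expression is linear in v - u, so equality follows as soon as a
  perturbation is admissible with both signs. Passing to vector-valued \<eta> costs nothing, because
  velocity and gradient are both multiples of the unit normal.\<close>

primrec ndiff :: "nat \<Rightarrow> (real \<Rightarrow> real) \<Rightarrow> bool" where
  "ndiff 0 f = True"
| "ndiff (Suc n) f = (\<exists>g. (\<forall>x. (f has_real_derivative g x) (at x)) \<and> ndiff n g)"

lemma smooth_has_deriv: "smooth f \<Longrightarrow> (f has_real_derivative deriv f x) (at x)"
  unfolding smooth_def
  by (metis DERIV_deriv_iff_real_differentiable differentiable_on_def iso_tuple_UNIV_I funpow_0)

lemma smooth_deriv: "smooth f \<Longrightarrow> smooth (deriv f)"
  unfolding smooth_def by (metis comp_apply funpow_Suc_right)

lemma smooth_imp_ndiff: "smooth f \<Longrightarrow> ndiff n f"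
  by (induction n arbitrary: f) (auto intro: smooth_has_deriv smooth_deriv)

lemma ndiff_imp_differentiable: "ndiff (Suc n) f \<Longrightarrow> (deriv ^^ n) f differentiable_on UNIV"
proof (induction n arbitrary: f)
  case 0
  then show ?case
    by (auto simp: differentiable_on_def real_differentiable_def)
next
  case (Suc n)
  then obtain g where g: "\<And>x. (f has_real_derivative g x) (at x)" "ndiff (Suc n) g"
    using ndiff.simps(2) by blast
  have "deriv f = g"
    using g(1) by (auto intro: DERIV_imp_deriv)
  then show ?case
    using Suc.IH[OF g(2)] by (simp add: funpow_swap1)
qed

text \<open>\<open>ndiff n\<close> replaces iterated \<open>deriv\<close> by existentially
  quantified derivatives, so closure under sums, products, reciprocals and affine substitution is a
  plain induction on \<open>n\<close>; this equivalence carries the results back to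
  \<open>smooth\<close>.\<close>

lemma smooth_iff_ndiff: "smooth f \<longleftrightarrow> (\<forall>n. ndiff n f)"
  using smooth_imp_ndiff ndiff_imp_differentiable unfolding smooth_def by blast

lemma ndiff_SucI:
  "ndiff n g \<Longrightarrow> (\<And>x. (f has_real_derivative g x) (at x)) \<Longrightarrow> ndiff (Suc n) f"
  by auto

lemma ndiff_mono: "ndiff (Suc n) f \<Longrightarrow> ndiff n f"
  by (induction n arbitrary: f) auto

lemma ndiff_add: "ndiff n f \<Longrightarrow> ndiff n g \<Longrightarrow> ndiff n (\<lambda>x. f x + g x)"
proof (induction n arbitrary: f g)
  case (Suc n)
  then obtain f' g' where "\<forall>x. (f has_real_derivative f' x) (at x)" "ndiff n f'"
    "\<forall>x. (g has_real_derivative g' x) (at x)" "ndiff n g'" by auto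
  then show ?case
    by (auto intro!: exI[of _ "\<lambda>x. f' x + g' x"] derivative_intros Suc.IH)
qed auto

lemma ndiff_const: "ndiff n (\<lambda>x. c)"
  by (induction n arbitrary: c) (auto intro: exI[of _ "\<lambda>x. 0"])

lemma ndiff_mult: "ndiff n f \<Longrightarrow> ndiff n g \<Longrightarrow> ndiff n (\<lambda>x. f x * g x)"
proof (induction n arbitrary: f g)
  case (Suc n)
  then obtain f' g' where *: "\<forall>x. (f has_real_derivative f' x) (at x)" "ndiff n f'"
    "\<forall>x. (g has_real_derivative g' x) (at x)" "ndiff n g'" by auto
  have "ndiff n (\<lambda>x. f' x * g x + g' x * f x)"
    by (intro ndiff_add Suc.IH *(2,4) Suc.prems[THEN ndiff_mono])
  then show ?case
    using * by (auto intro!: exI[of _ "\<lambda>x. f' x * g x + g' x * f x"] DERIV_mult)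
qed auto

lemma ndiff_inverse: "ndiff n f \<Longrightarrow> (\<And>x. f x \<noteq> 0) \<Longrightarrow> ndiff n (\<lambda>x. inverse (f x))"
proof (induction n arbitrary: f)
  case (Suc n)
  then obtain f' where *: "\<forall>x. (f has_real_derivative f' x) (at x)" "ndiff n f'" by auto
  \<comment> \<open>The derivative -f'/f^2 is written with two factors \<open>inverse (f x)\<close>,
    so that the induction hypothesis at order \<open>n\<close> applies to the reciprocal
    itself.\<close>
  have "ndiff n (\<lambda>x. (- 1) * (inverse (f x) * f' x * inverse (f x)))"
    by (intro ndiff_mult Suc.IH ndiff_const *(2) Suc.prems(2) ndiff_mono[OF Suc.prems(1)])
  moreover have "((\<lambda>x. inverse (f x)) has_real_derivative
      (- 1) * (inverse (f x) * f' x * inverse (f x))) (at x)" for x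
    using DERIV_inverse'[of f "f' x" x UNIV] * Suc.prems by simp
  ultimately show ?case by (rule ndiff_SucI)
qed auto

lemma ndiff_affine: "ndiff n f \<Longrightarrow> ndiff n (\<lambda>x. f (a * x + b))"
proof (induction n arbitrary: f)
  case (Suc n)
  then obtain f' where *: "\<forall>x. (f has_real_derivative f' x) (at x)" "ndiff n f'" by auto
  have "ndiff n (\<lambda>x. f' (a * x + b) * a)"
    using * Suc.IH by (intro ndiff_mult ndiff_const) auto
  moreover have "((\<lambda>x. f (a * x + b)) has_real_derivative f' (a * x + b) * a) (at x)" for x
    by (rule DERIV_chain2[OF *(1)[rule_format]]) (auto intro!: derivative_eq_intros)
  ultimately show ?case by (rule ndiff_SucI)
qed auto

lemma ndiff_id: "ndiff n (\<lambda>x. x)"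
  by (cases n) (auto intro!: exI[of _ "\<lambda>x. 1"] ndiff_const derivative_eq_intros)

lemma smooth_const [simp]: "smooth (\<lambda>x. c)"
  and smooth_id [simp]: "smooth (\<lambda>x. x)"
  and smooth_add: "smooth f \<Longrightarrow> smooth g \<Longrightarrow> smooth (\<lambda>x. f x + g x)"
  and smooth_mult: "smooth f \<Longrightarrow> smooth g \<Longrightarrow> smooth (\<lambda>x. f x * g x)"
  and smooth_inverse: "smooth f \<Longrightarrow> (\<And>x. f x \<noteq> 0) \<Longrightarrow> smooth (\<lambda>x. inverse (f x))"
  and smooth_affine: "smooth f \<Longrightarrow> smooth (\<lambda>x. f (a * x + b))"
  by (auto simp: smooth_iff_ndiff
      intro: ndiff_const ndiff_id ndiff_add ndiff_mult ndiff_inverse ndiff_affine)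

lemma smooth_diff: "smooth f \<Longrightarrow> smooth g \<Longrightarrow> smooth (\<lambda>x. f x - g x)"
  using smooth_add[of f "\<lambda>x. (- 1) * g x"] smooth_mult[of "\<lambda>x. - 1" g] by simp

lemma smooth_continuous_on: "smooth f \<Longrightarrow> continuous_on S f"
  by (meson DERIV_continuous_on smooth_has_deriv DERIV_subset subset_UNIV)

lemma deriv_smooth_mult:
  "smooth f \<Longrightarrow> smooth g \<Longrightarrow> deriv (\<lambda>x. f x * g x) x = deriv f x * g x + deriv g x * f x"
  by (intro DERIV_imp_deriv DERIV_mult smooth_has_deriv)

section \<open>Flat functions and cutoffs built from exp(-1/x)\<close>

definition exp_tail :: "nat \<Rightarrow> real \<Rightarrow> real" where
  "exp_tail k x = (if x > 0 then (1 / x) ^ k * exp (- (1 / x)) else 0)"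

lemma exp_tail_tendsto_0: "(exp_tail k \<longlongrightarrow> 0) (at_right 0)"
proof -
  have "((\<lambda>y::real. y ^ k / exp y) \<longlongrightarrow> 0) at_top"
    by (rule tendsto_power_div_exp_0)
  then have "((\<lambda>x::real. (inverse x) ^ k / exp (inverse x)) \<longlongrightarrow> 0) (at_right 0)"
    by (rule filterlim_compose) (rule filterlim_inverse_at_top_right)
  then show ?thesis
  proof (rule Lim_transform_eventually)
    show "\<forall>\<^sub>F x in at_right 0. inverse x ^ k / exp (inverse x) = exp_tail k x"
      unfolding eventually_at_filter
      by (rule always_eventually) (simp add: exp_tail_def exp_minus divide_inverse)
  qed
qed

text \<open>Differentiating x^(-k) exp(-1/x) gives the same expression with exponents k + 2 and k +
  1. The powers are carried along to make the family closed under differentiation; the cutoffs are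
  built from k = 0.\<close>

lemma exp_tail_deriv:
  "(exp_tail k has_real_derivative exp_tail (k + 2) x - k * exp_tail (k + 1) x) (at x)"
proof -
  consider "x > 0" | "x < 0" | "x = 0" by linarith
  then show ?thesis
  proof cases
    case 1
    have "((\<lambda>x. (1 / x) ^ k * exp (- (1 / x))) has_real_derivative
        exp_tail (k + 2) x - k * exp_tail (k + 1) x) (at x)"
    proof (cases k)
      case (Suc m)
      have "x ^ k = x * x ^ (k - Suc 0)" using Suc by simp
      then show ?thesis
        using 1 by (auto intro!: derivative_eq_intros simp: exp_tail_def field_simps power2_eq_square)
    qed (use 1 in \<open>auto intro!: derivative_eq_intros simp: exp_tail_def field_simps power2_eq_square\<close>)
    then show ?thesis
      by (rule has_field_derivative_transform_within_open[of _ _ _ "{0<..}"])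
         (use 1 in \<open>auto simp: exp_tail_def\<close>)
  next
    case 2
    have "((\<lambda>x. 0) has_real_derivative exp_tail (k + 2) x - k * exp_tail (k + 1) x) (at x)"
      using 2 by (simp add: exp_tail_def)
    then show ?thesis
      by (rule has_field_derivative_transform_within_open[of _ _ _ "{..<0}"])
         (use 2 in \<open>auto simp: exp_tail_def\<close>)
  next
    case 3
    \<comment> \<open>To the right of 0 the difference quotient is \<open>exp_tail (Suc k)\<close>,
      which tends to 0; to the left it is identically 0.\<close>
    have "((\<lambda>h. exp_tail k h / h) \<longlongrightarrow> 0) (at_right 0)"
      by (rule Lim_transform_eventually[OF exp_tail_tendsto_0[of "Suc k"]])
         (auto simp: exp_tail_def eventually_at_filter)
    moreover have "((\<lambda>h. exp_tail k h / h) \<longlongrightarrow> 0) (at_left 0)"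
      by (rule Lim_transform_eventually[OF tendsto_const])
         (auto simp: exp_tail_def eventually_at_filter)
    ultimately have "((\<lambda>h. exp_tail k h / h) \<longlongrightarrow> 0) (at 0)"
      using filterlim_at_split by blast
    then show ?thesis
      using 3 by (simp add: DERIV_def exp_tail_def)
  qed
qed

lemma smooth_exp_tail: "smooth (exp_tail k)"
proof -
  have "ndiff n (exp_tail k)" for n
  proof (induction n arbitrary: k)
    case (Suc n)
    have "ndiff n (\<lambda>x. exp_tail (k + 2) x + (- real k) * exp_tail (k + 1) x)"
      by (intro ndiff_add ndiff_mult ndiff_const Suc.IH)
    then show ?case
      using exp_tail_deriv[of k] by (auto intro!: exI[of _ "\<lambda>x. exp_tail (k + 2) x - k * exp_tail (k + 1) x"])
  qed auto
  then show ?thesis by (simp add: smooth_iff_ndiff)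
qed

lemma exp_tail_pos: "x > 0 \<Longrightarrow> exp_tail k x > 0"
  and exp_tail_eq_0: "x \<le> 0 \<Longrightarrow> exp_tail k x = 0"
  and exp_tail_nonneg: "exp_tail k x \<ge> 0"
  by (auto simp: exp_tail_def)

text \<open>Left unnormalised, since localisation needs only the sign and the support.\<close>

definition bump :: "real \<Rightarrow> real \<Rightarrow> real \<Rightarrow> real" where
  "bump a b x = exp_tail 0 (x - a) * exp_tail 0 (b - x)"

lemma smooth_bump: "smooth (bump a b)"
  using smooth_mult[OF smooth_affine[OF smooth_exp_tail[of 0], of 1 "- a"]
    smooth_affine[OF smooth_exp_tail[of 0], of "- 1" b]]
  unfolding bump_def[abs_def] by (simp add: algebra_simps)

lemma bump_pos: "a < x \<Longrightarrow> x < b \<Longrightarrow> bump a b x > 0"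
  and bump_nonneg: "bump a b x \<ge> 0"
  and bump_eq_0: "x \<le> a \<or> b \<le> x \<Longrightarrow> bump a b x = 0"
  by (auto simp: bump_def exp_tail_pos exp_tail_nonneg exp_tail_eq_0)

text \<open>The transition lies in [1,2] rather than [0,1]: for positive n,
  \<open>step (n * x)\<close> then vanishes up to x = 1/n, which leaves room for compact support
  inside an open interval, and equals 1 from x = 2/n on.\<close>

definition step :: "real \<Rightarrow> real" where
  "step x = exp_tail 0 (x - 1) * inverse (exp_tail 0 (x - 1) + exp_tail 0 (2 - x))"

lemma step_denom_pos: "exp_tail 0 (x - 1) + exp_tail 0 (2 - x) > 0"
  using exp_tail_pos[of "x - 1" 0] exp_tail_pos[of "2 - x" 0]
    exp_tail_nonneg[of 0 "x - 1"] exp_tail_nonneg[of 0 "2 - x"] by linarith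

lemma smooth_step: "smooth step"
  unfolding step_def[abs_def]
proof (intro smooth_mult smooth_inverse smooth_add)
  show s: "smooth (\<lambda>x. exp_tail 0 (x - 1))"
    using smooth_affine[OF smooth_exp_tail[of 0], of 1 "- 1"] by simp
  show "smooth (\<lambda>x. exp_tail 0 (2 - x))"
    using smooth_affine[OF smooth_exp_tail[of 0], of "- 1" 2] by (simp add: algebra_simps)
  show "exp_tail 0 (x - 1) + exp_tail 0 (2 - x) \<noteq> 0" for x
    using step_denom_pos[of x] by simp
qed (use smooth_affine[OF smooth_exp_tail[of 0], of 1 "- 1"] in simp)

lemma step_eq_0: "x \<le> 1 \<Longrightarrow> step x = 0"
  by (simp add: step_def exp_tail_eq_0)

lemma step_eq_1: "x \<ge> 2 \<Longrightarrow> step x = 1"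
  using exp_tail_pos[of "x - 1" 0] by (simp add: step_def exp_tail_eq_0)

lemma step_range: "0 \<le> step x" "step x \<le> 1"
  using step_denom_pos[of x] exp_tail_nonneg[of 0 "x - 1"] exp_tail_nonneg[of 0 "2 - x"]
  by (auto simp: step_def divide_simps simp flip: divide_inverse)

lemma deriv_step_eq_0:
  assumes "x < 1 \<or> 2 < x"
  shows "deriv step x = 0"
proof -
  consider "x < 1" | "2 < x" using assms by blast
  then show ?thesis
  proof cases
    case 1
    have "(step has_real_derivative 0) (at x)"
      by (rule has_field_derivative_transform_within_open[of "\<lambda>x. 0" _ _ "{..<1}"])
         (use 1 step_eq_0 in auto)
    then show ?thesis by (rule DERIV_imp_deriv)
  next
    case 2
    have "(step has_real_derivative 0) (at x)"
      by (rule has_field_derivative_transform_within_open[of "\<lambda>x. 1" _ _ "{2<..}"])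
         (use 2 step_eq_1 in auto)
    then show ?thesis by (rule DERIV_imp_deriv)
  qed
qed

text \<open>The derivative is continuous and vanishes off [1,2], so a bound on that compact interval
  is global; the rescaled cutoffs \<open>step (n * x)\<close> then have slopes of order n.\<close>

lemma deriv_step_bounded: obtains B where "B > 0" "\<And>x. \<bar>deriv step x\<bar> \<le> B"
proof -
  have "compact (deriv step ` {1..2})"
    by (intro compact_continuous_image smooth_continuous_on smooth_deriv smooth_step) auto
  then obtain B where B: "B > 0" "\<forall>y\<in>deriv step ` {1..2}. norm y \<le> B"
    using compact_imp_bounded bounded_pos by metis
  have "\<bar>deriv step x\<bar> \<le> B" for x
    using B deriv_step_eq_0[of x] by (cases "x \<in> {1..2}") auto
  with B(1) show ?thesis using that by blast
qed

section \<open>Lebesgue integrals over bounded intervals\<close>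

lemma finite_measure_Ioo: "finite_measure (lebesgue_on {a<..<b::real})"
  by (intro finite_measure_lebesgue_on) (metis box_real(1) lmeasurable_box)

lemma AE_lebesgue_Ioo:
  "(AE x in lebesgue_on {a<..<b::real}. P x) \<longleftrightarrow> (AE x in lebesgue. x \<in> {a<..<b} \<longrightarrow> P x)"
  by (rule AE_restrict_space_iff) simp

lemma continuous_measurable_Ioo:
  fixes f :: "real \<Rightarrow> real"
  shows "continuous_on {a..b} f \<Longrightarrow> f \<in> borel_measurable (lebesgue_on {a<..<b})"
  by (intro continuous_imp_measurable_on_sets_lebesgue)
     (auto intro: continuous_on_subset greaterThanLessThan_subseteq_atLeastAtMost_iff[THEN iffD2])

lemma bounded_measurable_integrable_Ioo:
  fixes f :: "real \<Rightarrow> real"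
  assumes "f \<in> borel_measurable (lebesgue_on {a<..<b})" "\<And>x. x \<in> {a<..<b} \<Longrightarrow> \<bar>f x\<bar> \<le> B"
  shows "integrable (lebesgue_on {a<..<b}) f"
  using assms(2) by (intro finite_measure.integrable_const_bound[OF finite_measure_Ioo _ assms(1), of B] AE_I2) auto

lemma continuous_bound_Icc:
  fixes f :: "real \<Rightarrow> real"
  assumes "continuous_on {a..b} f"
  obtains B where "B > 0" "\<And>x. x \<in> {a..b} \<Longrightarrow> \<bar>f x\<bar> \<le> B"
proof -
  have "compact (f ` {a..b})" by (intro compact_continuous_image assms) auto
  then obtain B where "B > 0" "\<forall>y\<in>f ` {a..b}. norm y \<le> B"
    using compact_imp_bounded bounded_pos by metis
  then show ?thesis using that by auto
qed

lemma continuous_integrable_Ioo: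
  fixes f :: "real \<Rightarrow> real"
  assumes "continuous_on {a..b} f"
  shows "integrable (lebesgue_on {a<..<b}) f"
proof -
  obtain B where "\<And>x. x \<in> {a..b} \<Longrightarrow> \<bar>f x\<bar> \<le> B"
    using continuous_bound_Icc[OF assms] by metis
  then show ?thesis
    by (intro bounded_measurable_integrable_Ioo[of _ _ _ B] continuous_measurable_Ioo assms) auto
qed

lemma continuous_integral_Ioo:
  fixes f :: "real \<Rightarrow> real"
  assumes "continuous_on {a..b} f"
  shows "integral\<^sup>L (lebesgue_on {a<..<b}) f = integral {a..b} f"
  using lebesgue_integral_eq_integral[OF continuous_integrable_Ioo[OF assms]]
    integral_open_interval_real[of a b f] by simp

lemma integral_Ioo_FTC:
  fixes f :: "real \<Rightarrow> real"
  assumes "a \<le> b" "\<And>x. x \<in> {a..b} \<Longrightarrow> (f has_real_derivative f' x) (at x within {a..b})"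
    "continuous_on {a..b} f'"
  shows "integral\<^sup>L (lebesgue_on {a<..<b}) f' = f b - f a"
  unfolding continuous_integral_Ioo[OF assms(3)]
  using assms by (intro integral_unique fundamental_theorem_of_calculus)
    (auto simp: has_real_derivative_iff_has_vector_derivative)

text \<open>A null set has dense complement, so nonnegativity spreads to the open interval by
  continuity and to the endpoints by closure. Most passages from almost every time to every time go
  through this lemma or \<open>AE_continuous_eq_0\<close>.\<close>

lemma AE_continuous_nonneg:
  fixes h :: "real \<Rightarrow> real"
  assumes "a < b" "continuous_on {a..b} h" "AE t in lebesgue_on {a<..<b}. h t \<ge> 0" "t \<in> {a..b}"
  shows "h t \<ge> 0"
proof -
  \<comment> \<open>Clamping the argument to [a,b] extends \<open>h\<close> continuously to the
    whole line, which makes the set where it is nonnegative closed there.\<close>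
  define h' where "h' = (\<lambda>t. h (max a (min b t)))"
  have h': "continuous_on UNIV h'" unfolding h'_def
    by (intro continuous_on_compose2[OF assms(2)] continuous_intros) (use assms(1) in auto)
  have "closed {t. 0 \<le> h' t}"
    by (intro closed_Collect_le h' continuous_on_const)
  have open_part: "h' t \<ge> 0" if "t \<in> {a<..<b}" for t
  proof -
    have "t \<in> {t. 0 \<le> h' t}"
    proof (rule mem_closed_if_AE_lebesgue_open[OF _ _ _ that])
      show "AE x\<in>{a<..<b} in lebesgue. x \<in> {t. 0 \<le> h' t}"
        using assms(3) unfolding AE_lebesgue_Ioo by eventually_elim (auto simp: h'_def max_def min_def)
    qed (use \<open>closed _\<close> in auto)
    then show ?thesis by simp
  qed
  have "h' ` closure {a<..<b} \<subseteq> {0..}"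
    by (rule image_closure_subset) (use open_part h' in \<open>auto intro: continuous_on_subset\<close>)
  then have "h' t \<ge> 0"
    using assms(1,4) by (auto simp: image_subset_iff)
  then show ?thesis
    using assms(4) by (simp add: h'_def)
qed

lemma AE_continuous_eq_0:
  fixes h :: "real \<Rightarrow> real"
  assumes "a < b" "continuous_on {a..b} h" "AE t in lebesgue_on {a<..<b}. h t = 0" "t \<in> {a..b}"
  shows "h t = 0"
proof -
  have "h t \<ge> 0" using assms(3) by (intro AE_continuous_nonneg[OF assms(1,2) _ assms(4)]) auto
  moreover have "- h t \<ge> 0"
    using assms(3) by (intro AE_continuous_nonneg[OF assms(1) _ _ assms(4)] continuous_intros assms(2)) auto
  ultimately show ?thesis by simp
qed

section \<open>Measurability and integrals under changes on null sets\<close>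

lemma borel_measurable_lebesgue_on_AE:
  fixes f g :: "real \<Rightarrow> real"
  assumes "f \<in> borel_measurable (lebesgue_on S)" "AE x in lebesgue_on S. f x = g x" "S \<in> sets lebesgue"
  shows "g \<in> borel_measurable (lebesgue_on S)"
proof -
  have "(\<lambda>x. if x \<in> S then f x else 0) \<in> borel_measurable lebesgue"
    using assms(1,3) borel_measurable_if by blast
  moreover have "AE x in lebesgue. x \<in> S \<longrightarrow> f x = g x"
    using assms(2,3) by (subst AE_restrict_space_iff[symmetric]) auto
  then have "AE x in lebesgue. (if x \<in> S then f x else 0) = (if x \<in> S then g x else 0)"
    by eventually_elim auto
  ultimately have "(\<lambda>x. if x \<in> S then g x else 0) \<in> borel_measurable lebesgue"
    by (rule borel_measurable_AE)
  then show ?thesis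
    using assms(3) borel_measurable_if by blast
qed

lemma borel_measurable_AE_LIMSEQ:
  fixes f :: "nat \<Rightarrow> real \<Rightarrow> real"
  assumes "\<And>n. f n \<in> borel_measurable (lebesgue_on S)"
    "AE x in lebesgue_on S. (\<lambda>n. f n x) \<longlonglongrightarrow> g x" "S \<in> sets lebesgue"
  shows "g \<in> borel_measurable (lebesgue_on S)"
proof (rule borel_measurable_lebesgue_on_AE[OF _ _ assms(3)])
  show "(\<lambda>x. lim (\<lambda>n. f n x)) \<in> borel_measurable (lebesgue_on S)"
    by (intro borel_measurable_lim_metric assms(1))
  show "AE x in lebesgue_on S. lim (\<lambda>n. f n x) = g x"
    using assms(2) by eventually_elim (rule limI)
qed

text \<open>No measurability is assumed: Lebesgue measure is complete, so \<open>f\<close> and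
  \<open>g\<close> are measurable together, and if neither is, both integrals are 0 by default.
  Representatives chosen by \<open>weak_deriv\<close> can thus be replaced freely inside
  integrals.\<close>

lemma integral_cong_AE_eq:
  fixes f g :: "real \<Rightarrow> real"
  assumes "AE x in lebesgue_on {a<..<b}. f x = g x"
  shows "integral\<^sup>L (lebesgue_on {a<..<b}) f = integral\<^sup>L (lebesgue_on {a<..<b}) g"
proof (cases "f \<in> borel_measurable (lebesgue_on {a<..<b})")
  case True
  then show ?thesis
    using borel_measurable_lebesgue_on_AE[OF True assms] assms by (intro integral_cong_AE) auto
next
  case False
  moreover have "AE x in lebesgue_on {a<..<b}. g x = f x"
    using assms by eventually_elim simp
  ultimately have "g \<notin> borel_measurable (lebesgue_on {a<..<b})"
    using borel_measurable_lebesgue_on_AE[of g _ f] by auto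
  with False show ?thesis
    by (metis borel_measurable_integrable not_integrable_integral_eq)
qed

lemma integrable_cong_AE_eq:
  fixes f g :: "real \<Rightarrow> real"
  assumes "integrable (lebesgue_on {a<..<b}) f" "AE x in lebesgue_on {a<..<b}. f x = g x"
  shows "integrable (lebesgue_on {a<..<b}) g"
  using assms by (intro integrable_cong_AE_imp[OF assms(1)]
    borel_measurable_lebesgue_on_AE[OF borel_measurable_integrable[OF assms(1)]]) auto

subsection \<open>The fundamental lemma of the calculus of variations\<close>

text \<open>The indicator of (c,d) is a bounded pointwise limit of test functions, so dominated
  convergence with bound |h| transfers the vanishing of the pairings.\<close>

lemma integral_subinterval_eq_0:
  fixes h :: "real \<Rightarrow> real"
  assumes h: "integrable (lebesgue_on {a<..<b}) h"
    and test: "\<And>\<phi>. \<phi> \<in> test_fun {a<..<b} \<Longrightarrow> (\<integral>x. h x * \<phi> x \<partial>lebesgue_on {a<..<b}) = 0"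
    and cd: "a \<le> c" "d \<le> b"
  shows "(\<integral>x. h x * indicator {c<..<d} x \<partial>lebesgue_on {a<..<b}) = 0"
proof -
  \<comment> \<open>For n > 0 the first factor vanishes for x \<le> c + 1/n and is 1 for x \<ge> c +
    2/n; the second does the same at d. For n = 0 both arguments are 0 and the product is
    identically 0.\<close>
  define \<phi> where "\<phi> n x = step (real n * (x - c)) * step (real n * (d - x))" for n x
  have smooth\<phi>: "smooth (\<phi> n)" for n
    using smooth_mult[OF smooth_affine[OF smooth_step, of "real n" "- real n * c"]
      smooth_affine[OF smooth_step, of "- real n" "real n * d"]]
    unfolding \<phi>_def[abs_def] by (simp add: algebra_simps)
  have \<phi>0: "\<phi> n x = 0" if "x \<notin> {c + 1 / n..d - 1 / n}" "n > 0" for n x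
    using that by (auto simp: \<phi>_def field_simps intro!: step_eq_0)
  have \<phi>_test: "\<phi> n \<in> test_fun {a<..<b}" for n
  proof (cases "n = 0")
    case True
    then show ?thesis by (auto simp: test_fun_def \<phi>_def[abs_def] step_eq_0 intro!: exI[of _ "{}"])
  next
    case False
    then have "1 / real n > 0" by simp
    then have "{c + 1 / n..d - 1 / n} \<subseteq> {a<..<b}"
      using cd by (intro subsetI) (unfold atLeastAtMost_iff greaterThanLessThan_iff, linarith)
    then show ?thesis
      using smooth\<phi> \<phi>0 False by (auto simp: test_fun_def intro!: exI[of _ "{c + 1 / n..d - 1 / n}"])
  qed
  have "(\<lambda>n. \<integral>x. h x * \<phi> n x \<partial>lebesgue_on {a<..<b}) \<longlonglongrightarrow>
      (\<integral>x. h x * indicator {c<..<d} x \<partial>lebesgue_on {a<..<b})"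
  proof (rule integral_dominated_convergence[where w="\<lambda>x. \<bar>h x\<bar>"])
    have "smooth (\<phi> n)" for n using smooth\<phi> .
    then have "\<phi> n \<in> borel_measurable (lebesgue_on {a<..<b})" for n
      by (intro continuous_measurable_Ioo smooth_continuous_on)
    then show "(\<lambda>x. h x * \<phi> n x) \<in> borel_measurable (lebesgue_on {a<..<b})" for n
      using h by (intro borel_measurable_times) auto
    have "(\<lambda>n. \<phi> n x) \<longlonglongrightarrow> indicator {c<..<d} x" for x
    proof (cases "x \<in> {c<..<d}")
      case True
      have "eventually (\<lambda>n. real n \<ge> 2 / (x - c)) sequentially"
        "eventually (\<lambda>n. real n \<ge> 2 / (d - x)) sequentially"
        using filterlim_at_top filterlim_real_sequentially by blast+
      then have "eventually (\<lambda>n. \<phi> n x = 1) sequentially"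
      proof eventually_elim
        case (elim n)
        then have "real n * (x - c) \<ge> 2" "real n * (d - x) \<ge> 2"
          using True by (auto simp: field_simps)
        then show ?case by (simp add: \<phi>_def step_eq_1)
      qed
      then show ?thesis using True by (simp add: tendsto_eventually)
    next
      case False
      have "\<phi> n x = 0" for n
        using False mult_nonneg_nonpos[of "real n" "x - c"] mult_nonneg_nonpos[of "real n" "d - x"]
        by (auto simp: \<phi>_def not_less intro!: step_eq_0)
      then show ?thesis using False by simp
    qed
    then show "AE x in lebesgue_on {a<..<b}. (\<lambda>n. h x * \<phi> n x) \<longlonglongrightarrow> h x * indicator {c<..<d} x"
      by (intro AE_I2 tendsto_mult tendsto_const)
    have "\<bar>\<phi> n x\<bar> \<le> 1" for n x
      using step_range by (auto simp: \<phi>_def abs_mult intro!: mult_le_one)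
    then show "AE x in lebesgue_on {a<..<b}. norm (h x * \<phi> n x) \<le> \<bar>h x\<bar>" for n
      by (intro AE_I2) (auto simp: abs_mult intro: mult_left_le)
    show "(\<lambda>x. h x * indicator {c<..<d} x) \<in> borel_measurable (lebesgue_on {a<..<b})"
      using h by (intro borel_measurable_times borel_measurable_indicator)
        (use cd in \<open>auto simp: sets_restrict_space image_iff intro!: bexI[of _ "{c<..<d}"]\<close>)
  qed (use h in auto)
  then show ?thesis
    using test[OF \<phi>_test] by (simp add: LIMSEQ_const_iff)
qed

text \<open>Vanishing integrals over all intervals mean vanishing averages, and by Lebesgue
  differentiation the averages converge to the function almost everywhere. The extension
  \<open>H\<close> by 0 allows intervals anywhere on the line.\<close>

lemma fundamental_lemma_variations:
  fixes h :: "real \<Rightarrow> real"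
  assumes h: "integrable (lebesgue_on {a<..<b}) h"
    and test: "\<And>\<phi>. \<phi> \<in> test_fun {a<..<b} \<Longrightarrow> (\<integral>x. h x * \<phi> x \<partial>lebesgue_on {a<..<b}) = 0"
  shows "AE x in lebesgue_on {a<..<b}. h x = 0"
proof -
  define H where "H x = (if x \<in> {a<..<b} then h x else 0)" for x
  have H: "integrable lebesgue H"
    using h unfolding H_def[abs_def]
    by (subst (asm) integrable_restrict_space) (auto elim!: Bochner_Integration.integrable_cong[THEN iffD1, rotated -1])
  have H_int: "H integrable_on cbox c d" for c d
    using integrable_on_lebesgue[OF H] integrable_on_subcbox by blast
  have zero: "integral (cbox c d) H = 0" for c d
  proof (cases "c \<le> d")
    case True
    \<comment> \<open>\<open>H\<close> is 0 outside (a,b), so only the intersection of (c,d) with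
      (a,b) contributes, and that interval is covered by the preceding lemma.\<close>
    define c' d' where "c' = max a c" and "d' = min b d"
    have eq: "(\<lambda>x. indicator {a<..<b} x *\<^sub>R (h x * indicator {c'<..<d'} x)) = (\<lambda>x. indicator {c<..<d} x *\<^sub>R H x)"
      by (auto simp: c'_def d'_def H_def fun_eq_iff indicator_def)
    have "0 = (\<integral>x. h x * indicator {c'<..<d'} x \<partial>lebesgue_on {a<..<b})"
      by (rule integral_subinterval_eq_0[symmetric, OF h test]) (auto simp: c'_def d'_def)
    also have "\<dots> = (\<integral>x. indicator {c<..<d} x *\<^sub>R H x \<partial>lebesgue)"
      by (subst integral_restrict_space) (simp_all only: eq, simp)
    also have "\<dots> = integral\<^sup>L (lebesgue_on {c<..<d}) H"
      by (subst integral_restrict_space) auto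
    also have "\<dots> = integral {c<..<d} H"
    proof (rule lebesgue_integral_eq_integral)
      show "integrable (lebesgue_on {c<..<d}) H"
        using integrable_mult_indicator[OF _ H, of "{c<..<d}"] by (subst integrable_restrict_space) auto
    qed auto
    also have "\<dots> = integral (cbox c d) H"
      using integral_open_interval_real[of c d H] by simp
    finally show ?thesis by simp
  next
    case False
    then show ?thesis by simp
  qed
  obtain N where N: "negligible N" "\<And>x e. \<lbrakk>x \<notin> N; 0 < e\<rbrakk> \<Longrightarrow> \<exists>d>0. \<forall>k. 0 < k \<and> k < d \<longrightarrow>
      norm (integral (cbox x (x + k *\<^sub>R One)) H /\<^sub>R k ^ DIM(real) - H x) < e"
    using integrable_ccontinuous_explicit[of H] H_int by metis
  have "H x = 0" if "x \<notin> N" for x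
  proof (rule ccontr)
    assume "H x \<noteq> 0"
    then have "0 < \<bar>H x\<bar>" by simp
    \<comment> \<open>With zero averages the error in the differentiation theorem is exactly |H x|,
      so an error below |H x| is contradictory.\<close>
    from N(2)[OF that this] obtain d where d: "d > 0" "\<forall>k. 0 < k \<and> k < d \<longrightarrow>
      norm (integral (cbox x (x + k *\<^sub>R One)) H /\<^sub>R k ^ DIM(real) - H x) < \<bar>H x\<bar>"
      by blast
    from d(2)[rule_format, of "d / 2"] d(1) show False
      by (simp only: zero) simp
  qed
  moreover have "AE x in lebesgue. x \<notin> N"
    using N(1) by (simp add: negligible_iff_null_sets AE_not_in)
  ultimately have "AE x in lebesgue. x \<in> {a<..<b} \<longrightarrow> h x = 0"
    unfolding H_def by (auto elim!: eventually_mono split: if_splits) metis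
  then show ?thesis unfolding AE_lebesgue_Ioo .
qed

section \<open>The space \<open>L2\<close>\<close>

lemma L2_mult_integrable:
  assumes "f \<in> L2" "g \<in> L2"
  shows "integrable leb_I (\<lambda>x. f x * g x)"
proof (rule Bochner_Integration.integrable_bound)
  show "integrable leb_I (\<lambda>x. (f x)\<^sup>2 + (g x)\<^sup>2)"
    using assms by (auto simp: L2_def)
  show "AE x in leb_I. norm (f x * g x) \<le> norm ((f x)\<^sup>2 + (g x)\<^sup>2)"
  proof (rule AE_I2)
    fix x
    have "2 * \<bar>f x\<bar> * \<bar>g x\<bar> \<le> \<bar>f x\<bar>\<^sup>2 + \<bar>g x\<bar>\<^sup>2"
      by (rule sum_squares_bound)
    moreover have "\<bar>f x\<bar> * \<bar>g x\<bar> \<ge> 0" by simp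
    ultimately have "\<bar>f x\<bar> * \<bar>g x\<bar> \<le> (f x)\<^sup>2 + (g x)\<^sup>2"
      unfolding mult.assoc power2_abs by linarith
    then show "norm (f x * g x) \<le> norm ((f x)\<^sup>2 + (g x)\<^sup>2)"
      by (simp add: abs_mult)
  qed
qed (use assms in \<open>auto simp: L2_def intro: borel_measurable_times\<close>)

lemma L2_add: "f \<in> L2 \<Longrightarrow> g \<in> L2 \<Longrightarrow> (\<lambda>x. f x + g x) \<in> L2"
  using L2_mult_integrable[of f g] by (auto simp: L2_def power2_sum mult.assoc intro!: borel_measurable_add)

lemma L2_scale: "f \<in> L2 \<Longrightarrow> (\<lambda>x. c * f x) \<in> L2"
  by (auto simp: L2_def power_mult_distrib intro!: borel_measurable_times)

lemma L2_diff: "f \<in> L2 \<Longrightarrow> g \<in> L2 \<Longrightarrow> (\<lambda>x. f x - g x) \<in> L2"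
  using L2_add[OF _ L2_scale[of g "- 1"], of f] by simp

lemma L2_AE_cong:
  assumes "f \<in> L2" "AE x in leb_I. f x = g x"
  shows "g \<in> L2"
proof -
  have "AE x in leb_I. (f x)\<^sup>2 = (g x)\<^sup>2"
    using assms(2) by eventually_elim simp
  then show ?thesis
    using assms borel_measurable_lebesgue_on_AE[of f "{0<..<1}" g] integrable_cong_AE_eq[of 0 1 "\<lambda>x. (f x)\<^sup>2" "\<lambda>x. (g x)\<^sup>2"]
    by (auto simp: L2_def)
qed

lemma continuous_L2: "continuous_on {0..1} f \<Longrightarrow> f \<in> L2"
  by (auto simp: L2_def intro!: continuous_measurable_Ioo continuous_integrable_Ioo continuous_intros)

lemma L2_integrable: "f \<in> L2 \<Longrightarrow> integrable leb_I f"
  using L2_mult_integrable[of f "\<lambda>x. 1"] continuous_L2[of "\<lambda>x. 1"] by simp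

lemma L2_norm_power2: "(L2_norm f)\<^sup>2 = (\<integral>x. (f x)\<^sup>2 \<partial>leb_I)"
  by (simp add: L2_norm_def)

lemma L2_norm_nonneg [simp]: "L2_norm f \<ge> 0"
  by (simp add: L2_norm_def)

lemma L2_norm_AE_cong: "AE x in leb_I. f x = g x \<Longrightarrow> L2_norm f = L2_norm g"
  unfolding L2_norm_def by (intro arg_cong[where f=sqrt] integral_cong_AE_eq) auto

lemma L2_norm_scale: "L2_norm (\<lambda>x. c * f x) = \<bar>c\<bar> * L2_norm f"
  by (simp add: L2_norm_def power_mult_distrib real_sqrt_mult)

text \<open>The polynomial s \<mapsto> ||f + s g||^2 is nonnegative; evaluating it at its minimiser
  -b/c gives the inequality when c > 0.\<close>

lemma L2_Cauchy_Schwarz: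
  assumes "f \<in> L2" "g \<in> L2"
  shows "\<bar>\<integral>x. f x * g x \<partial>leb_I\<bar> \<le> L2_norm f * L2_norm g"
proof -
  define a where "a = (\<integral>x. (f x)\<^sup>2 \<partial>leb_I)"
  define b where "b = (\<integral>x. f x * g x \<partial>leb_I)"
  define c where "c = (\<integral>x. (g x)\<^sup>2 \<partial>leb_I)"
  have quad: "0 \<le> a + 2 * s * b + s\<^sup>2 * c" for s
  proof -
    have "0 \<le> (\<integral>x. (f x + s * g x)\<^sup>2 \<partial>leb_I)" by simp
    also have "\<dots> = (\<integral>x. (f x)\<^sup>2 + (2 * s * (f x * g x) + s\<^sup>2 * (g x)\<^sup>2) \<partial>leb_I)"
      by (simp add: power2_sum power_mult_distrib algebra_simps)
    also have "\<dots> = a + (2 * s * b + s\<^sup>2 * c)"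
      unfolding a_def b_def c_def
      using assms L2_mult_integrable[OF assms] by (simp add: L2_def)
    finally show ?thesis by simp
  qed
  have "b\<^sup>2 \<le> a * c"
  proof (cases "c = 0")
    case True
    have "b = 0"
    proof (rule ccontr)
      assume "b \<noteq> 0"
      \<comment> \<open>With c = 0 the polynomial is affine in s, and this s makes it equal to
        -1.\<close>
      with quad[of "- (a + 1) / (2 * b)"] True show False by (simp add: field_simps)
    qed
    then show ?thesis using True by simp
  next
    case False
    then have "c > 0" by (simp add: c_def order_less_le)
    have "0 \<le> a + 2 * (- b / c) * b + (- b / c)\<^sup>2 * c" by (rule quad)
    also have "\<dots> = a - b\<^sup>2 / c"
      using \<open>c > 0\<close> by (simp add: field_simps power2_eq_square)
    finally show ?thesis using \<open>c > 0\<close> by (simp add: field_simps)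
  qed
  then have "sqrt (b\<^sup>2) \<le> sqrt (a * c)" by (rule real_sqrt_le_mono)
  then show ?thesis
    by (simp add: L2_norm_def a_def b_def c_def real_sqrt_mult)
qed

lemma L2_norm_triangle:
  assumes "f \<in> L2" "g \<in> L2"
  shows "L2_norm (\<lambda>x. f x + g x) \<le> L2_norm f + L2_norm g"
proof (rule power2_le_imp_le)
  have "(L2_norm (\<lambda>x. f x + g x))\<^sup>2 = (L2_norm f)\<^sup>2 + (L2_norm g)\<^sup>2 + 2 * (\<integral>x. f x * g x \<partial>leb_I)"
    unfolding L2_norm_power2
    using assms L2_mult_integrable[OF assms] by (simp add: L2_def power2_sum mult.assoc)
  also have "\<dots> \<le> (L2_norm f)\<^sup>2 + (L2_norm g)\<^sup>2 + 2 * (L2_norm f * L2_norm g)"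
    using L2_Cauchy_Schwarz[OF assms] by simp
  also have "\<dots> = (L2_norm f + L2_norm g)\<^sup>2" by (simp add: power2_sum)
  finally show "(L2_norm (\<lambda>x. f x + g x))\<^sup>2 \<le> (L2_norm f + L2_norm g)\<^sup>2" .
qed simp

lemma L2_norm_triangle_diff:
  assumes "f \<in> L2" "g \<in> L2"
  shows "\<bar>L2_norm f - L2_norm g\<bar> \<le> L2_norm (\<lambda>x. f x - g x)"
proof -
  have "L2_norm f \<le> L2_norm (\<lambda>x. f x - g x) + L2_norm g"
    using L2_norm_triangle[OF L2_diff[OF assms] assms(2)] by simp
  moreover have "L2_norm g \<le> L2_norm (\<lambda>x. f x - g x) + L2_norm f"
    using L2_norm_triangle[OF L2_diff[OF assms(2,1)] assms(1)] L2_norm_scale[of "- 1" "\<lambda>x. f x - g x"]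
    by simp
  ultimately show ?thesis by simp
qed

section \<open>Weak derivatives\<close>

lemma test_fun_L2: "\<phi> \<in> test_fun S \<Longrightarrow> \<phi> \<in> L2"
  and test_fun_deriv_L2: "\<phi> \<in> test_fun S \<Longrightarrow> deriv \<phi> \<in> L2"
  by (auto simp: test_fun_def intro!: continuous_L2 smooth_continuous_on smooth_deriv)

lemma weak_deriv_unique:
  assumes "g \<in> L2" "h \<in> L2" "has_weak_deriv f g" "has_weak_deriv f h"
  shows "AE x in leb_I. g x = h x"
proof -
  have "AE x in leb_I. g x - h x = 0"
  proof (rule fundamental_lemma_variations)
    show "integrable leb_I (\<lambda>x. g x - h x)"
      using assms by (intro L2_integrable L2_diff)
    fix \<phi> assume \<phi>: "\<phi> \<in> test_fun I01"
    have "(\<integral>x. (g x - h x) * \<phi> x \<partial>leb_I) = (\<integral>x. g x * \<phi> x \<partial>leb_I) - (\<integral>x. h x * \<phi> x \<partial>leb_I)"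
      using L2_mult_integrable[OF assms(1) test_fun_L2[OF \<phi>]] L2_mult_integrable[OF assms(2) test_fun_L2[OF \<phi>]]
      by (simp add: left_diff_distrib)
    also have "\<dots> = 0"
    proof -
      have "(\<integral>x. f x * deriv \<phi> x \<partial>leb_I) = - (\<integral>x. g x * \<phi> x \<partial>leb_I)"
        "(\<integral>x. f x * deriv \<phi> x \<partial>leb_I) = - (\<integral>x. h x * \<phi> x \<partial>leb_I)"
        using assms(3,4) \<phi> unfolding has_weak_deriv_def by blast+
      then show ?thesis by simp
    qed
    finally show "(\<integral>x. (g x - h x) * \<phi> x \<partial>leb_I) = 0" .
  qed
  then show ?thesis by simp
qed

text \<open>Uniqueness pins the value chosen by \<open>SOME\<close> down up to null sets, so any
  weak derivative known explicitly can stand in for it almost everywhere.\<close>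

lemma weak_deriv_AE_eq:
  assumes "g \<in> L2" "has_weak_deriv f g"
  shows "AE x in leb_I. weak_deriv f x = g x"
proof -
  have "weak_deriv f \<in> L2 \<and> has_weak_deriv f (weak_deriv f)"
    unfolding weak_deriv_def by (rule someI[of _ g]) (use assms in simp)
  then show ?thesis using assms by (intro weak_deriv_unique) auto
qed

lemma H1_weak_deriv:
  assumes "f \<in> H1"
  shows "weak_deriv f \<in> L2" "has_weak_deriv f (weak_deriv f)"
proof -
  from assms obtain g where "g \<in> L2 \<and> has_weak_deriv f g" by (auto simp: H1_def)
  then have "weak_deriv f \<in> L2 \<and> has_weak_deriv f (weak_deriv f)"
    unfolding weak_deriv_def by (rule someI[where P="\<lambda>g. g \<in> L2 \<and> has_weak_deriv f g"])
  then show "weak_deriv f \<in> L2" "has_weak_deriv f (weak_deriv f)" by auto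
qed

lemma H1_in_L2: "f \<in> H1 \<Longrightarrow> f \<in> L2"
  by (simp add: H1_def)

lemma has_weak_deriv_AE_cong:
  assumes "has_weak_deriv f g" "AE x in leb_I. f x = f' x" "AE x in leb_I. g x = g' x"
  shows "has_weak_deriv f' g'"
  unfolding has_weak_deriv_def
proof
  fix \<phi> assume "\<phi> \<in> test_fun I01"
  moreover have "(\<integral>x. f' x * deriv \<phi> x \<partial>leb_I) = (\<integral>x. f x * deriv \<phi> x \<partial>leb_I)"
    using assms(2) by (intro integral_cong_AE_eq) (auto elim: eventually_mono)
  moreover have "(\<integral>x. g' x * \<phi> x \<partial>leb_I) = (\<integral>x. g x * \<phi> x \<partial>leb_I)"
    using assms(3) by (intro integral_cong_AE_eq) (auto elim: eventually_mono)
  ultimately show "(\<integral>x. f' x * deriv \<phi> x \<partial>leb_I) = - (\<integral>x. g' x * \<phi> x \<partial>leb_I)"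
    using assms(1) by (simp add: has_weak_deriv_def)
qed

lemma has_weak_deriv_add_scale:
  assumes "f \<in> L2" "f' \<in> L2" "g \<in> L2" "g' \<in> L2" "has_weak_deriv f f'" "has_weak_deriv g g'"
  shows "has_weak_deriv (\<lambda>x. f x + c * g x) (\<lambda>x. f' x + c * g' x)"
  unfolding has_weak_deriv_def
proof
  fix \<phi> assume \<phi>: "\<phi> \<in> test_fun I01"
  note int = L2_mult_integrable[OF assms(1) test_fun_deriv_L2[OF \<phi>]]
    L2_mult_integrable[OF assms(3) test_fun_deriv_L2[OF \<phi>]]
    L2_mult_integrable[OF assms(2) test_fun_L2[OF \<phi>]] L2_mult_integrable[OF assms(4) test_fun_L2[OF \<phi>]]
  have "(\<integral>x. (f x + c * g x) * deriv \<phi> x \<partial>leb_I)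
      = (\<integral>x. f x * deriv \<phi> x \<partial>leb_I) + c * (\<integral>x. g x * deriv \<phi> x \<partial>leb_I)"
    using int by (simp add: distrib_right mult.assoc)
  also have "\<dots> = - ((\<integral>x. f' x * \<phi> x \<partial>leb_I) + c * (\<integral>x. g' x * \<phi> x \<partial>leb_I))"
    using assms(5,6) \<phi> by (simp add: has_weak_deriv_def algebra_simps)
  also have "(\<integral>x. f' x * \<phi> x \<partial>leb_I) + c * (\<integral>x. g' x * \<phi> x \<partial>leb_I)
      = (\<integral>x. (f' x + c * g' x) * \<phi> x \<partial>leb_I)"
    using int by (simp add: distrib_right mult.assoc)
  finally show "(\<integral>x. (f x + c * g x) * deriv \<phi> x \<partial>leb_I) = - (\<integral>x. (f' x + c * g' x) * \<phi> x \<partial>leb_I)" .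
qed

lemma H1_add_scale:
  assumes "f \<in> H1" "g \<in> H1"
  shows "(\<lambda>x. f x + c * g x) \<in> H1"
    and "AE x in leb_I. weak_deriv (\<lambda>x. f x + c * g x) x = weak_deriv f x + c * weak_deriv g x"
proof -
  note * = H1_weak_deriv[OF assms(1)] H1_weak_deriv[OF assms(2)] H1_in_L2[OF assms(1)] H1_in_L2[OF assms(2)]
  have d: "has_weak_deriv (\<lambda>x. f x + c * g x) (\<lambda>x. weak_deriv f x + c * weak_deriv g x)"
    "(\<lambda>x. weak_deriv f x + c * weak_deriv g x) \<in> L2"
    using * by (auto intro!: has_weak_deriv_add_scale L2_add L2_scale)
  show "(\<lambda>x. f x + c * g x) \<in> H1"
    using d * by (auto simp: H1_def intro!: L2_add L2_scale)
  show "AE x in leb_I. weak_deriv (\<lambda>x. f x + c * g x) x = weak_deriv f x + c * weak_deriv g x"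
    by (rule weak_deriv_AE_eq) (use d in auto)
qed

text \<open>Test pairings do not see null sets. This makes second weak derivatives manageable: the
  derivative of a sum is only almost everywhere the sum of the derivatives, and
  \<open>weak_deriv\<close> has to be applied to it once more.\<close>

lemma H1_AE_cong:
  assumes "f \<in> H1" "AE x in leb_I. f x = g x"
  shows "g \<in> H1" "AE x in leb_I. weak_deriv g x = weak_deriv f x"
proof -
  have "has_weak_deriv g (weak_deriv f)"
    using has_weak_deriv_AE_cong[OF H1_weak_deriv(2)[OF assms(1)] assms(2)] by simp
  then show "g \<in> H1" "AE x in leb_I. weak_deriv g x = weak_deriv f x"
    using H1_weak_deriv(1)[OF assms(1)] L2_AE_cong[OF H1_in_L2[OF assms(1)] assms(2)]
    by (auto simp: H1_def intro!: weak_deriv_AE_eq)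
qed

lemma H2_D: "f \<in> H2 \<Longrightarrow> f \<in> H1" "f \<in> H2 \<Longrightarrow> weak_deriv f \<in> H1"
  by (auto simp: H2_def)

lemma H2_add_scale:
  assumes "f \<in> H2" "g \<in> H2"
  shows "(\<lambda>x. f x + c * g x) \<in> H2"
    and "AE x in leb_I. weak_deriv (weak_deriv (\<lambda>x. f x + c * g x)) x
      = weak_deriv (weak_deriv f) x + c * weak_deriv (weak_deriv g) x"
proof -
  let ?h = "\<lambda>x. weak_deriv f x + c * weak_deriv g x"
  have h: "?h \<in> H1" "AE x in leb_I. weak_deriv ?h x
      = weak_deriv (weak_deriv f) x + c * weak_deriv (weak_deriv g) x"
    using H1_add_scale H2_D assms by auto
  have e: "AE x in leb_I. ?h x = weak_deriv (\<lambda>x. f x + c * g x) x"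
    using H1_add_scale(2)[OF H2_D(1)[OF assms(1)] H2_D(1)[OF assms(2)], where c=c]
    by eventually_elim simp
  show "(\<lambda>x. f x + c * g x) \<in> H2"
    using H1_add_scale(1)[OF H2_D(1)[OF assms(1)] H2_D(1)[OF assms(2)]] H1_AE_cong(1)[OF h(1) e]
    by (simp add: H2_def)
  show "AE x in leb_I. weak_deriv (weak_deriv (\<lambda>x. f x + c * g x)) x
      = weak_deriv (weak_deriv f) x + c * weak_deriv (weak_deriv g) x"
    using H1_AE_cong(2)[OF h(1) e] h(2) by eventually_elim simp
qed

lemma has_weak_deriv_C1:
  assumes "\<And>x. x \<in> {0..1} \<Longrightarrow> (f has_real_derivative f' x) (at x within {0..1})"
    "continuous_on {0..1} f'"
  shows "has_weak_deriv f f'"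
  unfolding has_weak_deriv_def
proof
  fix \<phi> assume "\<phi> \<in> test_fun I01"
  then obtain C where \<phi>: "smooth \<phi>" "C \<subseteq> I01" "\<And>x. x \<notin> C \<Longrightarrow> \<phi> x = 0"
    by (auto simp: test_fun_def)
  have cf: "continuous_on {0..1} f"
    using assms(1) by (rule DERIV_continuous_on)
  note cont = cf assms(2) smooth_continuous_on[OF \<phi>(1)] smooth_continuous_on[OF smooth_deriv[OF \<phi>(1)]]
  have "(\<integral>x. f' x * \<phi> x + deriv \<phi> x * f x \<partial>leb_I) = f 1 * \<phi> 1 - f 0 * \<phi> 0"
  proof (rule integral_Ioo_FTC)
    show "((\<lambda>x. f x * \<phi> x) has_real_derivative f' x * \<phi> x + deriv \<phi> x * f x) (at x within {0..1})"
      if "x \<in> {0..1}" for x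
      by (intro DERIV_mult assms(1)[OF that] has_field_derivative_at_within[OF smooth_has_deriv[OF \<phi>(1)]])
    show "continuous_on {0..1} (\<lambda>x. f' x * \<phi> x + deriv \<phi> x * f x)"
      by (intro continuous_on_add continuous_on_mult cont)
  qed simp
  also have "\<dots> = 0"
  proof -
    have "0 \<notin> C" "1 \<notin> C" using \<phi>(2) by auto
    then show ?thesis using \<phi>(3) by simp
  qed
  also have "(\<integral>x. f' x * \<phi> x + deriv \<phi> x * f x \<partial>leb_I)
      = (\<integral>x. f' x * \<phi> x \<partial>leb_I) + (\<integral>x. deriv \<phi> x * f x \<partial>leb_I)"
    by (intro Bochner_Integration.integral_add continuous_integrable_Ioo continuous_intros cont)
  finally show "(\<integral>x. f x * deriv \<phi> x \<partial>leb_I) = - (\<integral>x. f' x * \<phi> x \<partial>leb_I)"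
    by (simp add: mult.commute)
qed

lemma C1_H1:
  assumes "\<And>x. x \<in> {0..1} \<Longrightarrow> (f has_real_derivative f' x) (at x within {0..1})"
    "continuous_on {0..1} f'"
  shows "f \<in> H1" "AE x in leb_I. weak_deriv f x = f' x"
proof -
  have "f \<in> L2" using DERIV_continuous_on[OF assms(1)] by (intro continuous_L2) auto
  then show "f \<in> H1" "AE x in leb_I. weak_deriv f x = f' x"
    using has_weak_deriv_C1[OF assms] continuous_L2[OF assms(2)]
    by (auto simp: H1_def intro!: weak_deriv_AE_eq)
qed

lemma C2_H2:
  assumes "\<And>x. x \<in> {0..1} \<Longrightarrow> (f has_real_derivative f' x) (at x within {0..1})"
    "\<And>x. x \<in> {0..1} \<Longrightarrow> (f' has_real_derivative f'' x) (at x within {0..1})"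
    "continuous_on {0..1} f''"
  shows "f \<in> H2" "AE x in leb_I. weak_deriv (weak_deriv f) x = f'' x"
proof -
  note f = C1_H1[OF assms(1) DERIV_continuous_on[OF assms(2)], simplified]
  note f' = C1_H1[OF assms(2,3), simplified]
  have e: "AE x in leb_I. f' x = weak_deriv f x"
    using f(2) by (auto elim: eventually_mono)
  show "f \<in> H2" "AE x in leb_I. weak_deriv (weak_deriv f) x = f'' x"
    using f(1) H1_AE_cong[OF f'(1) e] f'(2) by (auto simp: H2_def elim: eventually_elim2)
qed

lemma smooth_weak_deriv:
  assumes "smooth \<phi>"
  shows "\<phi> \<in> H2" "AE x in leb_I. weak_deriv \<phi> x = deriv \<phi> x"
    "AE x in leb_I. weak_deriv (weak_deriv \<phi>) x = deriv (deriv \<phi>) x"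
proof -
  have d: "(\<phi> has_real_derivative deriv \<phi> x) (at x within S)"
    "(deriv \<phi> has_real_derivative deriv (deriv \<phi>) x) (at x within S)" for x S
    using assms smooth_has_deriv smooth_deriv has_field_derivative_at_within by blast+
  have c: "continuous_on {0..1} (deriv \<phi>)" "continuous_on {0..1} (deriv (deriv \<phi>))"
    using assms smooth_continuous_on smooth_deriv by blast+
  show "\<phi> \<in> H2" "AE x in leb_I. weak_deriv (weak_deriv \<phi>) x = deriv (deriv \<phi>) x"
    using C2_H2[OF d c(2)] by auto
  show "AE x in leb_I. weak_deriv \<phi> x = deriv \<phi> x"
    using C1_H1[OF d(1) c(1)] by auto
qed

section \<open>Sobolev norms and boundary values\<close>

lemma H1_norm_nonneg [simp]: "H1_norm f \<ge> 0"
  and H2_norm_nonneg [simp]: "H2_norm f \<ge> 0"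
  by (auto simp: H1_norm_def H2_norm_def)

text \<open>Read as a Euclidean combination of two terms, the H2 norm obeys the triangle inequality
  by the same planar Minkowski inequality as the H1 norm.\<close>

lemma H2_norm_eq: "H2_norm f = sqrt ((H1_norm f)\<^sup>2 + (L2_norm (weak_deriv (weak_deriv f)))\<^sup>2)"
  by (simp add: H1_norm_def H2_norm_def)

lemma L2_norm_add_scale:
  assumes "f \<in> L2" "g \<in> L2"
  shows "L2_norm (\<lambda>x. f x + c * g x) \<le> L2_norm f + \<bar>c\<bar> * L2_norm g"
  using L2_norm_triangle[OF assms(1) L2_scale[OF assms(2)], of c] by (simp add: L2_norm_scale)

lemma sqrt_sum_squares_add_scale:
  fixes a b c p q r k :: real
  assumes "0 \<le> p" "0 \<le> q" "p \<le> a + k * c" "q \<le> b + k * r" "k \<ge> 0"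
  shows "sqrt (p\<^sup>2 + q\<^sup>2) \<le> sqrt (a\<^sup>2 + b\<^sup>2) + k * sqrt (c\<^sup>2 + r\<^sup>2)"
proof -
  have "sqrt (p\<^sup>2 + q\<^sup>2) \<le> sqrt ((a + k * c)\<^sup>2 + (b + k * r)\<^sup>2)"
    using assms by (intro real_sqrt_le_mono add_mono power_mono) auto
  also have "\<dots> \<le> sqrt (a\<^sup>2 + b\<^sup>2) + sqrt ((k * c)\<^sup>2 + (k * r)\<^sup>2)"
    by (rule real_sqrt_sum_squares_triangle_ineq)
  also have "sqrt ((k * c)\<^sup>2 + (k * r)\<^sup>2) = sqrt (k\<^sup>2 * (c\<^sup>2 + r\<^sup>2))"
    by (simp add: power_mult_distrib algebra_simps)
  also have "\<dots> = k * sqrt (c\<^sup>2 + r\<^sup>2)"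
    using assms(5) by (simp add: real_sqrt_mult)
  finally show ?thesis by simp
qed

lemma H1_norm_add_scale:
  assumes "f \<in> H1" "g \<in> H1"
  shows "H1_norm (\<lambda>x. f x + c * g x) \<le> H1_norm f + \<bar>c\<bar> * H1_norm g"
  unfolding H1_norm_def
  using L2_norm_AE_cong[OF H1_add_scale(2)[OF assms, of c]] assms
  by (intro sqrt_sum_squares_add_scale) (auto intro!: L2_norm_add_scale H1_in_L2 H1_weak_deriv)

lemma H2_norm_add_scale:
  assumes "f \<in> H2" "g \<in> H2"
  shows "H2_norm (\<lambda>x. f x + c * g x) \<le> H2_norm f + \<bar>c\<bar> * H2_norm g"
  unfolding H2_norm_eq
  using L2_norm_AE_cong[OF H2_add_scale(2)[OF assms, of c]] assms
  by (intro sqrt_sum_squares_add_scale)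
     (auto intro!: H1_norm_add_scale L2_norm_add_scale H2_D H1_weak_deriv)

lemma test_fun_smooth: "\<phi> \<in> test_fun S \<Longrightarrow> smooth \<phi>"
  by (simp add: test_fun_def)

lemma test_fun_add_scale:
  assumes "\<phi> \<in> test_fun S" "\<zeta> \<in> test_fun S"
  shows "(\<lambda>x. \<phi> x + c * \<zeta> x) \<in> test_fun S"
proof -
  from assms obtain C D where "compact C" "C \<subseteq> S" "\<forall>x. x \<notin> C \<longrightarrow> \<phi> x = 0"
    "compact D" "D \<subseteq> S" "\<forall>x. x \<notin> D \<longrightarrow> \<zeta> x = 0"
    by (auto simp: test_fun_def)
  then show ?thesis
    using assms by (auto simp: test_fun_def intro!: smooth_add smooth_mult exI[of _ "C \<union> D"] compact_Un)
qed

lemma H1_0_add_scale: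
  assumes "f \<in> H1_0" "g \<in> H1_0"
  shows "(\<lambda>x. f x + c * g x) \<in> H1_0"
proof -
  from assms have fg: "f \<in> H1" "g \<in> H1" by (auto simp: H1_0_def)
  from assms obtain \<phi> \<zeta> where *: "\<And>n::nat. \<phi> n \<in> test_fun I01" "(\<lambda>n. H1_norm (\<lambda>x. f x - \<phi> n x)) \<longlonglongrightarrow> 0"
    "\<And>n::nat. \<zeta> n \<in> test_fun I01" "(\<lambda>n. H1_norm (\<lambda>x. g x - \<zeta> n x)) \<longlonglongrightarrow> 0"
    by (auto simp: H1_0_def)
  have sub: "(\<lambda>x. h x - \<phi> x) \<in> H1" if "h \<in> H1" "\<phi> \<in> test_fun I01" for h \<phi>
    using H1_add_scale(1)[OF that(1) H2_D(1)[OF smooth_weak_deriv(1)[OF test_fun_smooth[OF that(2)]]], of "- 1"]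
    by simp
  have bound: "H1_norm (\<lambda>x. (f x + c * g x) - (\<phi> n x + c * \<zeta> n x))
      \<le> H1_norm (\<lambda>x. f x - \<phi> n x) + \<bar>c\<bar> * H1_norm (\<lambda>x. g x - \<zeta> n x)" for n
    using H1_norm_add_scale[OF sub[OF fg(1) *(1)[of n]] sub[OF fg(2) *(3)[of n]], of c]
    by (simp add: algebra_simps)
  have lim: "(\<lambda>n. H1_norm (\<lambda>x. f x - \<phi> n x) + \<bar>c\<bar> * H1_norm (\<lambda>x. g x - \<zeta> n x)) \<longlonglongrightarrow> 0 + \<bar>c\<bar> * 0"
    by (intro tendsto_intros *)
  have "(\<lambda>n. H1_norm (\<lambda>x. (f x + c * g x) - (\<phi> n x + c * \<zeta> n x))) \<longlonglongrightarrow> 0"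
  proof (rule tendsto_sandwich[OF _ _ tendsto_const])
    show "(\<lambda>n. H1_norm (\<lambda>x. f x - \<phi> n x) + \<bar>c\<bar> * H1_norm (\<lambda>x. g x - \<zeta> n x)) \<longlonglongrightarrow> 0"
      using lim by simp
  qed (use bound in \<open>auto intro!: always_eventually\<close>)
  then show ?thesis
    using *(1,3) H1_add_scale(1)[OF fg, of c]
    by (auto simp: H1_0_def intro!: exI[of _ "\<lambda>n x. \<phi> n x + c * \<zeta> n x"] test_fun_add_scale)
qed

lemma H_space_add_scale: "f \<in> H_space \<Longrightarrow> g \<in> H_space \<Longrightarrow> (\<lambda>x. f x + c * g x) \<in> H_space"
  by (auto simp: H_space_def H2_add_scale H1_0_add_scale)

lemma H_space_H2: "f \<in> H_space \<Longrightarrow> f \<in> H2"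
  by (simp add: H_space_def)

lemma H_space_L2: "f \<in> H_space \<Longrightarrow> f \<in> L2"
  by (simp add: H_space_def H2_def H1_in_L2)

text \<open>A trace argument: d = f - \<open>\<phi> n\<close> has the boundary values of f, and
  integrating (d g)' for an affine weight g bounds d(1) g(1) - d(0) g(0) by the H1 norm of d times a
  constant, which tends to 0.\<close>

lemma H1_0_boundary_values:
  assumes f: "\<And>x. x \<in> {0..1} \<Longrightarrow> (f has_real_derivative f' x) (at x within {0..1})"
    "continuous_on {0..1} f'" and "f \<in> H1_0"
  shows "f 0 = 0" "f 1 = 0"
proof -
  from \<open>f \<in> H1_0\<close> obtain \<phi> where \<phi>: "\<And>n::nat. \<phi> n \<in> test_fun I01"
    "(\<lambda>n. H1_norm (\<lambda>x. f x - \<phi> n x)) \<longlonglongrightarrow> 0"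
    by (auto simp: H1_0_def)
  have pairing: "f 1 * (\<alpha> + \<beta>) - f 0 * \<alpha> = 0" for \<alpha> \<beta>
  proof -
    define g where "g x = \<alpha> + \<beta> * x" for x
    define k where "k = L2_norm g + L2_norm (\<lambda>x. \<beta>)"
    have g: "g \<in> L2" unfolding g_def by (intro continuous_L2 continuous_intros)
    have bound: "\<bar>f 1 * (\<alpha> + \<beta>) - f 0 * \<alpha>\<bar> \<le> H1_norm (\<lambda>x. f x - \<phi> n x) * k" for n
    proof -
      define d d' where "d x = f x - \<phi> n x" and "d' x = f' x - deriv (\<phi> n) x" for x
      note sm = test_fun_smooth[OF \<phi>(1)[of n]]
      have d: "(d has_real_derivative d' x) (at x within {0..1})" if "x \<in> {0..1}" for x
        unfolding d_def d'_def
        by (intro DERIV_diff f(1)[OF that] has_field_derivative_at_within[OF smooth_has_deriv[OF sm]])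
      have d': "continuous_on {0..1} d'" unfolding d'_def
        by (intro continuous_on_diff f(2) smooth_continuous_on smooth_deriv sm)
      have cd: "continuous_on {0..1} d" by (rule DERIV_continuous_on[OF d])
      have norm: "L2_norm d \<le> H1_norm d" "L2_norm d' \<le> H1_norm d"
        using L2_norm_AE_cong[OF C1_H1(2)[OF d d']] by (auto simp: H1_norm_def intro!: real_le_rsqrt)
      have "\<phi> n 0 = 0" "\<phi> n 1 = 0" using \<phi>(1)[of n] by (auto simp: test_fun_def)
      then have "f 1 * (\<alpha> + \<beta>) - f 0 * \<alpha> = d 1 * g 1 - d 0 * g 0"
        by (simp add: d_def g_def)
      also have "\<dots> = (\<integral>x. d' x * g x + \<beta> * d x \<partial>leb_I)"
      proof (rule integral_Ioo_FTC[symmetric])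
        fix x :: real assume x: "x \<in> {0..1}"
        have "(g has_real_derivative \<beta>) (at x within {0..1})"
          unfolding g_def by (auto intro!: derivative_eq_intros)
        from DERIV_mult[OF d[OF x] this]
        show "((\<lambda>x. d x * g x) has_real_derivative d' x * g x + \<beta> * d x) (at x within {0..1})" .
      next
        show "continuous_on {0..1} (\<lambda>x. d' x * g x + \<beta> * d x)"
          unfolding g_def by (intro continuous_intros d' cd)
      qed simp
      also have "\<dots> = (\<integral>x. d' x * g x \<partial>leb_I) + (\<integral>x. \<beta> * d x \<partial>leb_I)"
        by (intro Bochner_Integration.integral_add L2_mult_integrable continuous_L2 g d' cd continuous_on_const)
      finally have "\<bar>f 1 * (\<alpha> + \<beta>) - f 0 * \<alpha>\<bar> \<le> \<bar>\<integral>x. d' x * g x \<partial>leb_I\<bar> + \<bar>\<integral>x. \<beta> * d x \<partial>leb_I\<bar>"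
        by simp
      also have "\<dots> \<le> L2_norm d' * L2_norm g + L2_norm (\<lambda>x. \<beta>) * L2_norm d"
        by (intro add_mono L2_Cauchy_Schwarz continuous_L2 g d' cd continuous_on_const)
      also have "\<dots> \<le> H1_norm d * L2_norm g + L2_norm (\<lambda>x. \<beta>) * H1_norm d"
        by (intro add_mono mult_left_mono mult_right_mono norm) auto
      finally show ?thesis by (simp add: k_def d_def[abs_def] algebra_simps)
    qed
    have "(\<lambda>n. H1_norm (\<lambda>x. f x - \<phi> n x) * k) \<longlonglongrightarrow> 0 * k"
      by (intro tendsto_intros \<phi>(2))
    then have "\<bar>f 1 * (\<alpha> + \<beta>) - f 0 * \<alpha>\<bar> \<le> 0"
      using bound by (intro LIMSEQ_le_const[of _ "0 :: real"]) auto
    then show ?thesis by simp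
  qed
  \<comment> \<open>The affine weights 1 - x and x isolate the two endpoints.\<close>
  show "f 0 = 0" using pairing[of 1 "- 1"] by simp
  show "f 1 = 0" using pairing[of 0 1] by simp
qed

section \<open>Approximation by test functions in the H1 norm\<close>

lemma smooth_vanishing_bound:
  assumes "smooth \<phi>" "a \<in> {0..1}" "\<phi> a = 0"
  shows "\<exists>C>0. \<forall>x\<in>{0..1}. \<bar>\<phi> x\<bar> \<le> C * \<bar>x - a\<bar> \<and> \<bar>deriv \<phi> x\<bar> \<le> C"
proof -
  obtain C where C: "C > 0" "\<And>x. x \<in> {0..1} \<Longrightarrow> \<bar>deriv \<phi> x\<bar> \<le> C"
    using continuous_bound_Icc[of 0 1 "deriv \<phi>"] smooth_continuous_on smooth_deriv assms(1) by metis
  have "norm (\<phi> x - \<phi> a) \<le> C * norm (x - a)" if "x \<in> {0..1}" for x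
    by (rule field_differentiable_bound[of "{0..1}" \<phi> "deriv \<phi>"])
       (use that assms C(2) in \<open>auto intro: has_field_derivative_at_within smooth_has_deriv\<close>)
  then show ?thesis using C assms(3) by auto
qed

text \<open>The cutoffs have derivatives of size \<open>n\<close> on a layer of width \<open>2/n\<close> in which \<open>\<phi>\<close> is of
  size \<open>1/n\<close>, so the derivatives of the truncated functions stay bounded.\<close>

lemma smooth_vanishing_H1_0:
  assumes "smooth \<phi>" "\<phi> 0 = 0" "\<phi> 1 = 0"
  shows "\<phi> \<in> H1_0"
proof -
  obtain C where C: "C > 0" "\<And>x. x \<in> {0..1} \<Longrightarrow> \<bar>\<phi> x\<bar> \<le> C * \<bar>x - 0\<bar>"
    "\<And>x. x \<in> {0..1} \<Longrightarrow> \<bar>deriv \<phi> x\<bar> \<le> C"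
    using smooth_vanishing_bound[OF assms(1) _ assms(2)] by auto
  obtain D where D: "D > 0" "\<And>x. x \<in> {0..1} \<Longrightarrow> \<bar>\<phi> x\<bar> \<le> D * \<bar>x - 1\<bar>"
    using smooth_vanishing_bound[OF assms(1) _ assms(3)] by auto
  obtain B where B: "B > 0" "\<And>x. \<bar>deriv step x\<bar> \<le> B"
    using deriv_step_bounded by metis
  define l r where "l n x = step (real n * x)" and "r n x = step (real n * (1 - x))" for n x
  define l' r' where "l' n x = real n * deriv step (real n * x)"
    and "r' n x = - real n * deriv step (real n * (1 - x))" for n x
  define d where "d n x = \<phi> x - \<phi> x * (l n x * r n x)" for n x
  define d' where "d' n x = deriv \<phi> x * (1 - l n x * r n x)
      - (\<phi> x * l' n x * r n x + \<phi> x * r' n x * l n x)" for n x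
  have smooth_lr: "smooth (l n)" "smooth (r n)" for n
    using smooth_affine[OF smooth_step, of "real n" 0] smooth_affine[OF smooth_step, of "- real n" "real n"]
    by (simp_all add: l_def[abs_def] r_def[abs_def] algebra_simps)
  have deriv_l: "(l n has_real_derivative l' n x) (at x)" for n x
    unfolding l_def[abs_def] l'_def
    by (subst mult.commute, rule DERIV_chain2[OF smooth_has_deriv[OF smooth_step]])
       (auto intro!: derivative_eq_intros)
  have deriv_r: "(r n has_real_derivative r' n x) (at x)" for n x
    unfolding r_def[abs_def] r'_def
    by (subst mult.commute, rule DERIV_chain2[OF smooth_has_deriv[OF smooth_step]])
       (auto intro!: derivative_eq_intros)
  have deriv_d: "(d n has_real_derivative d' n x) (at x)" for n x
    unfolding d_def[abs_def] d'_def
    by (rule derivative_eq_intros smooth_has_deriv assms(1) deriv_l deriv_r refl)+ (simp add: algebra_simps)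
  have smooth_d: "smooth (d n)" for n
    unfolding d_def[abs_def] by (intro smooth_diff smooth_mult assms smooth_lr)
  have deriv_d_eq: "deriv (d n) = d' n" for n
    using deriv_d by (intro ext DERIV_imp_deriv)
  have range: "\<bar>1 - l n x * r n x\<bar> \<le> 1" "\<bar>r n x\<bar> \<le> 1" "\<bar>l n x\<bar> \<le> 1" for n x
    using step_range[of "real n * x"] step_range[of "real n * (1 - x)"]
      mult_le_one[of "step (real n * x)" "step (real n * (1 - x))"]
    by (auto simp: l_def r_def abs_le_iff intro: add_nonneg_nonneg)
  have layer_l: "\<bar>\<phi> x * l' n x\<bar> \<le> 2 * C * B" if "x \<in> {0..1}" for n x
  proof (cases "real n * x \<le> 2")
    case True
    have "\<bar>\<phi> x * l' n x\<bar> = \<bar>\<phi> x\<bar> * (real n * \<bar>deriv step (real n * x)\<bar>)"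
      by (simp add: l'_def abs_mult)
    also have "\<dots> \<le> (C * x) * (real n * B)"
      using C(2)[OF that] B that by (intro mult_mono) auto
    also have "\<dots> = (real n * x) * (C * B)" by (simp add: algebra_simps)
    also have "\<dots> \<le> 2 * (C * B)" using True B C by (intro mult_right_mono) auto
    finally show ?thesis by simp
  next
    case False
    then show ?thesis using B C by (simp add: l'_def deriv_step_eq_0)
  qed
  have layer_r: "\<bar>\<phi> x * r' n x\<bar> \<le> 2 * D * B" if "x \<in> {0..1}" for n x
  proof (cases "real n * (1 - x) \<le> 2")
    case True
    have "\<bar>\<phi> x * r' n x\<bar> = \<bar>\<phi> x\<bar> * (real n * \<bar>deriv step (real n * (1 - x))\<bar>)"
      by (simp add: r'_def abs_mult)
    also have "\<dots> \<le> (D * (1 - x)) * (real n * B)"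
      using D(2)[OF that] B that by (intro mult_mono) auto
    also have "\<dots> = (real n * (1 - x)) * (D * B)" by (simp add: algebra_simps)
    also have "\<dots> \<le> 2 * (D * B)" using True B D by (intro mult_right_mono) auto
    finally show ?thesis by simp
  next
    case False
    then show ?thesis using B D by (simp add: r'_def deriv_step_eq_0)
  qed
  have bound_d: "\<bar>d n x\<bar> \<le> C" if "x \<in> {0..1}" for n x
  proof -
    have "\<bar>d n x\<bar> = \<bar>\<phi> x\<bar> * \<bar>1 - l n x * r n x\<bar>"
      by (simp add: d_def flip: abs_mult) (simp add: algebra_simps)
    also have "\<dots> \<le> (C * \<bar>x\<bar>) * 1"
      using C(2)[OF that] range(1) C(1) by (intro mult_mono) auto
    also have "\<dots> \<le> C" using that C(1) by (auto intro: mult_left_le)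
    finally show ?thesis .
  qed
  have bound_d': "\<bar>d' n x\<bar> \<le> C + (2 * C * B + 2 * D * B)" if "x \<in> {0..1}" for n x
  proof -
    have "\<bar>d' n x\<bar> \<le> \<bar>deriv \<phi> x\<bar> * \<bar>1 - l n x * r n x\<bar>
        + (\<bar>\<phi> x * l' n x\<bar> * \<bar>r n x\<bar> + \<bar>\<phi> x * r' n x\<bar> * \<bar>l n x\<bar>)"
      unfolding d'_def abs_mult[symmetric] by linarith
    also have "\<dots> \<le> C * 1 + ((2 * C * B) * 1 + (2 * D * B) * 1)"
      by (intro add_mono mult_mono range layer_l layer_r C(3) that) (use B C(1) D(1) in auto)
    finally show ?thesis by simp
  qed
  have ev: "eventually (\<lambda>n. d n x = 0 \<and> d' n x = 0) sequentially" if "x \<in> {0<..<1}" for x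
  proof -
    have "eventually (\<lambda>n. real n > 2 / x) sequentially"
      "eventually (\<lambda>n. real n > 2 / (1 - x)) sequentially"
      using filterlim_at_top_dense filterlim_real_sequentially by blast+
    then show ?thesis
    proof eventually_elim
      case (elim n)
      then have "real n * x > 2" "real n * (1 - x) > 2"
        using that by (auto simp: field_simps)
      then show ?case
        by (simp add: d_def d'_def l_def r_def l'_def r'_def step_eq_1 deriv_step_eq_0)
    qed
  qed
  have conv: "(\<lambda>n. L2_norm (h n)) \<longlonglongrightarrow> 0"
    if "\<And>n. continuous_on {0..1} (h n)" "\<And>n x. x \<in> {0..1} \<Longrightarrow> \<bar>h n x\<bar> \<le> M"
      "\<And>x. x \<in> {0<..<1} \<Longrightarrow> eventually (\<lambda>n. h n x = 0) sequentially" for h :: "nat \<Rightarrow> real \<Rightarrow> real" and M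
  proof -
    have "(\<lambda>n. \<integral>x. (h n x)\<^sup>2 \<partial>leb_I) \<longlonglongrightarrow> (\<integral>x. 0 \<partial>leb_I)"
    proof (rule integral_dominated_convergence[where w="\<lambda>x. M\<^sup>2"])
      show "(\<lambda>x. (h n x)\<^sup>2) \<in> borel_measurable leb_I" for n
        by (intro continuous_measurable_Ioo continuous_intros that)
      show "integrable leb_I (\<lambda>x. M\<^sup>2)"
        by (intro continuous_integrable_Ioo continuous_intros)
      show "AE x in leb_I. (\<lambda>n. (h n x)\<^sup>2) \<longlonglongrightarrow> 0"
      proof (rule AE_I2)
        fix x assume "x \<in> space leb_I"
        then have "eventually (\<lambda>n. h n x = 0) sequentially" using that(3) by simp
        then have "eventually (\<lambda>n. (h n x)\<^sup>2 = 0) sequentially" by eventually_elim simp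
        then show "(\<lambda>n. (h n x)\<^sup>2) \<longlonglongrightarrow> 0" by (rule tendsto_eventually)
      qed
      show "AE x in leb_I. norm ((h n x)\<^sup>2) \<le> M\<^sup>2" for n
      proof (rule AE_I2)
        fix x assume "x \<in> space leb_I"
        then have "\<bar>h n x\<bar> \<le> M" using that(2) by simp
        from power_mono[OF this, of 2] show "norm ((h n x)\<^sup>2) \<le> M\<^sup>2" by simp
      qed
    qed simp
    from tendsto_real_sqrt[OF this] show ?thesis by (simp add: L2_norm_def)
  qed
  have "(\<lambda>n. sqrt ((L2_norm (d n))\<^sup>2 + (L2_norm (d' n))\<^sup>2)) \<longlonglongrightarrow> sqrt (0\<^sup>2 + 0\<^sup>2)"
  proof (intro tendsto_intros)
    show "(\<lambda>n. L2_norm (d n)) \<longlonglongrightarrow> 0"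
      by (rule conv[of d C]) (use smooth_d bound_d ev in \<open>auto intro: smooth_continuous_on simp: eventually_conj_iff\<close>)
    have "continuous_on {0..1} (d' n)" for n
      unfolding deriv_d_eq[symmetric] by (intro smooth_continuous_on smooth_deriv smooth_d)
    then show "(\<lambda>n. L2_norm (d' n)) \<longlonglongrightarrow> 0"
      by (rule conv[of d']) (use bound_d' ev in \<open>auto simp: eventually_conj_iff\<close>)
  qed
  moreover have "H1_norm (d n) = sqrt ((L2_norm (d n))\<^sup>2 + (L2_norm (d' n))\<^sup>2)" for n
    using L2_norm_AE_cong[OF smooth_weak_deriv(2)[OF smooth_d[of n]]] by (simp add: H1_norm_def deriv_d_eq)
  ultimately have lim: "(\<lambda>n. H1_norm (d n)) \<longlonglongrightarrow> 0" by simp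
  have test: "(\<lambda>x. \<phi> x * (l n x * r n x)) \<in> test_fun I01" for n
  proof (cases "n = 0")
    case True
    then show ?thesis by (auto simp: test_fun_def l_def step_eq_0 intro!: exI[of _ "{}"])
  next
    case False
    have "\<phi> x * (l n x * r n x) = 0" if "x \<notin> {1 / n..1 - 1 / n}" for x
      using that False by (auto simp: l_def r_def field_simps intro!: step_eq_0)
    moreover have "{1 / real n..1 - 1 / real n} \<subseteq> I01"
    proof -
      have "1 / real n > 0" using False by simp
      then show ?thesis by (intro subsetI) (unfold atLeastAtMost_iff greaterThanLessThan_iff, linarith)
    qed
    ultimately show ?thesis
      unfolding test_fun_def
      by (intro CollectI conjI exI[of _ "{1 / n..1 - 1 / n}"] smooth_mult assms smooth_lr allI impI compact_Icc)
  qed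
  have "\<phi> \<in> H1" using H2_D smooth_weak_deriv(1) assms(1) by blast
  then show ?thesis
    using lim test unfolding H1_0_def d_def[abs_def]
    by (intro CollectI conjI exI[of _ "\<lambda>n x. \<phi> x * (l n x * r n x)"]) auto
qed

lemma smooth_vanishing_H_space: "smooth \<phi> \<Longrightarrow> \<phi> 0 = 0 \<Longrightarrow> \<phi> 1 = 0 \<Longrightarrow> \<phi> \<in> H_space"
  by (simp add: H_space_def smooth_weak_deriv smooth_vanishing_H1_0)

section \<open>Bochner spaces\<close>

lemma bochner_measurableE:
  assumes "bochner_measurable T X N U"
  obtains s where "AE t in lebesgue_on {0<..<T}. U t \<in> X"
    "\<And>n::nat. simple_function (lebesgue_on {0<..<T}) (s n)" "\<And>n t. t \<in> {0<..<T} \<Longrightarrow> s n t \<in> X"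
    "AE t in lebesgue_on {0<..<T}. (\<lambda>n. N (\<lambda>x. s n t x - U t x)) \<longlonglongrightarrow> 0"
  using assms unfolding bochner_measurable_def by blast

text \<open>Simple approximants of \<open>U\<close> and of \<open>\<theta>\<close> combine, time by
  time, to approximants of the sum. Space and norm stay abstract so that the argument serves
  \<open>H_space\<close> with \<open>H2_norm\<close> as well as \<open>L2\<close> with
  \<open>L2_norm\<close>.\<close>

lemma bochner_measurable_add_scale:
  assumes "bochner_measurable T X N U" "\<theta> \<in> borel_measurable (lebesgue_on {0<..<T})" "\<phi> \<in> X"
    and X: "\<And>f g c. f \<in> X \<Longrightarrow> g \<in> X \<Longrightarrow> (\<lambda>x. f x + c * g x) \<in> X"
    and N: "\<And>f. N f \<ge> 0"
      "\<And>f g c. f \<in> X \<Longrightarrow> g \<in> X \<Longrightarrow> N (\<lambda>x. f x + c * g x) \<le> N f + \<bar>c\<bar> * N g"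
  shows "bochner_measurable T X N (\<lambda>t x. U t x + \<theta> t * \<phi> x)"
proof -
  let ?M = "lebesgue_on {0<..<T}"
  from assms(1) obtain s where s: "AE t in ?M. U t \<in> X" "\<And>n::nat. simple_function ?M (s n)"
    "\<And>n t. t \<in> {0<..<T} \<Longrightarrow> s n t \<in> X" "AE t in ?M. (\<lambda>n. N (\<lambda>x. s n t x - U t x)) \<longlonglongrightarrow> 0"
    by (rule bochner_measurableE) (rule that)
  obtain \<beta> where \<beta>: "\<And>n::nat. simple_function ?M (\<beta> n)" "\<And>t. t \<in> space ?M \<Longrightarrow> (\<lambda>n. \<beta> n t) \<longlonglongrightarrow> \<theta> t"
    using borel_measurable_implies_sequence_metric[OF assms(2), of 0] by blast
  define s' where "s' n t = (\<lambda>x. s n t x + \<beta> n t * \<phi> x)" for n t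
  have "AE t in ?M. (\<lambda>n. N (\<lambda>x. s' n t x - (U t x + \<theta> t * \<phi> x))) \<longlonglongrightarrow> 0"
    using s(1,4) AE_space
  proof eventually_elim
    case (elim t)
    then have t: "t \<in> {0<..<T}" by simp
    have diff: "(\<lambda>x. s n t x - U t x) \<in> X" for n
      using X[OF s(3)[OF t] elim(1), of n "- 1"] by simp
    have eq: "(\<lambda>x. s' n t x - (U t x + \<theta> t * \<phi> x)) = (\<lambda>x. (s n t x - U t x) + (\<beta> n t - \<theta> t) * \<phi> x)" for n
      by (simp add: s'_def fun_eq_iff algebra_simps)
    have bound: "N (\<lambda>x. s' n t x - (U t x + \<theta> t * \<phi> x))
        \<le> N (\<lambda>x. s n t x - U t x) + \<bar>\<beta> n t - \<theta> t\<bar> * N \<phi>" for n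
      unfolding eq by (rule N(2)[OF diff assms(3)])
    have "(\<lambda>n. \<beta> n t) \<longlonglongrightarrow> \<theta> t" using \<beta>(2) elim(3) by blast
    then have "(\<lambda>n. N (\<lambda>x. s n t x - U t x) + \<bar>\<beta> n t - \<theta> t\<bar> * N \<phi>) \<longlonglongrightarrow> 0 + \<bar>\<theta> t - \<theta> t\<bar> * N \<phi>"
      by (intro tendsto_intros elim)
    then have lim: "(\<lambda>n. N (\<lambda>x. s n t x - U t x) + \<bar>\<beta> n t - \<theta> t\<bar> * N \<phi>) \<longlonglongrightarrow> 0" by simp
    show ?case
      by (rule tendsto_sandwich[OF _ _ tendsto_const lim]) (use bound N(1) in \<open>auto intro!: always_eventually\<close>)
  qed
  moreover have "AE t in ?M. (\<lambda>x. U t x + \<theta> t * \<phi> x) \<in> X"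
    using s(1) by eventually_elim (intro X assms)
  moreover have "simple_function ?M (s' n)" for n
    unfolding s'_def using simple_function_compose2[OF s(2) \<beta>(1), of "\<lambda>f c x. f x + c * \<phi> x"] by simp
  moreover have "s' n t \<in> X" if "t \<in> {0<..<T}" for n t
    unfolding s'_def by (intro X s(3) that assms)
  ultimately show ?thesis
    unfolding bochner_measurable_def by blast
qed

lemma L2_add_scale: "f \<in> L2 \<Longrightarrow> g \<in> L2 \<Longrightarrow> (\<lambda>x. f x + c * g x) \<in> L2"
  by (intro L2_add L2_scale)

text \<open>A simple function stays simple under any map, so \<open>F\<close> composed with the
  approximants is measurable, and the Lipschitz bound carries this to the limit. The instances are
  the norm and the inner product with a fixed g.\<close>

lemma bochner_L2_functional_measurable:
  assumes "bochner_measurable T L2 L2_norm U"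
    and F: "\<And>f g. f \<in> L2 \<Longrightarrow> g \<in> L2 \<Longrightarrow> \<bar>F f - F g\<bar> \<le> L2_norm (\<lambda>x. f x - g x) * C"
  shows "(\<lambda>t. F (U t) :: real) \<in> borel_measurable (lebesgue_on {0<..<T})"
proof -
  let ?M = "lebesgue_on {0<..<T}"
  from assms(1) obtain s where s: "AE t in ?M. U t \<in> L2" "\<And>n::nat. simple_function ?M (s n)"
    "\<And>n t. t \<in> {0<..<T} \<Longrightarrow> s n t \<in> L2" "AE t in ?M. (\<lambda>n. L2_norm (\<lambda>x. s n t x - U t x)) \<longlonglongrightarrow> 0"
    by (rule bochner_measurableE) (rule that)
  show ?thesis
  proof (rule borel_measurable_AE_LIMSEQ[of "\<lambda>n t. F (s n t)"])
    show "(\<lambda>t. F (s n t)) \<in> borel_measurable ?M" for n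
      using simple_function_compose1[OF s(2), of F] by (rule borel_measurable_simple_function)
    show "AE t in ?M. (\<lambda>n. F (s n t)) \<longlonglongrightarrow> F (U t)"
      using s(1,4) AE_space
    proof eventually_elim
      case (elim t)
      have "(\<lambda>n. L2_norm (\<lambda>x. s n t x - U t x) * C) \<longlonglongrightarrow> 0"
        using tendsto_mult[OF elim(2) tendsto_const[of C]] by simp
      then have "(\<lambda>n. F (s n t) - F (U t)) \<longlonglongrightarrow> 0"
        by (rule Lim_null_comparison[rotated])
           (use F[OF s(3) elim(1)] elim(3) in \<open>auto intro!: always_eventually\<close>)
      then show ?case by (simp add: LIM_zero_iff)
    qed
  qed simp
qed

lemma bochner_L2_norm_measurable:
  "bochner_measurable T L2 L2_norm U \<Longrightarrow> (\<lambda>t. L2_norm (U t)) \<in> borel_measurable (lebesgue_on {0<..<T})"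
  by (rule bochner_L2_functional_measurable[where C=1]) (auto simp: L2_norm_triangle_diff)

lemma bochner_L2_inner_measurable:
  assumes "bochner_measurable T L2 L2_norm U" "g \<in> L2"
  shows "(\<lambda>t. \<integral>x. U t x * g x \<partial>leb_I) \<in> borel_measurable (lebesgue_on {0<..<T})"
proof (rule bochner_L2_functional_measurable[OF assms(1), of "\<lambda>f. \<integral>x. f x * g x \<partial>leb_I" "L2_norm g"])
  fix f h assume "f \<in> L2" "h \<in> L2"
  then have "(\<integral>x. f x * g x \<partial>leb_I) - (\<integral>x. h x * g x \<partial>leb_I) = (\<integral>x. (f x - h x) * g x \<partial>leb_I)"
    using assms(2) by (simp add: left_diff_distrib L2_mult_integrable)
  then show "\<bar>(\<integral>x. f x * g x \<partial>leb_I) - (\<integral>x. h x * g x \<partial>leb_I)\<bar> \<le> L2_norm (\<lambda>x. f x - h x) * L2_norm g"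
    using L2_Cauchy_Schwarz[OF L2_diff assms(2)] \<open>f \<in> L2\<close> \<open>h \<in> L2\<close> by simp
qed

lemma L2_L2_bochner: "U \<in> L2_L2 T \<Longrightarrow> bochner_measurable T L2 L2_norm U"
  and L2_L2_AE: "U \<in> L2_L2 T \<Longrightarrow> AE t in lebesgue_on {0<..<T}. U t \<in> L2"
  and L2_L2_integrable: "U \<in> L2_L2 T \<Longrightarrow> integrable (lebesgue_on {0<..<T}) (\<lambda>t. (L2_norm (U t))\<^sup>2)"
  by (auto simp: L2_L2_def bochner_measurable_def)

lemma L2_L2_inner_integrable:
  assumes "U \<in> L2_L2 T" "g \<in> L2"
  shows "integrable (lebesgue_on {0<..<T}) (\<lambda>t. \<integral>x. U t x * g x \<partial>leb_I)"
proof (rule Bochner_Integration.integrable_bound)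
  show "integrable (lebesgue_on {0<..<T}) (\<lambda>t. (L2_norm (U t))\<^sup>2 + (L2_norm g)\<^sup>2)"
    by (intro Bochner_Integration.integrable_add L2_L2_integrable assms continuous_integrable_Ioo continuous_on_const)
  show "AE t in lebesgue_on {0<..<T}. norm (\<integral>x. U t x * g x \<partial>leb_I) \<le> norm ((L2_norm (U t))\<^sup>2 + (L2_norm g)\<^sup>2)"
    using L2_L2_AE[OF assms(1)]
  proof eventually_elim
    case (elim t)
    have "2 * L2_norm (U t) * L2_norm g \<le> (L2_norm (U t))\<^sup>2 + (L2_norm g)\<^sup>2"
      by (rule sum_squares_bound)
    moreover have "L2_norm (U t) * L2_norm g \<ge> 0" by simp
    ultimately have "L2_norm (U t) * L2_norm g \<le> (L2_norm (U t))\<^sup>2 + (L2_norm g)\<^sup>2"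
      unfolding mult.assoc by linarith
    then show ?case using L2_Cauchy_Schwarz[OF elim assms(2)] by simp
  qed
qed (rule bochner_L2_inner_measurable[OF L2_L2_bochner[OF assms(1)] assms(2)])

lemma L2_L2_add_scale:
  assumes "U \<in> L2_L2 T" "continuous_on {0..T} \<theta>" "\<phi> \<in> L2"
  shows "(\<lambda>t x. U t x + \<theta> t * \<phi> x) \<in> L2_L2 T"
proof -
  let ?M = "lebesgue_on {0<..<T}"
  have b: "bochner_measurable T L2 L2_norm (\<lambda>t x. U t x + \<theta> t * \<phi> x)"
    by (intro bochner_measurable_add_scale L2_L2_bochner assms continuous_measurable_Ioo
        L2_add_scale L2_norm_add_scale) auto
  moreover have "integrable ?M (\<lambda>t. (L2_norm (\<lambda>x. U t x + \<theta> t * \<phi> x))\<^sup>2)"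
  proof (rule Bochner_Integration.integrable_bound)
    show "integrable ?M (\<lambda>t. 2 * (L2_norm (U t))\<^sup>2 + 2 * (\<theta> t * L2_norm \<phi>)\<^sup>2)"
      by (intro Bochner_Integration.integrable_add integrable_mult_right L2_L2_integrable assms
          continuous_integrable_Ioo continuous_intros)
    show "(\<lambda>t. (L2_norm (\<lambda>x. U t x + \<theta> t * \<phi> x))\<^sup>2) \<in> borel_measurable ?M"
      using bochner_L2_norm_measurable[OF b] by (rule borel_measurable_power)
    show "AE t in ?M. norm ((L2_norm (\<lambda>x. U t x + \<theta> t * \<phi> x))\<^sup>2)
        \<le> norm (2 * (L2_norm (U t))\<^sup>2 + 2 * (\<theta> t * L2_norm \<phi>)\<^sup>2)"
      using L2_L2_AE[OF assms(1)]
    proof eventually_elim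
      case (elim t)
      have "(L2_norm (\<lambda>x. U t x + \<theta> t * \<phi> x))\<^sup>2 \<le> (L2_norm (U t) + \<bar>\<theta> t\<bar> * L2_norm \<phi>)\<^sup>2"
        by (intro power_mono L2_norm_add_scale elim assms) auto
      also have "\<dots> \<le> 2 * (L2_norm (U t))\<^sup>2 + 2 * (\<bar>\<theta> t\<bar> * L2_norm \<phi>)\<^sup>2"
        using sum_squares_bound[of "L2_norm (U t)" "\<bar>\<theta> t\<bar> * L2_norm \<phi>"] by (simp add: power2_sum)
      finally show ?case by (simp add: power_mult_distrib)
    qed
  qed
  ultimately show ?thesis by (simp add: L2_L2_def)
qed

lemma mult_continuous_integrable:
  fixes h \<zeta> :: "real \<Rightarrow> real"
  assumes "integrable (lebesgue_on {a<..<b}) h" "continuous_on {a..b} \<zeta>"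
  shows "integrable (lebesgue_on {a<..<b}) (\<lambda>t. \<zeta> t * h t)"
proof -
  obtain B where B: "\<And>t. t \<in> {a..b} \<Longrightarrow> \<bar>\<zeta> t\<bar> \<le> B"
    using continuous_bound_Icc[OF assms(2)] by metis
  show ?thesis
  proof (rule Bochner_Integration.integrable_bound)
    show "integrable (lebesgue_on {a<..<b}) (\<lambda>t. B * h t)" using assms(1) by simp
    show "(\<lambda>t. \<zeta> t * h t) \<in> borel_measurable (lebesgue_on {a<..<b})"
      by (intro borel_measurable_times continuous_measurable_Ioo assms borel_measurable_integrable)
    show "AE t in lebesgue_on {a<..<b}. norm (\<zeta> t * h t) \<le> norm (B * h t)"
    proof (rule AE_I2)
      fix t assume "t \<in> space (lebesgue_on {a<..<b})"
      then have "\<bar>\<zeta> t\<bar> \<le> \<bar>B\<bar>" using B[of t] by simp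
      then show "norm (\<zeta> t * h t) \<le> norm (B * h t)" by (simp add: abs_mult mult_right_mono)
    qed
  qed
qed

lemma test_fun_boundary:
  assumes "\<zeta> \<in> test_fun {a<..<b}"
  shows "\<zeta> a = 0" "\<zeta> b = 0"
proof -
  from assms obtain C where "C \<subseteq> {a<..<b}" "\<forall>x. x \<notin> C \<longrightarrow> \<zeta> x = 0"
    by (auto simp: test_fun_def)
  moreover have "a \<notin> {a<..<b}" "b \<notin> {a<..<b}" by auto
  ultimately show "\<zeta> a = 0" "\<zeta> b = 0" by blast+
qed

lemma test_fun_integral_by_parts:
  assumes "\<zeta> \<in> test_fun {a<..<b}" "a \<le> b"
    and m: "\<And>t. t \<in> {a..b} \<Longrightarrow> (m has_real_derivative m' t) (at t within {a..b})" "continuous_on {a..b} m'"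
  shows "(\<integral>t. deriv \<zeta> t * m t \<partial>lebesgue_on {a<..<b}) = - (\<integral>t. \<zeta> t * m' t \<partial>lebesgue_on {a<..<b})"
proof -
  note sm = test_fun_smooth[OF assms(1)]
  note cont = smooth_continuous_on[OF sm] smooth_continuous_on[OF smooth_deriv[OF sm]] DERIV_continuous_on[OF m(1)] m(2)
  have "(\<integral>t. deriv \<zeta> t * m t + m' t * \<zeta> t \<partial>lebesgue_on {a<..<b}) = \<zeta> b * m b - \<zeta> a * m a"
  proof (rule integral_Ioo_FTC)
    show "((\<lambda>t. \<zeta> t * m t) has_real_derivative deriv \<zeta> t * m t + m' t * \<zeta> t) (at t within {a..b})"
      if "t \<in> {a..b}" for t
      by (intro DERIV_mult m(1)[OF that] has_field_derivative_at_within[OF smooth_has_deriv[OF sm]])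
    show "continuous_on {a..b} (\<lambda>t. deriv \<zeta> t * m t + m' t * \<zeta> t)"
      by (intro continuous_on_add continuous_on_mult cont)
  qed (rule assms(2))
  also have "\<dots> = 0" by (simp add: test_fun_boundary[OF assms(1)])
  also have "(\<integral>t. deriv \<zeta> t * m t + m' t * \<zeta> t \<partial>lebesgue_on {a<..<b})
      = (\<integral>t. deriv \<zeta> t * m t \<partial>lebesgue_on {a<..<b}) + (\<integral>t. m' t * \<zeta> t \<partial>lebesgue_on {a<..<b})"
    by (intro Bochner_Integration.integral_add continuous_integrable_Ioo continuous_on_mult cont)
  finally show ?thesis by (simp add: mult.commute)
qed

text \<open>Pairing with g turns \<theta>(t) \<phi>(x) into the scalar k \<theta>(t), so the added
  term needs only classical integration by parts in time.\<close>

lemma has_weak_time_deriv_add_scale: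
  assumes "U \<in> L2_L2 T" "W \<in> L2_L2 T" "has_weak_time_deriv T U W" "smooth \<theta>" "\<phi> \<in> L2" "T > 0"
  shows "has_weak_time_deriv T (\<lambda>t x. U t x + \<theta> t * \<phi> x) (\<lambda>t x. W t x + deriv \<theta> t * \<phi> x)"
  unfolding has_weak_time_deriv_def
proof (intro ballI)
  fix \<zeta> g assume \<zeta>: "\<zeta> \<in> test_fun {0<..<T}" and g: "g \<in> L2"
  let ?M = "lebesgue_on {0<..<T}"
  define k where "k = (\<integral>x. \<phi> x * g x \<partial>leb_I)"
  note cont = smooth_continuous_on[OF test_fun_smooth[OF \<zeta>]] smooth_continuous_on[OF smooth_deriv[OF test_fun_smooth[OF \<zeta>]]]
    smooth_continuous_on[OF assms(4)] smooth_continuous_on[OF smooth_deriv[OF assms(4)]]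
  \<comment> \<open>Used twice: with \<zeta>', U, \<theta> for the left side of the identity and
    with \<zeta>, W, \<theta>' for the right side.\<close>
  have split: "(\<integral>t. \<xi> t * (\<integral>x. (V t x + \<beta> t * \<phi> x) * g x \<partial>leb_I) \<partial>?M)
      = (\<integral>t. \<xi> t * (\<integral>x. V t x * g x \<partial>leb_I) \<partial>?M) + k * (\<integral>t. \<xi> t * \<beta> t \<partial>?M)"
    if "V \<in> L2_L2 T" "continuous_on {0..T} \<xi>" "continuous_on {0..T} \<beta>" for V \<xi> \<beta>
  proof -
    have "(\<integral>t. \<xi> t * (\<integral>x. (V t x + \<beta> t * \<phi> x) * g x \<partial>leb_I) \<partial>?M)
        = (\<integral>t. \<xi> t * (\<integral>x. V t x * g x \<partial>leb_I) + k * (\<xi> t * \<beta> t) \<partial>?M)"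
    proof (rule integral_cong_AE_eq)
      show "AE t in ?M. \<xi> t * (\<integral>x. (V t x + \<beta> t * \<phi> x) * g x \<partial>leb_I)
          = \<xi> t * (\<integral>x. V t x * g x \<partial>leb_I) + k * (\<xi> t * \<beta> t)"
        using L2_L2_AE[OF that(1)]
      proof eventually_elim
        case (elim t)
        have "(\<integral>x. (V t x + \<beta> t * \<phi> x) * g x \<partial>leb_I) = (\<integral>x. V t x * g x \<partial>leb_I) + \<beta> t * k"
          using L2_mult_integrable[OF elim g] L2_mult_integrable[OF assms(5) g]
          by (simp add: distrib_right mult.assoc k_def)
        then show ?case by (simp add: algebra_simps)
      qed
    qed
    also have "\<dots> = (\<integral>t. \<xi> t * (\<integral>x. V t x * g x \<partial>leb_I) \<partial>?M) + (\<integral>t. k * (\<xi> t * \<beta> t) \<partial>?M)"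
    proof (rule Bochner_Integration.integral_add)
      show "integrable ?M (\<lambda>t. \<xi> t * (\<integral>x. V t x * g x \<partial>leb_I))"
        by (rule mult_continuous_integrable[OF L2_L2_inner_integrable[OF that(1) g] that(2)])
      show "integrable ?M (\<lambda>t. k * (\<xi> t * \<beta> t))"
        by (intro continuous_integrable_Ioo continuous_on_mult continuous_on_const that)
    qed
    finally show ?thesis by simp
  qed
  have "(\<integral>t. deriv \<zeta> t * \<theta> t \<partial>?M) = - (\<integral>t. \<zeta> t * deriv \<theta> t \<partial>?M)"
    by (rule test_fun_integral_by_parts[OF \<zeta> _ has_field_derivative_at_within[OF smooth_has_deriv[OF assms(4)]] cont(4)])
       (use assms(6) in simp)
  moreover have "(\<integral>t. deriv \<zeta> t * (\<integral>x. U t x * g x \<partial>leb_I) \<partial>?M) = - (\<integral>t. \<zeta> t * (\<integral>x. W t x * g x \<partial>leb_I) \<partial>?M)"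
    using assms(3) \<zeta> g by (simp add: has_weak_time_deriv_def)
  ultimately show "(\<integral>t. deriv \<zeta> t * (\<integral>x. (U t x + \<theta> t * \<phi> x) * g x \<partial>leb_I) \<partial>?M)
      = - (\<integral>t. \<zeta> t * (\<integral>x. (W t x + deriv \<theta> t * \<phi> x) * g x \<partial>leb_I) \<partial>?M)"
    unfolding split[OF assms(1) cont(2,3)] split[OF assms(2) cont(1,4)] by simp
qed

text \<open>Produces the competitors for the variational inequality. Zero boundary values of \<phi>
  give membership in \<open>H1_0\<close> but leave its slopes at 0 and 1 free; that freedom later
  exposes the natural boundary condition.\<close>

lemma K_T_add_scale:
  assumes "u \<in> K_T \<psi> T" "T > 0" "smooth \<theta>" "smooth \<phi>" "\<phi> 0 = 0" "\<phi> 1 = 0"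
    and above: "\<And>x t. x \<in> {0<..<1} \<Longrightarrow> t \<in> {0<..<T} \<Longrightarrow> \<psi> x \<le> u x t + \<theta> t * \<phi> x"
  shows "(\<lambda>x t. u x t + \<theta> t * \<phi> x) \<in> K_T \<psi> T"
proof -
  let ?M = "lebesgue_on {0<..<T}"
  have sl: "slice (\<lambda>x t. u x t + \<theta> t * \<phi> x) = (\<lambda>t x. slice u t x + \<theta> t * \<phi> x)"
    by (simp add: slice_def fun_eq_iff)
  have \<phi>: "\<phi> \<in> H_space" by (intro smooth_vanishing_H_space assms)
  have \<theta>: "continuous_on {0..T} \<theta>" "continuous_on {0..T} (deriv \<theta>)"
    by (intro smooth_continuous_on smooth_deriv assms)+
  from assms(1) have u: "slice u \<in> Linf_H T" "slice u \<in> H1_L2 T" by (auto simp: K_T_def)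
  have "(\<lambda>t x. slice u t x + \<theta> t * \<phi> x) \<in> Linf_H T"
  proof -
    from u(1) obtain M where bm: "bochner_measurable T H_space H2_norm (slice u)"
      and M: "AE t in ?M. H2_norm (slice u t) \<le> M" by (auto simp: Linf_H_def)
    obtain B where B: "\<And>t. t \<in> {0..T} \<Longrightarrow> \<bar>\<theta> t\<bar> \<le> B"
      using continuous_bound_Icc[OF \<theta>(1)] by metis
    have "bochner_measurable T H_space H2_norm (\<lambda>t x. slice u t x + \<theta> t * \<phi> x)"
      by (intro bochner_measurable_add_scale bm continuous_measurable_Ioo \<theta> \<phi> H_space_add_scale
          H2_norm_add_scale H_space_H2) auto
    moreover have "AE t in ?M. slice u t \<in> H_space"
      using bm by (simp add: bochner_measurable_def)
    then have "AE t in ?M. H2_norm (\<lambda>x. slice u t x + \<theta> t * \<phi> x) \<le> M + B * H2_norm \<phi>"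
      using M AE_space
    proof eventually_elim
      case (elim t)
      have "H2_norm (\<lambda>x. slice u t x + \<theta> t * \<phi> x) \<le> H2_norm (slice u t) + \<bar>\<theta> t\<bar> * H2_norm \<phi>"
        by (intro H2_norm_add_scale H_space_H2 elim \<phi>)
      also have "\<dots> \<le> M + B * H2_norm \<phi>"
        using elim B[of t] by (intro add_mono mult_right_mono) auto
      finally show ?case .
    qed
    ultimately show ?thesis by (auto simp: Linf_H_def)
  qed
  moreover have "(\<lambda>t x. slice u t x + \<theta> t * \<phi> x) \<in> H1_L2 T"
  proof -
    from u(2) obtain W where W: "slice u \<in> L2_L2 T" "W \<in> L2_L2 T" "has_weak_time_deriv T (slice u) W"
      by (auto simp: H1_L2_def)
    show ?thesis
      using has_weak_time_deriv_add_scale[OF W assms(3) H_space_L2[OF \<phi>] assms(2)]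
        L2_L2_add_scale[OF W(1) \<theta>(1) H_space_L2[OF \<phi>]] L2_L2_add_scale[OF W(2) \<theta>(2) H_space_L2[OF \<phi>]]
      by (auto simp: H1_L2_def)
  qed
  moreover have "AE t in ?M. AE x in leb_I. \<psi> x \<le> u x t + \<theta> t * \<phi> x"
    by (intro AE_I2) (auto intro!: above)
  ultimately show ?thesis by (simp add: K_T_def sl)
qed

section \<open>Geometry of graphs\<close>

lemma deriv_x_pair:
  assumes "x \<in> {0..1}" "\<And>y. y \<in> {0..1} \<Longrightarrow> F y = (a y, b y)"
    "(a has_real_derivative a') (at x within {0..1})" "(b has_real_derivative b') (at x within {0..1})"
  shows "deriv_x F x = (a', b')"
proof -
  have "((\<lambda>y. (a y, b y)) has_vector_derivative (a', b')) (at x within {0..1})"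
    using assms(3,4) by (intro has_vector_derivative_Pair)
      (auto simp: has_real_derivative_iff_has_vector_derivative)
  then have "(F has_vector_derivative (a', b')) (at x within {0..1})"
    by (rule has_vector_derivative_transform[OF assms(1), rotated]) (use assms(2) in auto)
  then show ?thesis
    unfolding deriv_x_def by (rule vector_derivative_within_closed_interval[rotated 2]) (use assms(1) in auto)
qed

text \<open>The derivatives of f are named as functions up to order four, the order of the energy
  gradient; the geometry then becomes algebra in p, q, r, s and powers of
  \<open>len\<close>.\<close>

locale graph_jet =
  fixes f p q r s :: "real \<Rightarrow> real"
  assumes deriv_f: "\<And>x. x \<in> {0..1} \<Longrightarrow> (f has_real_derivative p x) (at x within {0..1})"
    and deriv_p: "\<And>x. x \<in> {0..1} \<Longrightarrow> (p has_real_derivative q x) (at x within {0..1})"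
    and deriv_q: "\<And>x. x \<in> {0..1} \<Longrightarrow> (q has_real_derivative r x) (at x within {0..1})"
    and deriv_r: "\<And>x. x \<in> {0..1} \<Longrightarrow> (r has_real_derivative s x) (at x within {0..1})"
    and cont_s: "continuous_on {0..1} s"
begin

abbreviation \<gamma> :: "real \<Rightarrow> real \<times> real" where "\<gamma> \<equiv> \<lambda>x. (x, f x)"

definition len :: "real \<Rightarrow> real" where "len x = sqrt (1 + (p x)\<^sup>2)"

definition normal :: "real \<Rightarrow> real \<times> real" where "normal x = (- (p x / len x), 1 / len x)"

text \<open>The signed curvature with respect to \<open>normal\<close> and, in the next two
  definitions, its first and second derivatives in arclength.\<close>

definition curv where "curv x = q x / len x ^ 3"
definition curv_s where "curv_s x = r x / len x ^ 4 - 3 * p x * (q x)\<^sup>2 / len x ^ 6"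
definition curv_ss where "curv_ss x = s x / len x ^ 5 - 10 * p x * q x * r x / len x ^ 7
    - 3 * (q x) ^ 3 / len x ^ 7 + 18 * (p x)\<^sup>2 * (q x) ^ 3 / len x ^ 9"

lemma len_pos: "len x > 0"
  unfolding len_def by (intro real_sqrt_gt_zero add_pos_nonneg) auto

lemma len_nz [simp]: "len x \<noteq> 0"
  using len_pos[of x] by simp

lemma len_sq: "(len x)\<^sup>2 = 1 + (p x)\<^sup>2"
  unfolding len_def by (intro real_sqrt_pow2) auto

lemma deriv_len:
  assumes "x \<in> {0..1}"
  shows "(len has_real_derivative p x * q x / len x) (at x within {0..1})"
proof -
  have "1 + (p x)\<^sup>2 > 0" by (intro add_pos_nonneg) auto
  then show ?thesis
    unfolding len_def[abs_def]
    by (auto intro!: derivative_eq_intros deriv_p[OF assms] simp: field_simps)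
qed

text \<open>The curvature and energy coefficients are sums of terms h / len^n. Since len' = p q /
  len, differentiating the denominator raises its exponent by two.\<close>

lemma deriv_div_len:
  assumes "x \<in> {0..1}" "(h has_real_derivative h') (at x within {0..1})"
  shows "((\<lambda>y. h y / len y ^ n) has_real_derivative
    h' / len x ^ n - n * h x * p x * q x / len x ^ (n + 2)) (at x within {0..1})"
proof (cases n)
  case 0
  then show ?thesis using assms(2) by simp
next
  case (Suc m)
  have "((\<lambda>y. h y / len y ^ n) has_real_derivative
      (h' * len x ^ n - h x * (real n * (p x * q x / len x) * len x ^ (n - Suc 0))) / (len x ^ n * len x ^ n))
    (at x within {0..1})"
    using DERIV_divide[OF assms(2) DERIV_power[OF deriv_len[OF assms(1)], of n]] by (simp add: mult_ac)
  moreover have "(h' * len x ^ n - h x * (real n * (p x * q x / len x) * len x ^ (n - Suc 0))) / (len x ^ n * len x ^ n)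
      = h' / len x ^ n - n * h x * p x * q x / len x ^ (n + 2)"
    using Suc by (simp add: field_simps)
  ultimately show ?thesis by simp
qed

lemma continuous_jet:
  "continuous_on {0..1} f" "continuous_on {0..1} p" "continuous_on {0..1} q"
  "continuous_on {0..1} r" "continuous_on {0..1} s" "continuous_on {0..1} len"
  using DERIV_continuous_on[OF deriv_f] DERIV_continuous_on[OF deriv_p] DERIV_continuous_on[OF deriv_q]
    DERIV_continuous_on[OF deriv_r] cont_s DERIV_continuous_on[OF deriv_len] by auto

lemma deriv_x_graph: "x \<in> {0..1} \<Longrightarrow> deriv_x \<gamma> x = (1, p x)"
  by (rule deriv_x_pair[of _ _ "\<lambda>x. x" f]) (auto intro: deriv_f)

lemma norm_deriv_x_graph: "x \<in> {0..1} \<Longrightarrow> norm (deriv_x \<gamma> x) = len x"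
  by (simp add: deriv_x_graph norm_Pair len_def)

lemma tangent_graph: "x \<in> {0..1} \<Longrightarrow> deriv_s \<gamma> \<gamma> x = (1 / len x, p x / len x)"
  by (simp add: deriv_s_def norm_deriv_x_graph) (simp add: deriv_x_graph)

lemma curvature_graph:
  assumes "x \<in> {0..1}"
  shows "curvature \<gamma> x = curv x *\<^sub>R normal x"
proof -
  have t1: "((\<lambda>y. 1 / len y) has_real_derivative - (p x * q x / len x ^ 3)) (at x within {0..1})"
    using deriv_div_len[OF assms DERIV_const[of 1], of 1] by (simp add: numeral_3_eq_3)
  have t2: "((\<lambda>y. p y / len y) has_real_derivative q x / len x - p x * p x * q x / len x ^ 3) (at x within {0..1})"
    using deriv_div_len[OF assms deriv_p[OF assms], of 1] by (simp add: numeral_3_eq_3)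
  have "deriv_x (deriv_s \<gamma> \<gamma>) x = (- (p x * q x / len x ^ 3), q x / len x - p x * p x * q x / len x ^ 3)"
    by (rule deriv_x_pair[OF assms tangent_graph t1 t2])
  \<comment> \<open>len^2 - p^2 = 1 collapses the second component to a single power of
    \<open>len\<close>.\<close>
  also have "\<dots> = (- (p x * q x / len x ^ 3), q x / len x ^ 3)"
  proof -
    have "q x / len x - p x * p x * q x / len x ^ 3 = q x * ((len x)\<^sup>2 - (p x)\<^sup>2) / len x ^ 3"
      by (simp add: field_simps power2_eq_square power3_eq_cube)
    then show ?thesis by (simp add: len_sq)
  qed
  finally show ?thesis
    using assms by (simp add: curvature_def deriv_s_def norm_deriv_x_graph curv_def normal_def mult_ac)
qed

text \<open>The Frenet equations: the arclength derivative of k N is k_s N minus k times the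
  curvature times the tangent, and \<open>nabla_s\<close> projects the tangential part away. On
  normal fields it thus acts on the scalar coefficient alone.\<close>

lemma nabla_s_normal:
  assumes "x \<in> {0..1}" "\<And>y. y \<in> {0..1} \<Longrightarrow> F y = k y *\<^sub>R normal y"
    "(k has_real_derivative k') (at x within {0..1})"
  shows "nabla_s \<gamma> F x = (k' / len x) *\<^sub>R normal x"
proof -
  define a where "a = - (q x / len x - p x * p x * q x / len x ^ 3)"
  have n1: "((\<lambda>y. - (p y / len y)) has_real_derivative a) (at x within {0..1})"
    using DERIV_minus[OF deriv_div_len[OF assms(1) deriv_p[OF assms(1)], of 1]] by (simp add: a_def numeral_3_eq_3)
  have n2: "((\<lambda>y. 1 / len y) has_real_derivative - (p x * q x / len x ^ 3)) (at x within {0..1})"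
    using deriv_div_len[OF assms(1) DERIV_const[of 1], of 1] by (simp add: numeral_3_eq_3)
  have a: "a = - (q x / len x ^ 3)"
  proof -
    have "q x / len x - p x * p x * q x / len x ^ 3 = q x * ((len x)\<^sup>2 - (p x)\<^sup>2) / len x ^ 3"
      by (simp add: field_simps power2_eq_square power3_eq_cube)
    then show ?thesis by (simp add: a_def len_sq)
  qed
  have "deriv_x F x = (k' * - (p x / len x) + a * k x, k' * (1 / len x) + - (p x * q x / len x ^ 3) * k x)"
    by (rule deriv_x_pair[OF assms(1) _ DERIV_mult[OF assms(3) n1] DERIV_mult[OF assms(3) n2]])
       (simp add: assms(2) normal_def)
  also have "\<dots> = k' *\<^sub>R normal x - (k x * q x / (len x)\<^sup>2) *\<^sub>R (1 / len x, p x / len x)"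
    by (simp add: normal_def a field_simps power2_eq_square power3_eq_cube)
  finally have "deriv_s \<gamma> F x = (k' / len x) *\<^sub>R normal x - (k x * q x / (len x) ^ 3) *\<^sub>R deriv_s \<gamma> \<gamma> x"
    using assms(1) by (simp add: deriv_s_def[of _ F] tangent_graph norm_deriv_x_graph scaleR_diff_right
        power2_eq_square power3_eq_cube mult_ac)
  moreover have "normal x \<bullet> deriv_s \<gamma> \<gamma> x = 0"
    using assms(1) by (simp add: tangent_graph normal_def)
  moreover have "deriv_s \<gamma> \<gamma> x \<bullet> deriv_s \<gamma> \<gamma> x = 1"
  proof -
    have "deriv_s \<gamma> \<gamma> x \<bullet> deriv_s \<gamma> \<gamma> x = (1 + (p x)\<^sup>2) / (len x)\<^sup>2"
      using assms(1) by (simp add: tangent_graph power2_eq_square add_divide_distrib)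
    then show ?thesis by (simp flip: len_sq)
  qed
  ultimately show ?thesis
    by (simp add: nabla_s_def normal_part_def inner_diff_left)
qed

lemma normal_inner_self: "normal x \<bullet> normal x = 1"
proof -
  have "normal x \<bullet> normal x = (1 + (p x)\<^sup>2) / (len x)\<^sup>2"
    by (simp add: normal_def power2_eq_square add_divide_distrib)
  then show ?thesis by (simp flip: len_sq)
qed

lemma norm_normal: "norm (normal x) = 1"
  by (simp add: norm_eq_sqrt_inner normal_inner_self)

lemma deriv_curv:
  assumes "x \<in> {0..1}"
  shows "(curv has_real_derivative len x * curv_s x) (at x within {0..1})"
    and "(curv_s has_real_derivative len x * curv_ss x) (at x within {0..1})"
proof -
  have e: "r x / len x ^ 3 - real 3 * q x * p x * q x / len x ^ (3 + 2) = len x * curv_s x"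
    by (simp add: curv_s_def field_simps power2_eq_square eval_nat_numeral)
  show "(curv has_real_derivative len x * curv_s x) (at x within {0..1})"
    unfolding curv_def[abs_def] e[symmetric]
    by (rule deriv_div_len[OF assms deriv_q[OF assms]])
  have d: "((\<lambda>y. 3 * p y * (q y)\<^sup>2) has_real_derivative 3 * (q x) ^ 3 + 6 * p x * q x * r x) (at x within {0..1})"
    by (rule derivative_eq_intros deriv_p deriv_q assms refl)+ (simp add: field_simps eval_nat_numeral)
  have e: "(s x / len x ^ 4 - real 4 * r x * p x * q x / len x ^ (4 + 2))
    - ((3 * (q x) ^ 3 + 6 * p x * q x * r x) / len x ^ 6
      - real 6 * (3 * p x * (q x)\<^sup>2) * p x * q x / len x ^ (6 + 2)) = len x * curv_ss x"
    by (simp add: curv_ss_def field_simps eval_nat_numeral)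
  show "(curv_s has_real_derivative len x * curv_ss x) (at x within {0..1})"
    unfolding curv_s_def[abs_def] e[symmetric]
    by (intro DERIV_diff deriv_div_len assms deriv_r d)
qed

text \<open>The integrand of the elastic energy of a graph is \<open>q\<^sup>2 / len ^ 5 + lam * len\<close>; its derivative
  is \<open>P\<close> in \<open>q\<close> and \<open>- Q + lam * R\<close> in \<open>p\<close>, while \<open>P1\<close>, \<open>P2\<close>, \<open>Q1\<close>, \<open>R1\<close> are derivatives in \<open>x\<close>.\<close>

definition P where "P x = 2 * q x / len x ^ 5"
definition P1 where "P1 x = 2 * r x / len x ^ 5 - 10 * p x * (q x)\<^sup>2 / len x ^ 7"
definition P2 where "P2 x = 2 * s x / len x ^ 5 - 30 * p x * q x * r x / len x ^ 7
    - 10 * (q x) ^ 3 / len x ^ 7 + 70 * (p x)\<^sup>2 * (q x) ^ 3 / len x ^ 9"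
definition Q where "Q x = 5 * (q x)\<^sup>2 * p x / len x ^ 7"
definition Q1 where "Q1 x = (10 * p x * q x * r x + 5 * (q x) ^ 3) / len x ^ 7
    - 35 * (p x)\<^sup>2 * (q x) ^ 3 / len x ^ 9"
definition R where "R x = p x / len x"
definition R1 where "R1 x = q x / len x ^ 3"
definition grad :: "real \<Rightarrow> real \<Rightarrow> real" where "grad lam x = P2 x + Q1 x - lam * R1 x"

text \<open>The left side is the Euler-Lagrange expression of the energy density of a graph, the
  right side the scalar form of the geometric gradient. Their difference has the factor len^2 - p^2
  - 1 = 0.\<close>

lemma grad_eq_curv: "grad lam x = 2 * curv_ss x + curv x ^ 3 - lam * curv x"
proof -
  have "P2 x + Q1 x - (2 * curv_ss x + curv x ^ 3) = q x ^ 3 * ((len x)\<^sup>2 - (p x)\<^sup>2 - 1) / len x ^ 9"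
    by (simp add: P2_def Q1_def curv_ss_def curv_def power_divide add_divide_distrib diff_divide_distrib
        right_diff_distrib left_diff_distrib power_mult[symmetric])
       (simp add: field_simps eval_nat_numeral)
  then show ?thesis by (simp add: grad_def R1_def curv_def len_sq)
qed

lemma grad_energy_graph:
  assumes "x \<in> {0..1}"
  shows "grad_energy lam \<gamma> x = grad lam x *\<^sub>R normal x"
proof -
  have 1: "nabla_s \<gamma> (curvature \<gamma>) y = curv_s y *\<^sub>R normal y" if "y \<in> {0..1}" for y
    using nabla_s_normal[OF that curvature_graph deriv_curv(1)[OF that]] by simp
  have 2: "nabla_s \<gamma> (nabla_s \<gamma> (curvature \<gamma>)) x = curv_ss x *\<^sub>R normal x"
    using nabla_s_normal[OF assms 1 deriv_curv(2)[OF assms]] by simp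
  show ?thesis
    using assms by (simp add: grad_energy_def 2 curvature_graph norm_normal grad_eq_curv scaleR_left_diff_distrib
        scaleR_left_distrib eval_nat_numeral mult_ac)
qed

text \<open>The squared curvature q^2 / len^6 times the length element leaves the fifth power of
  \<open>len\<close>.\<close>

lemma elastic_energy_graph: "elastic_energy lam \<gamma> = integral {0..1} (\<lambda>x. (q x)\<^sup>2 / len x ^ 5 + lam * len x)"
proof -
  note c = continuous_jet
  have "integral_ds \<gamma> (\<lambda>x. (norm (curvature \<gamma> x))\<^sup>2) = (\<integral>x. (q x)\<^sup>2 / len x ^ 5 \<partial>leb_I)"
    unfolding integral_ds_def
    by (rule Bochner_Integration.integral_cong)
       (auto simp: curvature_graph norm_deriv_x_graph norm_normal curv_def power_divide field_simps eval_nat_numeral)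
  moreover have "integral_ds \<gamma> (\<lambda>x. 1) = (\<integral>x. len x \<partial>leb_I)"
    unfolding integral_ds_def by (rule Bochner_Integration.integral_cong) (auto simp: norm_deriv_x_graph)
  moreover have "integrable leb_I (\<lambda>x. (q x)\<^sup>2 / len x ^ 5)" "integrable leb_I len"
    by (auto intro!: continuous_integrable_Ioo continuous_intros c)
  ultimately have "elastic_energy lam \<gamma> = (\<integral>x. (q x)\<^sup>2 / len x ^ 5 + lam * len x \<partial>leb_I)"
    by (simp add: elastic_energy_def)
  then show ?thesis
    by (simp add: continuous_integral_Ioo continuous_intros c)
qed

lemma deriv_coefficients:
  assumes "x \<in> {0..1}"
  shows "(P has_real_derivative P1 x) (at x within {0..1})"
    and "(P1 has_real_derivative P2 x) (at x within {0..1})"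
    and "(Q has_real_derivative Q1 x) (at x within {0..1})"
    and "(R has_real_derivative R1 x) (at x within {0..1})"
proof -
  have d: "((\<lambda>y. 2 * q y) has_real_derivative 2 * r x) (at x within {0..1})"
    by (rule derivative_eq_intros deriv_q assms refl)+ simp
  have e: "2 * r x / len x ^ 5 - real 5 * (2 * q x) * p x * q x / len x ^ (5 + 2) = P1 x"
    by (simp add: P1_def field_simps power2_eq_square)
  show "(P has_real_derivative P1 x) (at x within {0..1})"
    unfolding P_def[abs_def] e[symmetric] by (intro deriv_div_len assms d)
  have d1: "((\<lambda>y. 2 * r y) has_real_derivative 2 * s x) (at x within {0..1})"
    by (rule derivative_eq_intros deriv_r assms refl)+ simp
  have d2: "((\<lambda>y. 10 * p y * (q y)\<^sup>2) has_real_derivative 10 * (q x) ^ 3 + 20 * p x * q x * r x) (at x within {0..1})"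
    by (rule derivative_eq_intros deriv_p deriv_q assms refl)+ (simp add: field_simps eval_nat_numeral)
  have e: "(2 * s x / len x ^ 5 - real 5 * (2 * r x) * p x * q x / len x ^ (5 + 2))
    - ((10 * (q x) ^ 3 + 20 * p x * q x * r x) / len x ^ 7
      - real 7 * (10 * p x * (q x)\<^sup>2) * p x * q x / len x ^ (7 + 2)) = P2 x"
    by (simp add: P2_def field_simps eval_nat_numeral)
  show "(P1 has_real_derivative P2 x) (at x within {0..1})"
    unfolding P1_def[abs_def] e[symmetric] by (intro DERIV_diff deriv_div_len assms d1 d2)
  have d: "((\<lambda>y. 5 * (q y)\<^sup>2 * p y) has_real_derivative 10 * p x * q x * r x + 5 * (q x) ^ 3) (at x within {0..1})"
    by (rule derivative_eq_intros deriv_p deriv_q assms refl)+ (simp add: field_simps eval_nat_numeral)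
  have e: "(10 * p x * q x * r x + 5 * (q x) ^ 3) / len x ^ 7
      - real 7 * (5 * (q x)\<^sup>2 * p x) * p x * q x / len x ^ (7 + 2) = Q1 x"
    by (simp add: Q1_def field_simps eval_nat_numeral)
  show "(Q has_real_derivative Q1 x) (at x within {0..1})"
    unfolding Q_def[abs_def] e[symmetric] by (intro deriv_div_len assms d)
  have e: "q x / len x ^ 1 - real 1 * p x * p x * q x / len x ^ (1 + 2) = R1 x"
  proof -
    have "q x / len x - p x * p x * q x / len x ^ 3 = q x * ((len x)\<^sup>2 - (p x)\<^sup>2) / len x ^ 3"
      by (simp add: field_simps power2_eq_square power3_eq_cube)
    then show ?thesis by (simp add: R1_def len_sq numeral_3_eq_3)
  qed
  show "(R has_real_derivative R1 x) (at x within {0..1})"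
    using deriv_div_len[OF assms deriv_p[OF assms], of 1] unfolding e by (simp add: R_def[abs_def])
qed

lemma continuous_coefficients:
  "continuous_on {0..1} P" "continuous_on {0..1} P1" "continuous_on {0..1} P2" "continuous_on {0..1} Q"
  "continuous_on {0..1} Q1" "continuous_on {0..1} R" "continuous_on {0..1} R1" "continuous_on {0..1} (grad lam)"
  unfolding P_def[abs_def] P1_def[abs_def] P2_def[abs_def] Q_def[abs_def] Q1_def[abs_def] R_def[abs_def]
    R1_def[abs_def] grad_def[abs_def]
  by (auto intro!: continuous_intros continuous_jet)

text \<open>The first integrand arises from differentiating the energy in time, the second is that
  of the variational inequality; they differ by lam (R w)', which integrates to 0 because w vanishes
  at the endpoints. The slopes of w are not constrained, so the terms P w' survive.\<close>

lemma first_variation: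
  assumes w: "\<And>x. x \<in> {0..1} \<Longrightarrow> (w has_real_derivative w1 x) (at x within {0..1})"
    "\<And>x. x \<in> {0..1} \<Longrightarrow> (w1 has_real_derivative w2 x) (at x within {0..1})"
    "continuous_on {0..1} w2" "w 0 = 0" "w 1 = 0"
  shows "(\<integral>x. P x * w2 x - Q x * w1 x + lam * (R x * w1 x) \<partial>leb_I)
      = (\<integral>x. grad lam x * w x \<partial>leb_I) + P 1 * w1 1 - P 0 * w1 0"
    and "(\<integral>x. P x * w2 x - Q x * w1 x - lam * (R1 x * w x) \<partial>leb_I)
      = (\<integral>x. grad lam x * w x \<partial>leb_I) + P 1 * w1 1 - P 0 * w1 0"
proof -
  note c = continuous_coefficients DERIV_continuous_on[OF w(1)] DERIV_continuous_on[OF w(2)] w(3)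
  note d = deriv_coefficients w(1,2)
  have "(\<integral>x. (P x * w2 x - Q x * w1 x) - (P2 x + Q1 x) * w x \<partial>leb_I)
      = (P 1 * w1 1 - P1 1 * w 1 - Q 1 * w 1) - (P 0 * w1 0 - P1 0 * w 0 - Q 0 * w 0)"
  proof (rule integral_Ioo_FTC)
    fix x :: real assume x: "x \<in> {0..1}"
    \<comment> \<open>Two integrations by parts in one: (P w' - P' w - Q w)' = P w'' - Q w' - (P'' +
      Q') w.\<close>
    show "((\<lambda>x. P x * w1 x - P1 x * w x - Q x * w x) has_real_derivative
        (P x * w2 x - Q x * w1 x) - (P2 x + Q1 x) * w x) (at x within {0..1})"
      by (rule derivative_eq_intros d x refl)+ (simp add: algebra_simps)
  next
    show "continuous_on {0..1} (\<lambda>x. (P x * w2 x - Q x * w1 x) - (P2 x + Q1 x) * w x)"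
      by (intro continuous_intros c)
  qed simp
  then have A: "(\<integral>x. (P x * w2 x - Q x * w1 x) - (P2 x + Q1 x) * w x \<partial>leb_I) = P 1 * w1 1 - P 0 * w1 0"
    by (simp add: w)
  have "(\<integral>x. R x * w1 x + R1 x * w x \<partial>leb_I) = R 1 * w 1 - R 0 * w 0"
  proof (rule integral_Ioo_FTC)
    fix x :: real assume x: "x \<in> {0..1}"
    show "((\<lambda>x. R x * w x) has_real_derivative R x * w1 x + R1 x * w x) (at x within {0..1})"
      by (rule derivative_eq_intros d x refl)+ (simp add: algebra_simps)
  next
    show "continuous_on {0..1} (\<lambda>x. R x * w1 x + R1 x * w x)"
      by (intro continuous_intros c)
  qed simp
  then have B: "(\<integral>x. R x * w1 x + R1 x * w x \<partial>leb_I) = 0"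
    by (simp add: w)
  have "(\<integral>x. P x * w2 x - Q x * w1 x - lam * (R1 x * w x) \<partial>leb_I)
      = (\<integral>x. ((P x * w2 x - Q x * w1 x) - (P2 x + Q1 x) * w x) + grad lam x * w x \<partial>leb_I)"
    by (simp add: grad_def algebra_simps)
  also have "\<dots> = (\<integral>x. (P x * w2 x - Q x * w1 x) - (P2 x + Q1 x) * w x \<partial>leb_I) + (\<integral>x. grad lam x * w x \<partial>leb_I)"
    by (intro Bochner_Integration.integral_add continuous_integrable_Ioo continuous_intros c)
  finally show 2: "(\<integral>x. P x * w2 x - Q x * w1 x - lam * (R1 x * w x) \<partial>leb_I)
      = (\<integral>x. grad lam x * w x \<partial>leb_I) + P 1 * w1 1 - P 0 * w1 0"
    by (simp add: A)
  have "(\<integral>x. P x * w2 x - Q x * w1 x + lam * (R x * w1 x) \<partial>leb_I)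
      = (\<integral>x. (P x * w2 x - Q x * w1 x - lam * (R1 x * w x)) + lam * (R x * w1 x + R1 x * w x) \<partial>leb_I)"
    by (simp add: algebra_simps)
  also have "\<dots> = (\<integral>x. P x * w2 x - Q x * w1 x - lam * (R1 x * w x) \<partial>leb_I)
      + (\<integral>x. lam * (R x * w1 x + R1 x * w x) \<partial>leb_I)"
    by (intro Bochner_Integration.integral_add continuous_integrable_Ioo continuous_intros c)
  also have "(\<integral>x. lam * (R x * w1 x + R1 x * w x) \<partial>leb_I) = 0"
    by (simp add: B)
  finally show "(\<integral>x. P x * w2 x - Q x * w1 x + lam * (R x * w1 x) \<partial>leb_I)
      = (\<integral>x. grad lam x * w x \<partial>leb_I) + P 1 * w1 1 - P 0 * w1 0"
    using 2 by simp
qed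

text \<open>The unit normal is (-p, 1)/len, so a vertical vector of height v has normal component
  v/len.\<close>

lemma normal_part_vertical:
  assumes "x \<in> {0..1}"
  shows "normal_part \<gamma> x (0, v) = (v / len x) *\<^sub>R normal x"
proof -
  have "v - v * (p x / len x) * (p x / len x) = v * ((len x)\<^sup>2 - (p x)\<^sup>2) / (len x)\<^sup>2"
    by (simp add: field_simps power2_eq_square)
  then have "v - v * (p x / len x) * (p x / len x) = v / (len x)\<^sup>2"
    by (simp add: len_sq)
  then show ?thesis
    using assms by (simp add: normal_part_def tangent_graph normal_def power2_eq_square)
qed

end

section \<open>The variational inequality for smooth solutions\<close>

lemma continuous_on_section:
  assumes "continuous_on (A \<times> B) (\<lambda>(x, t). g x t)"
  shows "t \<in> B \<Longrightarrow> continuous_on A (\<lambda>x. g x t)" "x \<in> A \<Longrightarrow> continuous_on B (\<lambda>t. g x t)"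
proof -
  show "continuous_on A (\<lambda>x. g x t)" if "t \<in> B"
  proof -
    have "continuous_on A (\<lambda>x. (\<lambda>(x, t). g x t) (x, t))"
      by (rule continuous_on_compose2[OF assms]) (use that in \<open>auto intro!: continuous_intros\<close>)
    then show ?thesis by simp
  qed
  show "continuous_on B (\<lambda>t. g x t)" if "x \<in> A"
  proof -
    have "continuous_on B (\<lambda>t. (\<lambda>(x, t). g x t) (x, t))"
      by (rule continuous_on_compose2[OF assms]) (use that in \<open>auto intro!: continuous_intros\<close>)
    then show ?thesis by simp
  qed
qed

lemma continuous_on_swap_args:
  assumes "continuous_on (A \<times> B) (\<lambda>(x, t). g x t)"
  shows "continuous_on (B \<times> A) (\<lambda>(t, x). g x t)"
proof -
  have "continuous_on (B \<times> A) (\<lambda>z. (\<lambda>(x, t). g x t) (snd z, fst z))"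
    by (rule continuous_on_compose2[OF assms]) (auto intro!: continuous_intros)
  then show ?thesis by (simp add: split_beta)
qed

lemma continuous_integral_param:
  fixes g :: "real \<Rightarrow> real \<Rightarrow> real"
  assumes "continuous_on ({0..1} \<times> {0..T}) (\<lambda>(x, t). g x t)"
  shows "continuous_on {0..T} (\<lambda>t. \<integral>x. g x t \<partial>leb_I)"
proof -
  have "continuous_on {0..T} (\<lambda>t. integral (cbox 0 1) (\<lambda>x. g x t))"
    by (rule integral_continuous_on_param) (use continuous_on_swap_args[OF assms] in simp)
  moreover have "(\<integral>x. g x t \<partial>leb_I) = integral (cbox 0 1) (\<lambda>x. g x t)" if "t \<in> {0..T}" for t
    using continuous_integral_Ioo[OF continuous_on_section(1)[OF assms that]] by simp
  ultimately show ?thesis by (subst continuous_on_cong[OF refl])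
qed

lemma has_real_derivative_transform:
  assumes "x \<in> S" "\<And>y. y \<in> S \<Longrightarrow> g y = f y" "(f has_real_derivative f') (at x within S)"
  shows "(g has_real_derivative f') (at x within S)"
  using assms has_derivative_transform unfolding has_field_derivative_def by blast

lemma integral_param_has_derivative:
  fixes g :: "real \<Rightarrow> real \<Rightarrow> real"
  assumes "continuous_on ({0..1} \<times> {0..T}) (\<lambda>(x, t). g x t)"
    "continuous_on ({0..1} \<times> {0..T}) (\<lambda>(x, t). g' x t)"
    "\<And>x t. x \<in> {0..1} \<Longrightarrow> t \<in> {0..T} \<Longrightarrow> ((\<lambda>t. g x t) has_real_derivative g' x t) (at t within {0..T})"
    "t \<in> {0..T}"
  shows "((\<lambda>t. \<integral>x. g x t \<partial>leb_I) has_real_derivative (\<integral>x. g' x t \<partial>leb_I)) (at t within {0..T})"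
proof -
  have "((\<lambda>t. integral (cbox 0 1) (\<lambda>x. g x t)) has_field_derivative integral (cbox 0 1) (\<lambda>x. g' x t)) (at t within {0..T})"
  proof (rule leibniz_rule_field_derivative)
    show "continuous_on ({0..T} \<times> cbox 0 1) (\<lambda>(t, x). g' x t)"
      using continuous_on_swap_args[OF assms(2)] by simp
    show "(\<lambda>x. g x t) integrable_on cbox 0 1" if "t \<in> {0..T}" for t
      using continuous_on_section(1)[OF assms(1) that] by (intro integrable_continuous) simp
  qed (use assms in auto)
  moreover have "(\<integral>x. g x t \<partial>leb_I) = integral (cbox 0 1) (\<lambda>x. g x t)" if "t \<in> {0..T}" for t
    using continuous_integral_Ioo[OF continuous_on_section(1)[OF assms(1) that]] by simp
  moreover have "(\<integral>x. g' x t \<partial>leb_I) = integral (cbox 0 1) (\<lambda>x. g' x t)"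
    using continuous_integral_Ioo[OF continuous_on_section(1)[OF assms(2,4)]] by simp
  ultimately show ?thesis
    using has_real_derivative_transform[OF assms(4)] by metis
qed

text \<open>The weight \<open>Z\<close> is merely integrable (later a difference of a weak and a
  classical time derivative), so the integrand need not be jointly continuous; dominated convergence
  with bound |Z| M takes over.\<close>

lemma continuous_on_weighted_integral:
  fixes Z :: "real \<Rightarrow> real" and G :: "real \<Rightarrow> real \<Rightarrow> real"
  assumes "integrable leb_I Z" "continuous_on ({0..1} \<times> {0..T}) (\<lambda>(x, t). G x t)"
  shows "continuous_on {0..T} (\<lambda>t. \<integral>x. Z x * G x t \<partial>leb_I)"
  unfolding continuous_on_sequentially
proof (intro allI ballI impI, elim conjE)
  fix \<tau> :: "nat \<Rightarrow> real" and t assume t: "t \<in> {0..T}" and \<tau>: "\<forall>n. \<tau> n \<in> {0..T}" "\<tau> \<longlonglongrightarrow> t"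
  have "compact ((\<lambda>(x, t). G x t) ` ({0..1} \<times> {0..T}))"
    by (intro compact_continuous_image assms compact_Times) auto
  then obtain M where M: "\<forall>y \<in> (\<lambda>(x, t). G x t) ` ({0..1} \<times> {0..T}). norm y \<le> M"
    using compact_imp_bounded bounded_iff by metis
  show "((\<lambda>t. \<integral>x. Z x * G x t \<partial>leb_I) \<circ> \<tau>) \<longlonglongrightarrow> (\<integral>x. Z x * G x t \<partial>leb_I)"
    unfolding comp_def
  proof (rule integral_dominated_convergence[where w="\<lambda>x. \<bar>Z x\<bar> * M"])
    show "(\<lambda>x. Z x * G x t) \<in> borel_measurable leb_I"
      by (intro borel_measurable_times borel_measurable_integrable[OF assms(1)] continuous_measurable_Ioo
          continuous_on_section(1)[OF assms(2)] t)
    show "(\<lambda>x. Z x * G x (\<tau> n)) \<in> borel_measurable leb_I" for n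
      by (intro borel_measurable_times borel_measurable_integrable[OF assms(1)] continuous_measurable_Ioo
          continuous_on_section(1)[OF assms(2)] \<tau>(1)[rule_format])
    show "AE x in leb_I. (\<lambda>n. Z x * G x (\<tau> n)) \<longlonglongrightarrow> Z x * G x t"
    proof (rule AE_I2)
      fix x assume "x \<in> space leb_I"
      then have "continuous_on {0..T} (\<lambda>t. G x t)"
        by (intro continuous_on_section(2)[OF assms(2)]) auto
      then have "(\<lambda>n. G x (\<tau> n)) \<longlonglongrightarrow> G x t"
        using t \<tau> unfolding continuous_on_sequentially comp_def by blast
      then show "(\<lambda>n. Z x * G x (\<tau> n)) \<longlonglongrightarrow> Z x * G x t" by (intro tendsto_intros)
    qed
    show "AE x in leb_I. norm (Z x * G x (\<tau> n)) \<le> \<bar>Z x\<bar> * M" for n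
    proof (rule AE_I2)
      fix x assume "x \<in> space leb_I"
      then have "\<bar>G x (\<tau> n)\<bar> \<le> M" using M \<tau>(1) by auto
      then show "norm (Z x * G x (\<tau> n)) \<le> \<bar>Z x\<bar> * M" by (simp add: abs_mult mult_left_mono)
    qed
    show "integrable leb_I (\<lambda>x. \<bar>Z x\<bar> * M)"
      using assms(1) by auto
  qed
qed

text \<open>If h t0 were nonzero, h would keep its sign near t0 and its integral against a narrow
  bump could not vanish. Only bumps narrower than \<eta> are asked for, since wider ones may leave
  the region where perturbations of both signs are admissible.\<close>

lemma bump_integral_localize:
  assumes "continuous_on {a..b} h" "t0 \<in> {a<..<b}" "\<eta> > 0"
    and zero: "\<And>\<delta>. 0 < \<delta> \<Longrightarrow> \<delta> < \<eta> \<Longrightarrow> (\<integral>t. bump (t0 - \<delta>) (t0 + \<delta>) t * h t \<partial>lebesgue_on {a<..<b}) = 0"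
  shows "h t0 = 0"
proof (rule ccontr)
  assume nz: "h t0 \<noteq> 0"
  have "t0 \<in> {a..b}" using assms(2) by simp
  then obtain d where d: "d > 0" "\<And>t. t \<in> {a..b} \<Longrightarrow> dist t t0 < d \<Longrightarrow> dist (h t) (h t0) < \<bar>h t0\<bar>"
    using assms(1) nz unfolding continuous_on_iff by (metis zero_less_abs_iff)
  \<comment> \<open>Half of the smaller scale keeps the bump both admissible and inside the interval
    where h has the sign of h t0.\<close>
  define \<delta> where "\<delta> = min d \<eta> / 2"
  have \<delta>: "0 < \<delta>" "\<delta> < \<eta>" "\<delta> < d" using d(1) assms(3) by (auto simp: \<delta>_def)
  define g where "g t = bump (t0 - \<delta>) (t0 + \<delta>) t * (sgn (h t0) * h t)" for t
  have g_cont: "continuous_on {a..b} g" unfolding g_def[abs_def]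
    by (intro continuous_intros smooth_continuous_on smooth_bump assms)
  have g_nonneg: "g t \<ge> 0" if "t \<in> {a..b}" for t
  proof (cases "\<bar>t - t0\<bar> < \<delta>")
    case True
    then have "\<bar>h t - h t0\<bar> < \<bar>h t0\<bar>" using d(2)[OF that] \<delta> by (simp add: dist_real_def)
    then have "sgn (h t0) * h t \<ge> 0" by (auto simp: sgn_real_def split: if_splits)
    then show ?thesis by (simp add: g_def bump_nonneg)
  next
    case False
    then have "bump (t0 - \<delta>) (t0 + \<delta>) t = 0" by (intro bump_eq_0) linarith
    then show ?thesis by (simp add: g_def)
  qed
  have "integral\<^sup>L (lebesgue_on {a<..<b}) g = 0"
  proof -
    have "integral\<^sup>L (lebesgue_on {a<..<b}) g = (\<integral>t. sgn (h t0) * (bump (t0 - \<delta>) (t0 + \<delta>) t * h t) \<partial>lebesgue_on {a<..<b})"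
      by (simp add: g_def[abs_def] mult_ac)
    also have "\<dots> = 0" using zero[OF \<delta>(1,2)] by simp
    finally show ?thesis .
  qed
  then have "AE t in lebesgue_on {a<..<b}. g t = 0"
    using continuous_integrable_Ioo[OF g_cont] g_nonneg
    by (subst (asm) integral_nonneg_eq_0_iff_AE) (auto intro!: AE_I2)
  then have "g t0 = 0"
    using assms(2) by (intro AE_continuous_eq_0[OF _ g_cont]) auto
  moreover have "g t0 > 0"
    using \<delta> nz bump_pos[of "t0 - \<delta>" t0 "t0 + \<delta>"] by (auto simp: g_def sgn_mult_self_eq mult.commute sgn_real_def)
  ultimately show False by simp
qed

section \<open>Functions smooth up to the boundary of the space-time rectangle\<close>

locale smooth_rect =
  fixes T :: real and u :: "real \<Rightarrow> real \<Rightarrow> real" and D :: "nat \<Rightarrow> nat \<Rightarrow> real \<Rightarrow> real \<Rightarrow> real"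
  assumes T_pos: "T > 0"
    and D_0: "\<And>x t. x \<in> {0..1} \<Longrightarrow> t \<in> {0..T} \<Longrightarrow> D 0 0 x t = u x t"
    and D_cont: "\<And>i j. continuous_on ({0..1} \<times> {0..T}) (\<lambda>(x, t). D i j x t)"
    and D_x: "\<And>i j x t. x \<in> {0..1} \<Longrightarrow> t \<in> {0..T} \<Longrightarrow>
      ((\<lambda>y. D i j y t) has_real_derivative D (Suc i) j x t) (at x within {0..1})"
    and D_t: "\<And>i j x t. x \<in> {0..1} \<Longrightarrow> t \<in> {0..T} \<Longrightarrow>
      ((\<lambda>s. D i j x s) has_real_derivative D i (Suc j) x t) (at t within {0..T})"
begin

lemma u_x:
  assumes "x \<in> {0..1}" "t \<in> {0..T}"
  shows "((\<lambda>y. u y t) has_real_derivative D 1 0 x t) (at x within {0..1})"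
  using has_real_derivative_transform[OF assms(1) _ D_x[OF assms, of 0 0]] D_0 assms by simp

lemma u_t:
  assumes "x \<in> {0..1}" "t \<in> {0..T}"
  shows "((\<lambda>s. u x s) has_real_derivative D 0 1 x t) (at t within {0..T})"
  using has_real_derivative_transform[OF assms(2) _ D_t[OF assms, of 0 0]] D_0 assms by simp

lemma D_cont_x: "t \<in> {0..T} \<Longrightarrow> continuous_on {0..1} (\<lambda>x. D i j x t)"
  and D_cont_t: "x \<in> {0..1} \<Longrightarrow> continuous_on {0..T} (\<lambda>t. D i j x t)"
  using continuous_on_section[OF D_cont] by blast+

lemma jet:
  assumes "t \<in> {0..T}"
  shows "graph_jet (\<lambda>x. u x t) (\<lambda>x. D 1 0 x t) (\<lambda>x. D 2 0 x t) (\<lambda>x. D 3 0 x t) (\<lambda>x. D 4 0 x t)"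
  using u_x D_x[of _ t 1 0] D_x[of _ t 2 0] D_x[of _ t 3 0] D_cont_x assms
  by unfold_locales (auto simp: eval_nat_numeral)

text \<open>The length element at time t, followed by the other coefficients.
  \<open>graph_jet\<close> is available only for t in [0,T], so the explicit formulas
  \<open>L_eq\<close>, \<open>Pt_eq\<close> and the like carry that condition.\<close>

definition L where "L x t = graph_jet.len (\<lambda>x. D 1 0 x t) x"
definition Pt where "Pt x t = graph_jet.P (\<lambda>x. D 1 0 x t) (\<lambda>x. D 2 0 x t) x"
definition Qt where "Qt x t = graph_jet.Q (\<lambda>x. D 1 0 x t) (\<lambda>x. D 2 0 x t) x"
definition Rt where "Rt x t = graph_jet.R (\<lambda>x. D 1 0 x t) x"
definition R1t where "R1t x t = graph_jet.R1 (\<lambda>x. D 1 0 x t) (\<lambda>x. D 2 0 x t) x"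
definition gradt where
  "gradt lam x t = graph_jet.grad (\<lambda>x. D 1 0 x t) (\<lambda>x. D 2 0 x t) (\<lambda>x. D 3 0 x t) (\<lambda>x. D 4 0 x t) lam x"

lemma L_eq: "t \<in> {0..T} \<Longrightarrow> L x t = sqrt (1 + (D 1 0 x t)\<^sup>2)"
  unfolding L_def using graph_jet.len_def[OF jet] by simp

lemma L_pos: "t \<in> {0..T} \<Longrightarrow> L x t > 0"
  unfolding L_def using graph_jet.len_pos[OF jet] by simp

lemma L_cont: "continuous_on ({0..1} \<times> {0..T}) (\<lambda>(x, t). L x t)"
proof -
  have "continuous_on ({0..1} \<times> {0..T}) (\<lambda>z. sqrt (1 + (D 1 0 (fst z) (snd z))\<^sup>2))"
    using D_cont[of 1 0] by (auto intro!: continuous_intros simp: split_beta)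
  then show ?thesis
    by (rule continuous_on_eq) (auto simp: L_eq)
qed

lemma Pt_eq: "t \<in> {0..T} \<Longrightarrow> Pt x t = 2 * D 2 0 x t / L x t ^ 5"
  unfolding Pt_def L_def using graph_jet.P_def[OF jet] by simp

lemma Qt_eq: "t \<in> {0..T} \<Longrightarrow> Qt x t = 5 * (D 2 0 x t)\<^sup>2 * D 1 0 x t / L x t ^ 7"
  unfolding Qt_def L_def using graph_jet.Q_def[OF jet] by simp

lemma Rt_eq: "t \<in> {0..T} \<Longrightarrow> Rt x t = D 1 0 x t / L x t"
  unfolding Rt_def L_def using graph_jet.R_def[OF jet] by simp

lemma R1t_eq: "t \<in> {0..T} \<Longrightarrow> R1t x t = D 2 0 x t / L x t ^ 3"
  unfolding R1t_def L_def using graph_jet.R1_def[OF jet] by simp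

lemma gradt_eq: "t \<in> {0..T} \<Longrightarrow> gradt lam x t =
    2 * D 4 0 x t / L x t ^ 5 - 30 * D 1 0 x t * D 2 0 x t * D 3 0 x t / L x t ^ 7
    - 10 * (D 2 0 x t) ^ 3 / L x t ^ 7 + 70 * (D 1 0 x t)\<^sup>2 * (D 2 0 x t) ^ 3 / L x t ^ 9
    + ((10 * D 1 0 x t * D 2 0 x t * D 3 0 x t + 5 * (D 2 0 x t) ^ 3) / L x t ^ 7
      - 35 * (D 1 0 x t)\<^sup>2 * (D 2 0 x t) ^ 3 / L x t ^ 9) - lam * (D 2 0 x t / L x t ^ 3)"
  unfolding gradt_def L_def
  using graph_jet.grad_def[OF jet] graph_jet.P2_def[OF jet] graph_jet.Q1_def[OF jet] graph_jet.R1_def[OF jet]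
  by simp

lemma rect_cont:
  "continuous_on ({0..1} \<times> {0..T}) (\<lambda>(x, t). Pt x t)" "continuous_on ({0..1} \<times> {0..T}) (\<lambda>(x, t). Qt x t)"
  "continuous_on ({0..1} \<times> {0..T}) (\<lambda>(x, t). Rt x t)"
  "continuous_on ({0..1} \<times> {0..T}) (\<lambda>(x, t). gradt lam x t)"
proof -
  have D: "continuous_on ({0..1} \<times> {0..T}) (\<lambda>z. D i j (fst z) (snd z))" for i j
    using D_cont by (simp add: split_beta)
  have L: "continuous_on ({0..1} \<times> {0..T}) (\<lambda>z. L (fst z) (snd z))"
    using L_cont by (simp add: split_beta)
  have nz: "L (fst z) (snd z) ^ n \<noteq> 0" if "z \<in> {0..1} \<times> {0..T}" for z n
    using L_pos[of "snd z" "fst z"] that by auto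
  have nz1: "L (fst z) (snd z) \<noteq> 0" if "z \<in> {0..1} \<times> {0..T}" for z
    using L_pos[of "snd z" "fst z"] that by auto
  have "continuous_on ({0..1} \<times> {0..T}) (\<lambda>z. 2 * D 2 0 (fst z) (snd z) / L (fst z) (snd z) ^ 5)"
    by (intro continuous_intros D L ballI nz)
  then show "continuous_on ({0..1} \<times> {0..T}) (\<lambda>(x, t). Pt x t)"
    by (rule continuous_on_eq) (auto simp: Pt_eq)
  have "continuous_on ({0..1} \<times> {0..T}) (\<lambda>z. 5 * (D 2 0 (fst z) (snd z))\<^sup>2 * D 1 0 (fst z) (snd z) / L (fst z) (snd z) ^ 7)"
    by (intro continuous_intros D L ballI nz)
  then show "continuous_on ({0..1} \<times> {0..T}) (\<lambda>(x, t). Qt x t)"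
    by (rule continuous_on_eq) (auto simp: Qt_eq)
  have "continuous_on ({0..1} \<times> {0..T}) (\<lambda>z. D 1 0 (fst z) (snd z) / L (fst z) (snd z))"
    by (intro continuous_intros D L ballI nz1)
  then show "continuous_on ({0..1} \<times> {0..T}) (\<lambda>(x, t). Rt x t)"
    by (rule continuous_on_eq) (auto simp: Rt_eq)
  have "continuous_on ({0..1} \<times> {0..T}) (\<lambda>z. let x = fst z; t = snd z in
    2 * D 4 0 x t / L x t ^ 5 - 30 * D 1 0 x t * D 2 0 x t * D 3 0 x t / L x t ^ 7
    - 10 * (D 2 0 x t) ^ 3 / L x t ^ 7 + 70 * (D 1 0 x t)\<^sup>2 * (D 2 0 x t) ^ 3 / L x t ^ 9
    + ((10 * D 1 0 x t * D 2 0 x t * D 3 0 x t + 5 * (D 2 0 x t) ^ 3) / L x t ^ 7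
      - 35 * (D 1 0 x t)\<^sup>2 * (D 2 0 x t) ^ 3 / L x t ^ 9) - lam * (D 2 0 x t / L x t ^ 3))"
    unfolding Let_def by (intro continuous_intros D L ballI nz)
  then show "continuous_on ({0..1} \<times> {0..T}) (\<lambda>(x, t). gradt lam x t)"
    by (rule continuous_on_eq) (auto simp: gradt_eq)
qed

text \<open>The coefficient of the unit normal in the sum of normal velocity and energy gradient;
  its vanishing is the flow equation at (x,t).\<close>

definition residual where "residual lam x t = D 0 1 x t / L x t + gradt lam x t"

lemma residual_cont: "continuous_on ({0..1} \<times> {0..T}) (\<lambda>(x, t). residual lam x t)"
proof -
  have nz: "L (fst z) (snd z) \<noteq> 0" if "z \<in> {0..1} \<times> {0..T}" for z
    using L_pos[of "snd z" "fst z"] that by auto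
  have "continuous_on ({0..1} \<times> {0..T})
      (\<lambda>z. D 0 1 (fst z) (snd z) / L (fst z) (snd z) + gradt lam (fst z) (snd z))"
    using D_cont[of 0 1] L_cont rect_cont(4)[of lam]
    by (intro continuous_intros ballI nz) (simp_all add: split_beta)
  then show ?thesis by (simp add: residual_def split_beta)
qed

lemma weak_deriv_slice:
  assumes "t \<in> {0..T}"
  shows "AE x in leb_I. weak_deriv (slice u t) x = D 1 0 x t"
    "AE x in leb_I. weak_deriv (weak_deriv (slice u t)) x = D 2 0 x t"
proof -
  note d = graph_jet.deriv_f[OF jet[OF assms]] graph_jet.deriv_p[OF jet[OF assms]]
  show "AE x in leb_I. weak_deriv (slice u t) x = D 1 0 x t"
    unfolding slice_def by (rule C1_H1(2)) (use d D_cont_x assms in auto)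
  show "AE x in leb_I. weak_deriv (weak_deriv (slice u t)) x = D 2 0 x t"
    unfolding slice_def by (rule C2_H2(2)) (use d D_cont_x assms in auto)
qed

text \<open>Paired with a fixed g, u becomes a C1 scalar function of time. Comparing its weak and
  classical integration by parts, the fundamental lemma in time gives the equality.\<close>

lemma weak_time_deriv_inner:
  assumes W: "W \<in> L2_L2 T" "has_weak_time_deriv T (slice u) W" and g: "continuous_on {0..1} g"
  shows "AE t in lebesgue_on {0<..<T}. (\<integral>x. W t x * g x \<partial>leb_I) = (\<integral>x. D 0 1 x t * g x \<partial>leb_I)"
proof -
  let ?M = "lebesgue_on {0<..<T}"
  define m m' where "m t = (\<integral>x. D 0 0 x t * g x \<partial>leb_I)" and "m' t = (\<integral>x. D 0 1 x t * g x \<partial>leb_I)" for t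
  have cg: "continuous_on ({0..1} \<times> {0..T}) (\<lambda>(x, t). D i j x t * g x)" for i j
  proof -
    have "continuous_on ({0..1} \<times> {0..T}) (\<lambda>z. g (fst z))"
      by (rule continuous_on_compose2[OF g]) (auto intro!: continuous_intros)
    then show ?thesis
      using D_cont[of i j] by (simp add: split_beta continuous_on_mult)
  qed
  have m: "(m has_real_derivative m' t) (at t within {0..T})" if "t \<in> {0..T}" for t
    unfolding m_def m'_def
    by (rule integral_param_has_derivative[OF cg cg _ that]) (use D_t[of _ _ 0 0] in \<open>auto intro!: DERIV_cmult_right\<close>)
  have m': "continuous_on {0..T} m'"
    unfolding m'_def by (rule continuous_integral_param[OF cg])
  have "AE t in ?M. (\<integral>x. W t x * g x \<partial>leb_I) - m' t = 0"
  proof (rule fundamental_lemma_variations)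
    have i: "integrable ?M (\<lambda>t. \<integral>x. W t x * g x \<partial>leb_I)" "integrable ?M m'"
      using L2_L2_inner_integrable[OF W(1) continuous_L2[OF g]] continuous_integrable_Ioo[OF m'] by auto
    then show "integrable ?M (\<lambda>t. (\<integral>x. W t x * g x \<partial>leb_I) - m' t)" by simp
    fix \<zeta> assume \<zeta>: "\<zeta> \<in> test_fun {0<..<T}"
    note c = smooth_continuous_on[OF test_fun_smooth[OF \<zeta>]]
    have "(\<integral>t. \<zeta> t * (\<integral>x. W t x * g x \<partial>leb_I) \<partial>?M) = - (\<integral>t. deriv \<zeta> t * (\<integral>x. slice u t x * g x \<partial>leb_I) \<partial>?M)"
      using W(2) \<zeta> continuous_L2[OF g] unfolding has_weak_time_deriv_def by simp
    also have "(\<integral>t. deriv \<zeta> t * (\<integral>x. slice u t x * g x \<partial>leb_I) \<partial>?M) = (\<integral>t. deriv \<zeta> t * m t \<partial>?M)"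
      by (intro Bochner_Integration.integral_cong refl arg_cong2[where f=times])
         (auto simp: m_def slice_def D_0 intro!: Bochner_Integration.integral_cong)
    also have "\<dots> = - (\<integral>t. \<zeta> t * m' t \<partial>?M)"
      by (rule test_fun_integral_by_parts[OF \<zeta> _ m m']) (use T_pos in auto)
    finally have "(\<integral>t. \<zeta> t * (\<integral>x. W t x * g x \<partial>leb_I) \<partial>?M) = (\<integral>t. \<zeta> t * m' t \<partial>?M)" by simp
    then show "(\<integral>t. ((\<integral>x. W t x * g x \<partial>leb_I) - m' t) * \<zeta> t \<partial>?M) = 0"
      using mult_continuous_integrable[OF i(1) c] mult_continuous_integrable[OF i(2) c]
      by (simp add: right_diff_distrib mult.commute)
  qed
  then show ?thesis by (simp add: m'_def)
qed

text \<open>The exceptional null set of times depends on \<open>g\<close> above; testing against the countably many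
  \<open>G(\<cdot>, q)\<close> with \<open>q\<close> rational makes it uniform.\<close>

lemma weak_time_deriv_pairing:
  assumes W: "W \<in> L2_L2 T" "has_weak_time_deriv T (slice u) W"
    and G: "continuous_on ({0..1} \<times> {0..T}) (\<lambda>(x, t). G x t)"
  shows "AE t in lebesgue_on {0<..<T}. (\<integral>x. W t x * G x t \<partial>leb_I) = (\<integral>x. D 0 1 x t * G x t \<partial>leb_I)"
proof -
  let ?S = "{0<..<T} \<inter> \<rat>"
  have "AE t in lebesgue_on {0<..<T}. \<forall>\<tau>\<in>?S. (\<integral>x. W t x * G x \<tau> \<partial>leb_I) = (\<integral>x. D 0 1 x t * G x \<tau> \<partial>leb_I)"
  proof (subst AE_ball_countable)
    show "countable ?S"
      by (rule countable_subset[OF _ countable_rat]) auto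
    show "\<forall>\<tau>\<in>?S. AE t in lebesgue_on {0<..<T}. (\<integral>x. W t x * G x \<tau> \<partial>leb_I) = (\<integral>x. D 0 1 x t * G x \<tau> \<partial>leb_I)"
      by (intro ballI weak_time_deriv_inner W continuous_on_section(1)[OF G]) auto
  qed
  then show ?thesis
    using L2_L2_AE[OF W(1)] AE_space
  proof eventually_elim
    case (elim t)
    then have t: "t \<in> {0<..<T}" by simp
    define Z where "Z x = W t x - D 0 1 x t" for x
    have L2: "W t \<in> L2" "(\<lambda>x. D 0 1 x t) \<in> L2"
      using elim t by (auto intro!: continuous_L2 D_cont_x)
    have split: "(\<integral>x. Z x * G x \<tau> \<partial>leb_I) = (\<integral>x. W t x * G x \<tau> \<partial>leb_I) - (\<integral>x. D 0 1 x t * G x \<tau> \<partial>leb_I)"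
      if "\<tau> \<in> {0..T}" for \<tau>
      using L2_mult_integrable[OF L2(1) continuous_L2[OF continuous_on_section(1)[OF G that]]]
        L2_mult_integrable[OF L2(2) continuous_L2[OF continuous_on_section(1)[OF G that]]]
      by (simp add: Z_def left_diff_distrib)
    \<comment> \<open>The second argument of \<open>G\<close> is decoupled from t: with
      \<open>Z\<close> fixed, the pairing is continuous in \<tau> and zero at rational \<tau>, hence
      zero at \<tau> = t.\<close>
    have cont: "continuous_on {0..T} (\<lambda>\<tau>. \<integral>x. Z x * G x \<tau> \<partial>leb_I)"
      unfolding Z_def by (intro continuous_on_weighted_integral L2_integrable L2_diff L2 G)
    have "closure ?S \<subseteq> {0..T}"
      by (rule closure_minimal) auto
    moreover have "{0<..<T} \<inter> closure \<rat> \<subseteq> closure ?S"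
      by (rule open_Int_closure_subset) simp
    then have "t \<in> closure ?S" using t by (auto simp: Rats_closure_real)
    ultimately have t_closure: "closure ?S \<subseteq> {0..T}" "t \<in> closure ?S" by auto
    have "(\<integral>x. Z x * G x \<tau> \<partial>leb_I) = 0" if "\<tau> \<in> ?S" for \<tau>
      using elim(1) split[of \<tau>] that by auto
    from continuous_constant_on_closure[OF continuous_on_subset[OF cont t_closure(1)] this t_closure(2)]
    have "(\<integral>x. Z x * G x t \<partial>leb_I) = 0" .
    then show ?case using split[of t] t by simp
  qed
qed

end

section \<open>Pointwise consequences of the variational inequality\<close>

locale obstacle_solution = smooth_rect +
  fixes lam :: real and \<psi> u0 :: "real \<Rightarrow> real"
  assumes psi_cont: "continuous_on {0..1} \<psi>" and psi_0: "\<psi> 0 < 0" and psi_1: "\<psi> 1 < 0"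
    and weak_sol: "weak_solution lam \<psi> T u0 u"
begin

lemma u_K_T: "u \<in> K_T \<psi> T"
  using weak_sol by (simp add: weak_solution_def)

lemma obstacle_cont: "continuous_on ({0..1} \<times> {0..T}) (\<lambda>(x, t). u x t - \<psi> x)"
proof -
  have "continuous_on ({0..1} \<times> {0..T}) (\<lambda>z. \<psi> (fst z))"
    by (rule continuous_on_compose2[OF psi_cont]) (auto intro!: continuous_intros)
  then have "continuous_on ({0..1} \<times> {0..T}) (\<lambda>z. D 0 0 (fst z) (snd z) - \<psi> (fst z))"
    using D_cont[of 0 0] by (simp add: split_beta continuous_on_diff)
  then show ?thesis
    by (rule continuous_on_eq) (auto simp: D_0)
qed

text \<open>The double almost-everywhere inequality is upgraded one variable at a time: in x for
  almost every t, then in t at the given x.\<close>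

lemma above_obstacle:
  assumes "x \<in> {0..1}" "t \<in> {0..T}"
  shows "\<psi> x \<le> u x t"
proof -
  have "AE t in lebesgue_on {0<..<T}. AE x in leb_I. \<psi> x \<le> u x t"
    using u_K_T by (simp add: K_T_def)
  then have "AE t in lebesgue_on {0<..<T}. 0 \<le> u x t - \<psi> x"
    using AE_space
  proof eventually_elim
    case (elim t)
    then have "t \<in> {0..T}" by simp
    then show ?case
      using elim(1) assms(1)
      by (intro AE_continuous_nonneg[of 0 1 "\<lambda>x. u x t - \<psi> x"] continuous_on_section(1)[OF obstacle_cont]) auto
  qed
  then have "0 \<le> u x t - \<psi> x"
    using assms T_pos by (intro AE_continuous_nonneg[of 0 T "\<lambda>t. u x t - \<psi> x"] continuous_on_section(2)[OF obstacle_cont]) auto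
  then show ?thesis by simp
qed

lemma boundary_values:
  assumes "t \<in> {0..T}"
  shows "u 0 t = 0" "u 1 t = 0"
proof -
  have "AE t in lebesgue_on {0<..<T}. slice u t \<in> H_space"
    using u_K_T by (simp add: K_T_def Linf_H_def bochner_measurable_def)
  then have *: "AE t in lebesgue_on {0<..<T}. D 0 0 0 t = 0 \<and> D 0 0 1 t = 0"
    using AE_space
  proof eventually_elim
    case (elim t)
    then have t: "t \<in> {0..T}" by simp
    have "(\<lambda>x. u x t) \<in> H1_0" using elim(1) by (simp add: H_space_def slice_def)
    from H1_0_boundary_values[OF u_x[OF _ t] D_cont_x[OF t] this]
    show ?case using t by (simp add: D_0)
  qed
  have "D 0 0 0 t = 0"
    using * by (intro AE_continuous_eq_0[OF T_pos D_cont_t _ assms]) auto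
  moreover have "D 0 0 1 t = 0"
    using * by (intro AE_continuous_eq_0[OF T_pos D_cont_t _ assms]) auto
  ultimately show "u 0 t = 0" "u 1 t = 0" using assms by (simp_all add: D_0)
qed

lemma boundary_velocity:
  assumes "t \<in> {0..T}"
  shows "D 0 1 0 t = 0" "D 0 1 1 t = 0"
proof -
  have "D 0 1 x t = 0" if "x \<in> {0..1}" "\<And>s. s \<in> {0..T} \<Longrightarrow> u x s = 0" for x
  proof -
    have 1: "((\<lambda>s. 0) has_vector_derivative D 0 1 x t) (at t within {0..T})"
      unfolding has_real_derivative_iff_has_vector_derivative[symmetric]
      by (rule has_real_derivative_transform[OF assms _ u_t[OF that(1) assms]]) (use that(2) in simp)
    show ?thesis
      using vector_derivative_within_closed_interval[OF T_pos assms 1]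
        vector_derivative_within_closed_interval[OF T_pos assms has_vector_derivative_const[of "0 :: real"]] by simp
  qed
  then show "D 0 1 0 t = 0" "D 0 1 1 t = 0" using boundary_values by auto
qed

text \<open>\<epsilon> is the amplitude available to perturbations of either sign near (x0,t0). The
  closed rectangle is covered because the boundary condition uses x0 = 0 and x0 = 1, and the final
  time uses t0 = T.\<close>

lemma local_gap:
  assumes "x0 \<in> {0..1}" "t0 \<in> {0..T}" "\<psi> x0 < u x0 t0"
  obtains \<eta> \<epsilon> where "\<eta> > 0" "\<epsilon> > 0"
    "\<And>x t. x \<in> {0..1} \<Longrightarrow> t \<in> {0..T} \<Longrightarrow> \<bar>x - x0\<bar> < \<eta> \<Longrightarrow> \<bar>t - t0\<bar> < \<eta> \<Longrightarrow> \<psi> x + \<epsilon> \<le> u x t"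
proof -
  define g where "g = u x0 t0 - \<psi> x0"
  have "g > 0" using assms by (simp add: g_def)
  then have "g / 2 > 0" by simp
  moreover have "(x0, t0) \<in> {0..1} \<times> {0..T}" using assms by simp
  ultimately obtain d where d: "d > 0" "\<And>z. z \<in> {0..1} \<times> {0..T} \<Longrightarrow> dist z (x0, t0) < d \<Longrightarrow>
      dist ((\<lambda>(x, t). u x t - \<psi> x) z) ((\<lambda>(x, t). u x t - \<psi> x) (x0, t0)) < g / 2"
    using obstacle_cont unfolding continuous_on_iff by blast
  show ?thesis
  proof (rule that[of "d / 2" "g / 2"])
    fix x t assume *: "x \<in> {0..1}" "t \<in> {0..T}" "\<bar>x - x0\<bar> < d / 2" "\<bar>t - t0\<bar> < d / 2"
    have "dist (x, t) (x0, t0) \<le> \<bar>x - x0\<bar> + \<bar>t - t0\<bar>"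
      unfolding dist_Pair_Pair by (simp add: dist_real_def sqrt_sum_squares_le_sum_abs)
    then have "\<bar>(u x t - \<psi> x) - g\<bar> < g / 2"
      using d(2)[of "(x, t)"] * by (simp add: dist_real_def g_def)
    then show "\<psi> x + g / 2 \<le> u x t" by linarith
  qed (use d(1) \<open>g > 0\<close> in auto)
qed

text \<open>The spatial integral of the variational inequality at time t in direction \<phi>, after
  integration by parts in x; the boundary terms keep the slopes of \<phi>.\<close>

definition variation :: "(real \<Rightarrow> real) \<Rightarrow> real \<Rightarrow> real" where
  "variation \<phi> t = (\<integral>x. residual lam x t * \<phi> x \<partial>leb_I) + Pt 1 t * deriv \<phi> 1 - Pt 0 t * deriv \<phi> 0"

lemma variation_cont:
  assumes "smooth \<phi>"
  shows "continuous_on {0..T} (variation \<phi>)"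
proof -
  have "continuous_on ({0..1} \<times> {0..T}) (\<lambda>z. \<phi> (fst z))"
    by (rule continuous_on_compose2[OF smooth_continuous_on[OF assms, of "{0..1}"]]) (auto intro!: continuous_intros)
  then have "continuous_on ({0..1} \<times> {0..T}) (\<lambda>(x, t). residual lam x t * \<phi> x)"
    using residual_cont[of lam] by (simp add: split_beta continuous_on_mult)
  then show ?thesis
    unfolding variation_def[abs_def]
    by (intro continuous_intros continuous_integral_param continuous_on_section(2)[OF rect_cont(1)]) auto
qed

text \<open>The weak time derivative enters only through its pairing with \<phi> / L, which is
  assumed equal to the classical one; the remaining terms are \<open>first_variation\<close> with w
  = \<phi>.\<close>

lemma vi_integral_slice:
  assumes \<phi>: "smooth \<phi>" "\<phi> 0 = 0" "\<phi> 1 = 0" and W: "W \<in> L2" and t: "t \<in> {0..T}"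
    and pairing: "(\<integral>x. W x * (\<phi> x / L x t) \<partial>leb_I) = (\<integral>x. D 0 1 x t * (\<phi> x / L x t) \<partial>leb_I)"
  shows "(\<integral>x. vi_integrand lam (slice u t) W (slice (\<lambda>x t. u x t + \<theta> t * \<phi> x) t) x \<partial>leb_I) = \<theta> t * variation \<phi> t"
proof -
  note c = continuous_on_section(1)[OF rect_cont(1) t] continuous_on_section(1)[OF rect_cont(2) t]
    continuous_on_section(1)[OF rect_cont(4) t] continuous_on_section(1)[OF L_cont t] D_cont_x[OF t]
    smooth_continuous_on[OF \<phi>(1)] smooth_continuous_on[OF smooth_deriv[OF \<phi>(1)]]
    smooth_continuous_on[OF smooth_deriv[OF smooth_deriv[OF \<phi>(1)]]]
  have nz: "L x t \<noteq> 0" for x using L_pos[OF t, of x] by simp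
  have c1: "continuous_on {0..1} (\<lambda>x. R1t x t)"
    using t by (simp add: R1t_eq) (intro continuous_intros c ballI, simp add: nz)
  define B where "B x = Pt x t * deriv (deriv \<phi>) x - Qt x t * deriv \<phi> x - lam * (R1t x t * \<phi> x)" for x
  have cB: "continuous_on {0..1} B" unfolding B_def[abs_def] by (intro continuous_intros c c1)
  have cL: "continuous_on {0..1} (\<lambda>x. \<phi> x / L x t)" by (intro continuous_intros c) (simp add: nz)
  have sm: "smooth (\<lambda>x. \<theta> t * \<phi> x)" by (intro smooth_mult \<phi> smooth_const)
  have d1: "deriv (\<lambda>x. \<theta> t * \<phi> x) = (\<lambda>x. \<theta> t * deriv \<phi> x)"
    by (intro ext DERIV_imp_deriv DERIV_cmult smooth_has_deriv \<phi>)
  have d2: "deriv (\<lambda>x. \<theta> t * deriv \<phi> x) = (\<lambda>x. \<theta> t * deriv (deriv \<phi>) x)"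
    by (intro ext DERIV_imp_deriv DERIV_cmult smooth_has_deriv smooth_deriv \<phi>)
  have diff: "(\<lambda>y. slice (\<lambda>x t. u x t + \<theta> t * \<phi> x) t y - slice u t y) = (\<lambda>x. \<theta> t * \<phi> x)"
    by (simp add: slice_def fun_eq_iff)
  have "(\<integral>x. vi_integrand lam (slice u t) W (slice (\<lambda>x t. u x t + \<theta> t * \<phi> x) t) x \<partial>leb_I)
      = (\<integral>x. \<theta> t * (W x * (\<phi> x / L x t) + B x) \<partial>leb_I)"
  proof (rule integral_cong_AE_eq)
    show "AE x in leb_I. vi_integrand lam (slice u t) W (slice (\<lambda>x t. u x t + \<theta> t * \<phi> x) t) x
        = \<theta> t * (W x * (\<phi> x / L x t) + B x)"
      using weak_deriv_slice[OF t] smooth_weak_deriv(2,3)[OF sm]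
    proof eventually_elim
      case (elim x)
      show ?case
        unfolding vi_integrand_def Let_def diff elim d1 d2 L_eq[OF t, symmetric]
        using t by (simp add: B_def Pt_eq Qt_eq R1t_eq algebra_simps)
    qed
  qed
  also have "\<dots> = \<theta> t * ((\<integral>x. W x * (\<phi> x / L x t) \<partial>leb_I) + (\<integral>x. B x \<partial>leb_I))"
    using L2_mult_integrable[OF W continuous_L2[OF cL]] continuous_integrable_Ioo[OF cB] by simp
  also have "(\<integral>x. B x \<partial>leb_I) = (\<integral>x. gradt lam x t * \<phi> x \<partial>leb_I) + Pt 1 t * deriv \<phi> 1 - Pt 0 t * deriv \<phi> 0"
    unfolding B_def Pt_def Qt_def R1t_def gradt_def
    by (rule graph_jet.first_variation(2)[OF jet[OF t]])
       (auto intro!: has_field_derivative_at_within smooth_has_deriv smooth_deriv \<phi> c)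
  also have "(\<integral>x. W x * (\<phi> x / L x t) \<partial>leb_I) + ((\<integral>x. gradt lam x t * \<phi> x \<partial>leb_I) + Pt 1 t * deriv \<phi> 1 - Pt 0 t * deriv \<phi> 0)
      = variation \<phi> t"
  proof -
    have "(\<integral>x. residual lam x t * \<phi> x \<partial>leb_I) = (\<integral>x. D 0 1 x t * (\<phi> x / L x t) + gradt lam x t * \<phi> x \<partial>leb_I)"
      by (simp add: residual_def algebra_simps)
    also have "\<dots> = (\<integral>x. D 0 1 x t * (\<phi> x / L x t) \<partial>leb_I) + (\<integral>x. gradt lam x t * \<phi> x \<partial>leb_I)"
      by (intro Bochner_Integration.integral_add continuous_integrable_Ioo continuous_on_mult cL c)
    finally show ?thesis using pairing by (simp add: variation_def)
  qed
  finally show ?thesis .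
qed

text \<open>The integrand is linear in v - u, so v = u + \<theta> \<phi> pulls \<theta>(t) out of
  the spatial integral exactly, without a limit in a small parameter.\<close>

lemma variational_inequality:
  assumes "smooth \<theta>" "smooth \<phi>" "\<phi> 0 = 0" "\<phi> 1 = 0"
    and above: "\<And>x t. x \<in> {0<..<1} \<Longrightarrow> t \<in> {0<..<T} \<Longrightarrow> \<psi> x \<le> u x t + \<theta> t * \<phi> x"
  shows "0 \<le> (\<integral>t. \<theta> t * variation \<phi> t \<partial>lebesgue_on {0<..<T})"
proof -
  let ?v = "\<lambda>x t. u x t + \<theta> t * \<phi> x"
  define W where "W = weak_time_deriv T (slice u)"
  have "\<exists>W. W \<in> L2_L2 T \<and> has_weak_time_deriv T (slice u) W"
    using u_K_T by (auto simp: K_T_def H1_L2_def)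
  then have W: "W \<in> L2_L2 T" "has_weak_time_deriv T (slice u) W"
    unfolding W_def weak_time_deriv_def by (metis (mono_tags, lifting) someI_ex)+
  have "?v \<in> K_T \<psi> T"
    by (rule K_T_add_scale) (use assms u_K_T T_pos in auto)
  then have "0 \<le> (\<integral>t. (\<integral>x. vi_integrand lam (slice u t) (W t) (slice ?v t) x \<partial>leb_I) \<partial>lebesgue_on {0<..<T})"
    using weak_sol by (simp add: weak_solution_def W_def)
  also have "\<dots> = (\<integral>t. \<theta> t * variation \<phi> t \<partial>lebesgue_on {0<..<T})"
  proof (rule integral_cong_AE_eq)
    have "continuous_on ({0..1} \<times> {0..T}) (\<lambda>(x, t). \<phi> x / L x t)"
    proof -
      have "continuous_on ({0..1} \<times> {0..T}) (\<lambda>z. \<phi> (fst z))"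
        by (rule continuous_on_compose2[OF smooth_continuous_on[OF assms(2), of "{0..1}"]]) (auto intro!: continuous_intros)
      moreover have "L (fst z) (snd z) \<noteq> 0" if "z \<in> {0..1} \<times> {0..T}" for z
        using L_pos[of "snd z" "fst z"] that by auto
      ultimately show ?thesis
        using L_cont by (simp add: split_beta continuous_on_divide)
    qed
    from weak_time_deriv_pairing[OF W this] L2_L2_AE[OF W(1)] AE_space
    show "AE t in lebesgue_on {0<..<T}. (\<integral>x. vi_integrand lam (slice u t) (W t) (slice ?v t) x \<partial>leb_I)
        = \<theta> t * variation \<phi> t"
    proof eventually_elim
      case (elim t)
      then show ?case by (intro vi_integral_slice assms) auto
    qed
  qed
  finally show ?thesis .
qed

text \<open>Near t0 and where \<phi> is nonzero there is room \<epsilon> above the obstacle, so a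
  small multiple of a narrow time bump times \<phi> is admissible with either sign. The two
  inequalities force the integral against the bump to vanish.\<close>

lemma variation_eq_0:
  assumes \<phi>: "smooth \<phi>" "\<phi> 0 = 0" "\<phi> 1 = 0" and "t0 \<in> {0<..<T}" "\<eta> > 0" "\<epsilon> > 0"
    and gap: "\<And>x t. x \<in> {0<..<1} \<Longrightarrow> t \<in> {0<..<T} \<Longrightarrow> \<bar>t - t0\<bar> < \<eta> \<Longrightarrow> \<phi> x \<noteq> 0 \<Longrightarrow> \<psi> x + \<epsilon> \<le> u x t"
  shows "variation \<phi> t0 = 0"
proof (rule bump_integral_localize[OF variation_cont[OF \<phi>(1)] assms(4,5)])
  fix \<delta> :: real assume \<delta>: "0 < \<delta>" "\<delta> < \<eta>"
  let ?\<beta> = "bump (t0 - \<delta>) (t0 + \<delta>)"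
  obtain M where M: "M > 0" "\<And>x. x \<in> {0..1} \<Longrightarrow> \<bar>\<phi> x\<bar> \<le> M"
    using continuous_bound_Icc[OF smooth_continuous_on[OF \<phi>(1)]] by metis
  obtain N where N: "N > 0" "\<And>t. t \<in> {0..T} \<Longrightarrow> \<bar>?\<beta> t\<bar> \<le> N"
    using continuous_bound_Icc[OF smooth_continuous_on[OF smooth_bump]] by metis
  \<comment> \<open>With |\<phi>| \<le> M and the time bump bounded by N, this amplitude keeps the
    perturbation within the gap \<epsilon>.\<close>
  define k where "k = \<epsilon> / (M * N)"
  have k: "k > 0" using M N assms(6) by (simp add: k_def)
  have ineq: "0 \<le> c * (\<integral>t. ?\<beta> t * variation \<phi> t \<partial>lebesgue_on {0<..<T})" if c: "\<bar>c\<bar> = k" for c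
  proof -
    have "0 \<le> (\<integral>t. (c * ?\<beta> t) * variation \<phi> t \<partial>lebesgue_on {0<..<T})"
    proof (rule variational_inequality)
      fix x t assume x: "x \<in> {0<..<1::real}" and t: "t \<in> {0<..<T}"
      show "\<psi> x \<le> u x t + c * ?\<beta> t * \<phi> x"
      proof (cases "?\<beta> t = 0 \<or> \<phi> x = 0")
        case True
        then show ?thesis using above_obstacle[of x t] x t by auto
      next
        case False
        then have "\<bar>t - t0\<bar> < \<eta>" using \<delta> bump_eq_0[of t "t0 - \<delta>" "t0 + \<delta>"] by fastforce
        then have "\<psi> x + \<epsilon> \<le> u x t" using gap[OF x t] False by simp
        moreover have "\<bar>c * ?\<beta> t * \<phi> x\<bar> \<le> \<epsilon>"
        proof -
          have "\<bar>c * ?\<beta> t * \<phi> x\<bar> = k * (\<bar>?\<beta> t\<bar> * \<bar>\<phi> x\<bar>)"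
            by (simp add: abs_mult c)
          also have "\<dots> \<le> k * (N * M)"
            using M N x t k by (intro mult_left_mono mult_mono) auto
          also have "\<dots> = \<epsilon>" using M N by (simp add: k_def)
          finally show ?thesis .
        qed
        ultimately show ?thesis by linarith
      qed
    qed (auto intro!: smooth_mult smooth_bump \<phi>)
    then show ?thesis by (simp add: mult.assoc)
  qed
  show "(\<integral>t. ?\<beta> t * variation \<phi> t \<partial>lebesgue_on {0<..<T}) = 0"
    using ineq[of k] ineq[of "- k"] k by (auto simp: zero_le_mult_iff mult_le_0_iff)
qed

lemma residual_eq_0_interior:
  assumes "x0 \<in> {0<..<1}" "t0 \<in> {0<..<T}" "\<psi> x0 < u x0 t0"
  shows "residual lam x0 t0 = 0"
proof -
  obtain \<eta> \<epsilon> where \<eta>: "\<eta> > 0" "\<epsilon> > 0"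
    "\<And>x t. x \<in> {0..1} \<Longrightarrow> t \<in> {0..T} \<Longrightarrow> \<bar>x - x0\<bar> < \<eta> \<Longrightarrow> \<bar>t - t0\<bar> < \<eta> \<Longrightarrow> \<psi> x + \<epsilon> \<le> u x t"
    using local_gap[of x0 t0] assms by auto
  \<comment> \<open>The distances to both endpoints enter so that the spatial bump vanishes at 0 and
    1.\<close>
  define \<eta>' where "\<eta>' = min \<eta> (min x0 (1 - x0))"
  have t0: "t0 \<in> {0..T}" using assms by simp
  show ?thesis
  proof (rule bump_integral_localize[where h="\<lambda>x. residual lam x t0" and \<eta>=\<eta>', OF _ assms(1)])
    show "\<eta>' > 0" using \<eta> assms by (simp add: \<eta>'_def)
    show "continuous_on {0..1} (\<lambda>x. residual lam x t0)"
      by (rule continuous_on_section(1)[OF residual_cont t0])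
    fix \<delta> :: real assume \<delta>: "0 < \<delta>" "\<delta> < \<eta>'"
    let ?\<phi> = "bump (x0 - \<delta>) (x0 + \<delta>)"
    have zero: "?\<phi> 0 = 0" "?\<phi> 1 = 0" using \<delta> by (auto simp: \<eta>'_def intro!: bump_eq_0)
    have "variation ?\<phi> t0 = 0"
    proof (rule variation_eq_0[OF smooth_bump zero assms(2) \<eta>(1,2)])
      fix x t assume *: "x \<in> {0<..<1::real}" "t \<in> {0<..<T}" "\<bar>t - t0\<bar> < \<eta>" "?\<phi> x \<noteq> 0"
      then have "\<bar>x - x0\<bar> < \<delta>" using bump_eq_0[of x "x0 - \<delta>" "x0 + \<delta>"] by fastforce
      then show "\<psi> x + \<epsilon> \<le> u x t" using * \<delta> by (intro \<eta>(3)) (auto simp: \<eta>'_def)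
    qed
    \<comment> \<open>The bump is nonnegative, so each of its zeros is a minimum and its slope
      vanishes there; this removes the boundary terms of \<open>variation\<close>.\<close>
    moreover have "deriv ?\<phi> y = 0" if "?\<phi> y = 0" for y
      by (rule DERIV_local_min[OF smooth_has_deriv[OF smooth_bump], of 1]) (use bump_nonneg that in auto)
    ultimately show "(\<integral>x. ?\<phi> x * residual lam x t0 \<partial>leb_I) = 0"
      using zero by (simp add: variation_def mult.commute)
  qed
qed

lemma residual_eq_0:
  assumes "x \<in> {0<..<1}" "t \<in> {0<..T}" "\<psi> x < u x t"
  shows "residual lam x t = 0"
proof (cases "t = T")
  case True
  have x: "x \<in> {0..1}" and T: "T \<in> {0..T}" using assms(1) T_pos by auto
  obtain \<eta> \<epsilon> where \<eta>: "\<eta> > 0" "\<epsilon> > 0"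
    "\<And>x' t. x' \<in> {0..1} \<Longrightarrow> t \<in> {0..T} \<Longrightarrow> \<bar>x' - x\<bar> < \<eta> \<Longrightarrow> \<bar>t - T\<bar> < \<eta> \<Longrightarrow> \<psi> x' + \<epsilon> \<le> u x' t"
    using local_gap[OF x T] assms(3) True by auto
  \<comment> \<open>All times in (a,T) are positive and within \<eta> of T, so the gap persists
    there and the interior result applies.\<close>
  define a where "a = max 0 (T - \<eta>)"
  have a: "0 \<le> a" "a < T" using T_pos \<eta>(1) by (auto simp: a_def)
  have "residual lam x T = 0"
  proof (rule AE_continuous_eq_0[where h="\<lambda>t. residual lam x t", OF a(2)])
    show "continuous_on {a..T} (\<lambda>t. residual lam x t)"
      by (rule continuous_on_subset[OF continuous_on_section(2)[OF residual_cont x]]) (use a in auto)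
    show "AE s in lebesgue_on {a<..<T}. residual lam x s = 0"
    proof (rule AE_I2)
      fix s assume "s \<in> space (lebesgue_on {a<..<T})"
      then have s: "s \<in> {0<..<T}" "\<bar>s - T\<bar> < \<eta>" using a by (auto simp: a_def)
      have "\<psi> x + \<epsilon> \<le> u x s" by (rule \<eta>(3)[OF x]) (use s \<eta>(1) in auto)
      then show "residual lam x s = 0"
        using \<eta>(2) by (intro residual_eq_0_interior assms(1) s) auto
    qed
  qed (use a in auto)
  then show ?thesis using True by simp
next
  case False
  then show ?thesis using assms by (intro residual_eq_0_interior) auto
qed

text \<open>\<open>Pt\<close> is the bending moment 2 u'' / |\<gamma>'|^5, conjugate to the slope. A
  direction with nonzero slope at exactly one endpoint isolates the moment there; the gap near that
  endpoint comes from u = 0 > \<psi>.\<close>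

lemma boundary_moment_eq_0:
  assumes "t \<in> {0<..T}"
  shows "Pt 0 t = 0" "Pt 1 t = 0"
proof -
  have base: "- Pt 0 t0 * deriv \<phi> 0 + Pt 1 t0 * deriv \<phi> 1 = 0"
    if t0: "t0 \<in> {0<..<T}" and \<phi>: "smooth \<phi>" "\<phi> 0 = 0" "\<phi> 1 = 0" and "\<eta> > 0" "\<epsilon> > 0"
      and gap: "\<And>x t. x \<in> {0<..<1} \<Longrightarrow> t \<in> {0<..<T} \<Longrightarrow> \<bar>t - t0\<bar> < \<eta> \<Longrightarrow> \<phi> x \<noteq> 0 \<Longrightarrow> \<psi> x + \<epsilon> \<le> u x t"
    for t0 \<phi> \<eta> \<epsilon>
  proof -
    \<comment> \<open>The bulk term drops out, because the pointwise equation already holds wherever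
      \<phi> is nonzero.\<close>
    have "residual lam x t0 * \<phi> x = 0" if "x \<in> {0<..<1}" for x
    proof (cases "\<phi> x = 0")
      case False
      then have "\<psi> x < u x t0" using gap[OF that t0] \<open>\<eta> > 0\<close> \<open>\<epsilon> > 0\<close> by simp
      then show ?thesis using residual_eq_0_interior[OF that t0] by simp
    qed simp
    then have "(\<integral>x. residual lam x t0 * \<phi> x \<partial>leb_I) = (\<integral>x. 0 \<partial>leb_I)"
      by (intro Bochner_Integration.integral_cong) auto
    then show ?thesis
      using variation_eq_0[OF \<phi> t0 \<open>\<eta> > 0\<close> \<open>\<epsilon> > 0\<close> gap] by (simp add: variation_def)
  qed
  have left: "Pt 0 t0 = 0" if t0: "t0 \<in> {0<..<T}" for t0
  proof -
    obtain \<eta> \<epsilon> where \<eta>: "\<eta> > 0" "\<epsilon> > 0"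
      "\<And>x t. x \<in> {0..1} \<Longrightarrow> t \<in> {0..T} \<Longrightarrow> \<bar>x - 0\<bar> < \<eta> \<Longrightarrow> \<bar>t - t0\<bar> < \<eta> \<Longrightarrow> \<psi> x + \<epsilon> \<le> u x t"
      using local_gap[of 0 t0] t0 psi_0 boundary_values[of t0] by auto
    define \<rho> where "\<rho> = min \<eta> (1 / 2)"
    have \<rho>: "0 < \<rho>" "\<rho> < 1" "\<rho> \<le> \<eta>" using \<eta> by (auto simp: \<rho>_def)
    \<comment> \<open>Vanishes at 0 with slope \<open>exp_tail 0 \<rho>\<close> > 0 and is
      identically 0 for x \<ge> \<rho>; since \<rho> \<le> 1/2, neither value nor slope is left at
      the other endpoint.\<close>
    define \<phi> where "\<phi> x = x * exp_tail 0 (\<rho> - x)" for x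
    have tail: "smooth (\<lambda>x. exp_tail 0 (\<rho> - x))"
      using smooth_affine[OF smooth_exp_tail[of 0], of "- 1" \<rho>] by simp
    have \<phi>: "smooth \<phi>" "\<phi> 0 = 0" "\<phi> 1 = 0"
      unfolding \<phi>_def[abs_def] using \<rho> tail by (auto intro!: smooth_mult simp: exp_tail_eq_0)
    have d: "deriv \<phi> x = exp_tail 0 (\<rho> - x) + x * deriv (\<lambda>x. exp_tail 0 (\<rho> - x)) x" for x
      using deriv_smooth_mult[OF smooth_id tail, of x] by (simp add: \<phi>_def[abs_def] mult.commute)
    have "deriv (\<lambda>x. exp_tail 0 (\<rho> - x)) 1 = 0"
      by (rule DERIV_local_min[OF smooth_has_deriv[OF tail], of 1]) (use \<rho> exp_tail_nonneg in \<open>auto simp: exp_tail_eq_0\<close>)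
    then have "deriv \<phi> 0 = exp_tail 0 \<rho>" "deriv \<phi> 1 = 0"
      using \<rho> by (auto simp: d exp_tail_eq_0)
    moreover have "- Pt 0 t0 * deriv \<phi> 0 + Pt 1 t0 * deriv \<phi> 1 = 0"
    proof (rule base[OF t0 \<phi> \<eta>(1,2)])
      fix x t assume *: "x \<in> {0<..<1::real}" "t \<in> {0<..<T}" "\<bar>t - t0\<bar> < \<eta>" "\<phi> x \<noteq> 0"
      then have "x < \<rho>" using exp_tail_eq_0[of "\<rho> - x" 0] by (force simp: \<phi>_def)
      then show "\<psi> x + \<epsilon> \<le> u x t" using * \<rho> by (intro \<eta>(3)) auto
    qed
    ultimately show ?thesis using exp_tail_pos[OF \<rho>(1), of 0] by auto
  qed
  have right: "Pt 1 t0 = 0" if t0: "t0 \<in> {0<..<T}" for t0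
  proof -
    obtain \<eta> \<epsilon> where \<eta>: "\<eta> > 0" "\<epsilon> > 0"
      "\<And>x t. x \<in> {0..1} \<Longrightarrow> t \<in> {0..T} \<Longrightarrow> \<bar>x - 1\<bar> < \<eta> \<Longrightarrow> \<bar>t - t0\<bar> < \<eta> \<Longrightarrow> \<psi> x + \<epsilon> \<le> u x t"
      using local_gap[of 1 t0] t0 psi_1 boundary_values[of t0] by auto
    define \<rho> where "\<rho> = min \<eta> (1 / 2)"
    have \<rho>: "0 < \<rho>" "\<rho> < 1" "\<rho> \<le> \<eta>" using \<eta> by (auto simp: \<rho>_def)
    \<comment> \<open>Reflection of the direction used on the left; its slope at 1 is
      \<open>- exp_tail 0 \<rho>\<close>.\<close>
    define \<phi> where "\<phi> x = (1 - x) * exp_tail 0 (x + (\<rho> - 1))" for x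
    have tail: "smooth (\<lambda>x. exp_tail 0 (x + (\<rho> - 1)))"
      using smooth_affine[OF smooth_exp_tail[of 0], of 1 "\<rho> - 1"] by simp
    have lin: "smooth (\<lambda>x. 1 - x)" by (intro smooth_diff) auto
    have dlin: "deriv (\<lambda>x::real. 1 - x) x = - 1" for x
      by (rule DERIV_imp_deriv) (auto intro!: derivative_eq_intros)
    have \<phi>: "smooth \<phi>" "\<phi> 0 = 0" "\<phi> 1 = 0"
      unfolding \<phi>_def[abs_def] using \<rho> tail lin by (auto intro!: smooth_mult simp: exp_tail_eq_0)
    have d: "deriv \<phi> x = - exp_tail 0 (x + (\<rho> - 1)) + (1 - x) * deriv (\<lambda>x. exp_tail 0 (x + (\<rho> - 1))) x" for x
      using deriv_smooth_mult[OF lin tail, of x] by (simp add: \<phi>_def[abs_def] dlin mult.commute)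
    have "deriv (\<lambda>x. exp_tail 0 (x + (\<rho> - 1))) 0 = 0"
      by (rule DERIV_local_min[OF smooth_has_deriv[OF tail], of 1]) (use \<rho> exp_tail_nonneg in \<open>auto simp: exp_tail_eq_0\<close>)
    then have "deriv \<phi> 1 = - exp_tail 0 \<rho>" "deriv \<phi> 0 = 0"
      using \<rho> by (auto simp: d exp_tail_eq_0)
    moreover have "- Pt 0 t0 * deriv \<phi> 0 + Pt 1 t0 * deriv \<phi> 1 = 0"
    proof (rule base[OF t0 \<phi> \<eta>(1,2)])
      fix x t assume *: "x \<in> {0<..<1::real}" "t \<in> {0<..<T}" "\<bar>t - t0\<bar> < \<eta>" "\<phi> x \<noteq> 0"
      then have "1 - \<rho> < x" using exp_tail_eq_0[of "x + (\<rho> - 1)" 0] by (force simp: \<phi>_def)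
      then show "\<psi> x + \<epsilon> \<le> u x t" using * \<rho> by (intro \<eta>(3)) auto
    qed
    ultimately show ?thesis using exp_tail_pos[OF \<rho>(1), of 0] by auto
  qed
  have t: "t \<in> {0..T}" using assms by simp
  show "Pt 0 t = 0"
    by (rule AE_continuous_eq_0[OF T_pos continuous_on_section(2)[OF rect_cont(1)] _ t])
       (auto intro!: AE_I2 left)
  show "Pt 1 t = 0"
    by (rule AE_continuous_eq_0[OF T_pos continuous_on_section(2)[OF rect_cont(1)] _ t])
       (auto intro!: AE_I2 right)
qed

section \<open>The gradient flow\<close>

lemma normal_velocity_graph:
  assumes "x \<in> {0..1}" "t \<in> {0..T}"
  shows "normal_velocity T (graph_curve u) t x
    = (D 0 1 x t / L x t) *\<^sub>R graph_jet.normal (\<lambda>x. D 1 0 x t) x"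
proof -
  have "((\<lambda>s. (x, u x s)) has_vector_derivative (0, D 0 1 x t)) (at t within {0..T})"
    using u_t[OF assms] by (intro has_vector_derivative_Pair)
      (auto simp: has_real_derivative_iff_has_vector_derivative)
  then have "vector_derivative (\<lambda>s. (x, u x s)) (at t within {0..T}) = (0, D 0 1 x t)"
    by (rule vector_derivative_within_closed_interval[rotated 2]) (use assms T_pos in auto)
  then show ?thesis
    using graph_jet.normal_part_vertical[OF jet[OF assms(2)] assms(1)]
    by (simp add: normal_velocity_def graph_curve_def L_def)
qed

lemma grad_energy_graph_curve:
  assumes "x \<in> {0..1}" "t \<in> {0..T}"
  shows "grad_energy lam (graph_curve u t) x = gradt lam x t *\<^sub>R graph_jet.normal (\<lambda>x. D 1 0 x t) x"
  using graph_jet.grad_energy_graph[OF jet[OF assms(2)] assms(1), of lam]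
  by (simp add: graph_curve_def gradt_def)

text \<open>Velocity and gradient are multiples of the unit normal whose coefficients sum to
  \<open>residual\<close>, so the integrands agree pointwise: either \<eta> vanishes or x lies in
  the noncoincidence set.\<close>

lemma gradient_flow:
  assumes t: "t \<in> {0<..T}" and \<eta>: "\<eta> \<in> test_fun2 (noncoincidence_set \<psi> u t)"
  shows "integral_ds (graph_curve u t) (\<lambda>x. normal_velocity T (graph_curve u) t x \<bullet> \<eta> x)
    = - integral_ds (graph_curve u t) (\<lambda>x. grad_energy lam (graph_curve u t) x \<bullet> \<eta> x)"
proof -
  have "normal_velocity T (graph_curve u) t x \<bullet> \<eta> x = - (grad_energy lam (graph_curve u t) x \<bullet> \<eta> x)"
    if x: "x \<in> {0<..<1}" for x
  proof (cases "\<eta> x = 0")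
    case False
    have "x \<in> noncoincidence_set \<psi> u t"
    proof (rule ccontr)
      assume "x \<notin> noncoincidence_set \<psi> u t"
      then have "fst (\<eta> x) = 0" "snd (\<eta> x) = 0"
        using \<eta> by (auto simp: test_fun2_def test_fun_def)
      then show False using False by (simp add: prod_eq_iff)
    qed
    then have "residual lam x t = 0"
      using x t by (intro residual_eq_0) (auto simp: noncoincidence_set_def)
    then have "D 0 1 x t / L x t = - gradt lam x t" by (simp add: residual_def)
    then show ?thesis
      using x t by (simp add: normal_velocity_graph grad_energy_graph_curve)
  qed simp
  then have "integral_ds (graph_curve u t) (\<lambda>x. normal_velocity T (graph_curve u) t x \<bullet> \<eta> x)
      = integral_ds (graph_curve u t) (\<lambda>x. - (grad_energy lam (graph_curve u t) x \<bullet> \<eta> x))"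
    unfolding integral_ds_def by (intro Bochner_Integration.integral_cong) auto
  then show ?thesis by (simp add: integral_ds_def)
qed

lemma boundary_curvature:
  assumes "t \<in> {0<..T}"
  shows "curvature (graph_curve u t) 0 = 0" "curvature (graph_curve u t) 1 = 0"
proof -
  have t: "t \<in> {0..T}" using assms by simp
  have "D 2 0 0 t = 0" "D 2 0 1 t = 0"
    using boundary_moment_eq_0[OF assms] L_pos[OF t, of 0] L_pos[OF t, of 1] by (auto simp: Pt_eq[OF t])
  then show "curvature (graph_curve u t) 0 = 0" "curvature (graph_curve u t) 1 = 0"
    using graph_jet.curvature_graph[OF jet[OF t]] graph_jet.curv_def[OF jet[OF t]]
    by (simp_all add: graph_curve_def)
qed

lemma coincidence_velocity:
  assumes "x \<in> {0..1}" "t \<in> {0<..<T}" "u x t = \<psi> x"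
  shows "D 0 1 x t = 0"
proof (rule DERIV_local_min)
  show "((\<lambda>s. u x s) has_real_derivative D 0 1 x t) (at t)"
    using u_t[of x t] assms at_within_interior[of t "{0..T}"] by simp
  show "0 < min t (T - t)" using assms by simp
  show "\<forall>s. \<bar>t - s\<bar> < min t (T - t) \<longrightarrow> u x t \<le> u x s"
  proof (intro allI impI)
    fix s assume "\<bar>t - s\<bar> < min t (T - t)"
    then have "s \<in> {0..T}" by auto
    then show "u x t \<le> u x s" using above_obstacle[OF assms(1)] assms(3) by simp
  qed
qed

text \<open>At \<open>t = T\<close> a point of the coincidence set only satisfies \<open>\<partial>\<^sub>t u \<le> 0\<close>, so the dissipation
  identity is obtained there by continuity in time.\<close>

lemma dissipation:
  assumes "t \<in> {0<..T}"
  shows "(\<integral>x. gradt lam x t * D 0 1 x t \<partial>leb_I) = - (\<integral>x. (D 0 1 x t)\<^sup>2 / L x t \<partial>leb_I)"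
proof -
  define h where "h t = (\<integral>x. residual lam x t * D 0 1 x t \<partial>leb_I)" for t
  have cont: "continuous_on ({0..1} \<times> {0..T}) (\<lambda>(x, t). residual lam x t * D 0 1 x t)"
    using residual_cont[of lam] D_cont[of 0 1] by (simp add: split_beta continuous_on_mult)
  have t: "t \<in> {0..T}" using assms by simp
  have "h t = 0"
  proof (rule AE_continuous_eq_0[OF T_pos _ _ t])
    show "continuous_on {0..T} h"
      unfolding h_def by (rule continuous_integral_param[OF cont])
    show "AE s in lebesgue_on {0<..<T}. h s = 0"
    proof (rule AE_I2)
      fix s assume "s \<in> space (lebesgue_on {0<..<T})"
      then have s: "s \<in> {0<..<T}" by simp
      have "residual lam x s * D 0 1 x s = 0" if x: "x \<in> {0<..<1}" for x
      proof (cases "\<psi> x < u x s")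
        case True
        then show ?thesis using residual_eq_0_interior[OF x s] by simp
      next
        case False
        then have "u x s = \<psi> x" using above_obstacle[of x s] x s by simp
        then show ?thesis using coincidence_velocity[of x s] x s by simp
      qed
      then have "h s = (\<integral>x. 0 \<partial>leb_I)"
        unfolding h_def by (intro Bochner_Integration.integral_cong) auto
      then show "h s = 0" by simp
    qed
  qed
  moreover have "h t = (\<integral>x. (D 0 1 x t)\<^sup>2 / L x t \<partial>leb_I) + (\<integral>x. gradt lam x t * D 0 1 x t \<partial>leb_I)"
  proof -
    have nz: "L x t \<noteq> 0" for x using L_pos[OF t, of x] by simp
    have "h t = (\<integral>x. (D 0 1 x t)\<^sup>2 / L x t + gradt lam x t * D 0 1 x t \<partial>leb_I)"
      by (simp add: h_def residual_def algebra_simps power2_eq_square)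
    also have "\<dots> = (\<integral>x. (D 0 1 x t)\<^sup>2 / L x t \<partial>leb_I) + (\<integral>x. gradt lam x t * D 0 1 x t \<partial>leb_I)"
      by (intro Bochner_Integration.integral_add continuous_integrable_Ioo continuous_intros D_cont_x[OF t]
          continuous_on_section(1)[OF rect_cont(4) t] continuous_on_section(1)[OF L_cont t] ballI nz)
    finally show ?thesis .
  qed
  ultimately show ?thesis by simp
qed

lemma energy_density_deriv:
  assumes "x \<in> {0..1}" "t \<in> {0..T}"
  shows "((\<lambda>t. (D 2 0 x t)\<^sup>2 / L x t ^ 5 + lam * L x t) has_real_derivative
    Pt x t * D 2 1 x t - Qt x t * D 1 1 x t + lam * (Rt x t * D 1 1 x t)) (at t within {0..T})"
proof -
  have dq: "((\<lambda>t. D 2 0 x t) has_real_derivative D 2 1 x t) (at t within {0..T})"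
    and dp: "((\<lambda>t. D 1 0 x t) has_real_derivative D 1 1 x t) (at t within {0..T})"
    using D_t[OF assms, of 2 0] D_t[OF assms, of 1 0] by simp_all
  have nz: "L x t \<noteq> 0" using L_pos[OF assms(2), of x] by simp
  have pos: "1 + (D 1 0 x t)\<^sup>2 > 0" by (intro add_pos_nonneg) auto
  have "((\<lambda>t. sqrt (1 + (D 1 0 x t)\<^sup>2)) has_real_derivative D 1 0 x t * D 1 1 x t / L x t) (at t within {0..T})"
  proof -
    have "((\<lambda>t. 1 + (D 1 0 x t)\<^sup>2) has_real_derivative 2 * D 1 0 x t * D 1 1 x t) (at t within {0..T})"
      using DERIV_add[OF DERIV_const[of 1] DERIV_power[OF dp, of 2]] by (simp add: mult_ac)
    from DERIV_chain2[OF DERIV_real_sqrt[OF pos] this] show ?thesis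
      by (rule DERIV_cong) (simp add: L_eq[OF assms(2)] field_simps)
  qed
  then have dL: "((\<lambda>t. L x t) has_real_derivative D 1 0 x t * D 1 1 x t / L x t) (at t within {0..T})"
    by (rule has_real_derivative_transform[OF assms(2), rotated]) (simp add: L_eq)
  have alg: "(real 2 * (b * a ^ (2 - Suc 0)) * l ^ 5 - a\<^sup>2 * (real 5 * (c * d / l * l ^ (5 - Suc 0)))) / (l ^ 5 * l ^ 5)
      + lam * (c * d / l) = 2 * a / l ^ 5 * b - 5 * a\<^sup>2 * c / l ^ 7 * d + lam * (c / l * d)"
    if "l \<noteq> 0" for a b c d l :: real
    using that by (simp add: field_simps eval_nat_numeral)
  show ?thesis
  proof (rule DERIV_cong)
    show "((\<lambda>t. (D 2 0 x t)\<^sup>2 / L x t ^ 5 + lam * L x t) has_real_derivative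
      (real 2 * (D 2 1 x t * D 2 0 x t ^ (2 - Suc 0)) * L x t ^ 5
        - (D 2 0 x t)\<^sup>2 * (real 5 * (D 1 0 x t * D 1 1 x t / L x t * L x t ^ (5 - Suc 0))))
        / (L x t ^ 5 * L x t ^ 5) + lam * (D 1 0 x t * D 1 1 x t / L x t)) (at t within {0..T})"
      by (rule DERIV_add[OF DERIV_divide[OF DERIV_power[OF dq] DERIV_power[OF dL]] DERIV_cmult[OF dL]]) (simp add: nz)
    show "(real 2 * (D 2 1 x t * D 2 0 x t ^ (2 - Suc 0)) * L x t ^ 5
        - (D 2 0 x t)\<^sup>2 * (real 5 * (D 1 0 x t * D 1 1 x t / L x t * L x t ^ (5 - Suc 0))))
        / (L x t ^ 5 * L x t ^ 5) + lam * (D 1 0 x t * D 1 1 x t / L x t)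
      = Pt x t * D 2 1 x t - Qt x t * D 1 1 x t + lam * (Rt x t * D 1 1 x t)"
      unfolding Pt_eq[OF assms(2)] Qt_eq[OF assms(2)] Rt_eq[OF assms(2)] by (rule alg[OF nz])
  qed
qed

text \<open>The first variation in the direction of the velocity \<open>D 0 1\<close>, which
  vanishes at the endpoints since the boundary values are constant in time. Its slopes there are
  multiplied by vanishing moments, and \<open>dissipation\<close> evaluates the remaining
  integral.\<close>

lemma energy_dissipation:
  assumes "t \<in> {0<..T}"
  shows "((\<lambda>s. elastic_energy lam (graph_curve u s)) has_real_derivative
      - integral_ds (graph_curve u t) (\<lambda>x. (norm (normal_velocity T (graph_curve u) t x))\<^sup>2))
    (at t within {0..T})"
proof -
  have t: "t \<in> {0..T}" using assms by simp
  have nz: "L (fst z) (snd z) ^ n \<noteq> 0" if "z \<in> {0..1} \<times> {0..T}" for z n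
    using L_pos[of "snd z" "fst z"] that by auto
  have c: "continuous_on ({0..1} \<times> {0..T}) (\<lambda>z. D i j (fst z) (snd z))"
    "continuous_on ({0..1} \<times> {0..T}) (\<lambda>z. L (fst z) (snd z))"
    "continuous_on ({0..1} \<times> {0..T}) (\<lambda>z. Pt (fst z) (snd z))"
    "continuous_on ({0..1} \<times> {0..T}) (\<lambda>z. Qt (fst z) (snd z))"
    "continuous_on ({0..1} \<times> {0..T}) (\<lambda>z. Rt (fst z) (snd z))" for i j
    using D_cont L_cont rect_cont by (simp_all add: split_beta)
  have cont: "continuous_on ({0..1} \<times> {0..T}) (\<lambda>(x, t). (D 2 0 x t)\<^sup>2 / L x t ^ 5 + lam * L x t)"
    unfolding split_beta by (intro continuous_intros c ballI nz)
  have cont': "continuous_on ({0..1} \<times> {0..T})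
      (\<lambda>(x, t). Pt x t * D 2 1 x t - Qt x t * D 1 1 x t + lam * (Rt x t * D 1 1 x t))"
    unfolding split_beta by (intro continuous_on_add continuous_on_diff continuous_on_mult continuous_on_const c)
  have "((\<lambda>s. \<integral>x. (D 2 0 x s)\<^sup>2 / L x s ^ 5 + lam * L x s \<partial>leb_I) has_real_derivative
      (\<integral>x. Pt x t * D 2 1 x t - Qt x t * D 1 1 x t + lam * (Rt x t * D 1 1 x t) \<partial>leb_I)) (at t within {0..T})"
    by (rule integral_param_has_derivative[OF cont cont' energy_density_deriv t])
  also have "(\<integral>x. Pt x t * D 2 1 x t - Qt x t * D 1 1 x t + lam * (Rt x t * D 1 1 x t) \<partial>leb_I)
      = (\<integral>x. gradt lam x t * D 0 1 x t \<partial>leb_I) + Pt 1 t * D 1 1 1 t - Pt 0 t * D 1 1 0 t"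
    unfolding Pt_def Qt_def Rt_def gradt_def
  proof (rule graph_jet.first_variation(1)[OF jet[OF t]])
    \<comment> \<open>\<open>D 1 1\<close> and \<open>D 2 1\<close> came in as time derivatives of
      u' and u'' and serve here as space derivatives of the velocity; the interchange of mixed
      partials is built into the family \<open>D\<close>.\<close>
    show "((\<lambda>x. D 0 1 x t) has_real_derivative D 1 1 x t) (at x within {0..1})" if "x \<in> {0..1}" for x
      using D_x[OF that t, of 0 1] by simp
    show "((\<lambda>x. D 1 1 x t) has_real_derivative D 2 1 x t) (at x within {0..1})" if "x \<in> {0..1}" for x
      using D_x[OF that t, of 1 1] by (simp add: numeral_2_eq_2)
  qed (use boundary_velocity[OF t] D_cont_x[OF t] in auto)
  also have "\<dots> = - (\<integral>x. (D 0 1 x t)\<^sup>2 / L x t \<partial>leb_I)"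
    using boundary_moment_eq_0[OF assms] dissipation[OF assms] by simp
  \<comment> \<open>The squared speed carries 1/L^2, and one factor is cancelled by the length
    element.\<close>
  also have "(\<integral>x. (D 0 1 x t)\<^sup>2 / L x t \<partial>leb_I)
      = integral_ds (graph_curve u t) (\<lambda>x. (norm (normal_velocity T (graph_curve u) t x))\<^sup>2)"
    unfolding integral_ds_def
  proof (rule Bochner_Integration.integral_cong[OF refl])
    fix x assume "x \<in> space leb_I"
    then have x: "x \<in> {0..1}" by simp
    have "L x t \<noteq> 0" using L_pos[OF t, of x] by simp
    moreover have "norm (deriv_x (graph_curve u t) x) = L x t"
      using graph_jet.norm_deriv_x_graph[OF jet[OF t] x] by (simp add: graph_curve_def L_def)
    moreover have "norm (graph_jet.normal (\<lambda>x. D 1 0 x t) x) = 1"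
      by (rule graph_jet.norm_normal[OF jet[OF t]])
    ultimately show "(D 0 1 x t)\<^sup>2 / L x t
        = (norm (normal_velocity T (graph_curve u) t x))\<^sup>2 * norm (deriv_x (graph_curve u t) x)"
      by (simp add: normal_velocity_graph[OF x t] power_divide power2_eq_square)
  qed
  finally show ?thesis
  proof (rule has_real_derivative_transform[OF t, rotated])
    fix s assume s: "s \<in> {0..T}"
    show "elastic_energy lam (graph_curve u s) = (\<integral>x. (D 2 0 x s)\<^sup>2 / L x s ^ 5 + lam * L x s \<partial>leb_I)"
      using graph_jet.elastic_energy_graph[OF jet[OF s], of lam]
        continuous_integral_Ioo[OF continuous_on_section(1)[OF cont s]]
      by (simp add: graph_curve_def L_def)
  qed
qed

end

theorem mainTheorem2:
  fixes lam T :: real and \<psi> u0 :: "real \<Rightarrow> real" and u :: "real \<Rightarrow> real \<Rightarrow> real"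
  assumes "lam \<ge> 0"
    and "continuous_on {0..1} \<psi>"
    and "\<psi> 0 < 0"
    and "\<psi> 1 < 0"
    and "u0 \<in> K_set \<psi>"
    and "T > 0"
    and "weak_solution lam \<psi> T u0 u"
    and "smooth_closed_rect T u"
  shows "(\<forall>x\<in>I01. \<forall>t\<in>{0..T}. u x t \<ge> \<psi> x)
    \<and> (\<forall>t\<in>{0<..T}. \<forall>\<eta>\<in>test_fun2 (noncoincidence_set \<psi> u t).
         integral_ds (graph_curve u t) (\<lambda>x. normal_velocity T (graph_curve u) t x \<bullet> \<eta> x)
         = - integral_ds (graph_curve u t) (\<lambda>x. grad_energy lam (graph_curve u t) x \<bullet> \<eta> x))
    \<and> (\<forall>t\<in>{0..T}. graph_curve u t 0 = (0, 0) \<and> graph_curve u t 1 = (1, 0))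
    \<and> (\<forall>t\<in>{0<..T}. curvature (graph_curve u t) 0 = 0 \<and> curvature (graph_curve u t) 1 = 0)
    \<and> (\<forall>t\<in>{0<..T}.
         ((\<lambda>s. elastic_energy lam (graph_curve u s)) has_real_derivative
            - integral_ds (graph_curve u t) (\<lambda>x. (norm (normal_velocity T (graph_curve u) t x))\<^sup>2))
         (at t within {0..T}))"
proof -
  from assms(8) obtain D :: "nat \<Rightarrow> nat \<Rightarrow> real \<Rightarrow> real \<Rightarrow> real" where D:
    "\<forall>x\<in>{0..1}. \<forall>t\<in>{0..T}. D 0 0 x t = u x t"
    "\<forall>i j. continuous_on ({0..1} \<times> {0..T}) (\<lambda>(x, t). D i j x t) \<and>
      (\<forall>x\<in>{0..1}. \<forall>t\<in>{0..T}.
        ((\<lambda>y. D i j y t) has_real_derivative D (Suc i) j x t) (at x within {0..1}) \<and>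
        ((\<lambda>s. D i j x s) has_real_derivative D i (Suc j) x t) (at t within {0..T}))"
    unfolding smooth_closed_rect_def by blast
  interpret obstacle_solution T u D lam \<psi> u0
    by unfold_locales (use D assms in blast)+
  show ?thesis
    using above_obstacle gradient_flow boundary_values boundary_curvature energy_dissipation
    by (auto simp: graph_curve_def)
qed

end
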